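(* Consider stochastic online scheduling on $m$ unrelated machines with immediate dispatch, where every squared coefficient of variation satisfies $\mathrm{CV}[\bm p_{ij}]^2=\mathrm{Var}[\bm p_{ij}]/\mathrm E[\bm p_{ij}]^2\le\Delta$. Then: (1) The GA-RSOS policy satisfies, for every scheduling policy $\Pi$ and every fixed-assignment policy $\mathrm{FA}$, $\mathrm E[\sum_j w_j\bm C_j^{\mathrm{GA\text-RSOS}}]\le(8+4\Delta)\mathrm E[\sum_j w_j\bm C_j^{\Pi}]$ and $\mathrm E[\sum_j w_j\bm C_j^{\mathrm{GA\text-RSOS}}]\le 8\,\mathrm E[\sum_j w_j\bm C_j^{\mathrm{FA}}]$ (expectation also over the policy's randomness). (2) The GA-DSOS policy satisfies, for every scheduling policy $\Pi$ and every fixed-assignment policy $\mathrm{FA}$, $\mathrm E[\sum_j w_j\bm C_j^{\mathrm{GA\text-DSOS}}]\le(3+\sqrt5)(2+\Delta)\mathrm E[\sum_j w_j\bm C_j^{\Pi}]$ and $\mathrm E[\sum_j w_j\bm C_j^{\mathrm{GA\text-DSOS}}]\le 2(3+\sqrt5)\mathrm E[\sum_j w_j\bm C_j^{\mathrm{FA}}]$.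
   Context: Problem: $n$ jobs, $m$ machines. Job $j$ has weight $w_j\ge0$, release date $r_j\ge0$, and on machine $i$ a non-negative random processing time $\bm p_{ij}$ with known distribution and $\bar p_{ij}:=\mathrm E[\bm p_{ij}]>0$; processing times of different jobs are independent. Each job must be processed non-preemptively on one machine, not before $r_j$; each machine processes at most one job at a time. A scheduling policy is non-anticipative (decisions at time $t$ depend only on the input data and the processing times of jobs completed by $t$); it may know all jobs in advance. A fixed-assignment policy is one whose assignment of jobs to machines does not depend on the processing time realizations. $\bm C_j^\Pi$ is the completion time of $j$ under $\Pi$. Single-machine notions: for jobs assigned to machine $i$, the deterministic counterpart of $j$ has processing time $\bar p_{ij}$; the preemptive WSPT schedule processes at every time the released unfinished job with largest ratio $w_j/\bar p_{ij}$ (ratio of weight to total processing time). For a preemptive schedule, $I_j(t)\in\{0,1\}$ indicates processing of $j$ at $t$, and the mean busy time is $M_j:=\frac1{\bar p_{ij}}\int_0^\infty I_j(t)t\,\mathrm dt$. The $\alpha$-point of $j$ is the first time at which an $\alpha$-fraction of its deterministic counterpart has been processed in this preemptive WSPT schedule. Greedy assignment: when job $j$ is released, it is immediately and irrevocably assigned to a machine $i$ minimizing the increase $\mathrm{cost}(j\to i)$ of $\sum_{k\text{ assigned to }i}w_k(M_k^{\mathrm S_i^{\mathrm p}}+\bar p_{ik}/2)$, where $\mathrm S_i^{\mathrm p}$ is the virtual preemptive WSPT schedule of the deterministic counterparts of the jobs assigned to $i$. On each machine, the jobs assigned to it are then scheduled by: GA-RSOS: each job $j$ draws $\bm\alpha_j$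 uniformly from $(0,1]$ independently at release, and is appended to a FIFO queue of its machine when its $\bm\alpha_j$-point is reached in the virtual schedule; the machine processes its queue in FIFO order without idling while the queue is nonempty. GA-DSOS: the same with $\alpha_j=\phi-1$, $\phi=(1+\sqrt5)/2$. *)

theory Defs
  imports "HOL-Probability.Probability"
begin

text \<open>
  Jobs are \<open>0, \<dots>, njobs I - 1\<close> and machines are \<open>0, \<dots>, nmach I - 1\<close>; \<open>ptime I i j\<close> is the
  random processing time of job \<open>j\<close> on machine \<open>i\<close>, living on the probability space \<open>prb I\<close>.
\<close>

record 'a sos =
  njobs :: nat
  nmach :: nat
  wt :: "nat \<Rightarrow> real"
  rel :: "nat \<Rightarrow> real"
  prb :: "'a measure"
  ptime :: "nat \<Rightarrow> nat \<Rightarrow> 'a \<Rightarrow> real"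

definition pbar :: "'a sos \<Rightarrow> nat \<Rightarrow> nat \<Rightarrow> real" where
  "pbar I i j = (LINT \<omega>|prb I. ptime I i j \<omega>)"

text \<open>
  Independence is between different jobs only: the vectors \<open>(p\<^sub>i\<^sub>j)\<^sub>i\<close> are independent over \<open>j\<close>, while
  the processing times of one job on different machines may be arbitrarily dependent.
\<close>

definition sos_instance :: "'a sos \<Rightarrow> bool" where
  "sos_instance I \<longleftrightarrow>
     prob_space (prb I) \<and>
     (\<forall>j<njobs I. 0 \<le> wt I j \<and> 0 \<le> rel I j) \<and>
     (\<forall>i<nmach I. \<forall>j<njobs I.
        integrable (prb I) (ptime I i j) \<and>
        (\<forall>\<omega>\<in>space (prb I). 0 \<le> ptime I i j \<omega>) \<and>
        0 < pbar I i j) \<and>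
     prob_space.indep_vars (prb I) (\<lambda>j. \<Pi>\<^sub>M i\<in>{..<nmach I}. borel)
       (\<lambda>j \<omega>. \<lambda>i\<in>{..<nmach I}. ptime I i j \<omega>) {..<njobs I}"

definition sqCV :: "'a sos \<Rightarrow> nat \<Rightarrow> nat \<Rightarrow> real" where
  "sqCV I i j = (LINT \<omega>|prb I. (ptime I i j \<omega> - pbar I i j)\<^sup>2) / (pbar I i j)\<^sup>2"

text \<open>
  The Bochner integral of a non-integrable function is \<open>0\<close>, so finiteness of the variance has to be
  required explicitly.
\<close>

definition sqCV_bounded :: "'a sos \<Rightarrow> real \<Rightarrow> bool" where
  "sqCV_bounded I \<Delta> \<longleftrightarrow>
     (\<forall>i<nmach I. \<forall>j<njobs I.
        integrable (prb I) (\<lambda>\<omega>. (ptime I i j \<omega>)\<^sup>2) \<and> sqCV I i j \<le> \<Delta>)"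


subsection \<open>Scheduling policies\<close>

text \<open>
  A realization maps a pair (machine, job) to a processing time; a schedule maps a job to its
  machine and its start time.
\<close>

type_synonym realization = "nat \<times> nat \<Rightarrow> real"
type_synonym schedule = "nat \<Rightarrow> nat \<times> real"

definition realizations :: "'a sos \<Rightarrow> realization measure" where
  "realizations I = (\<Pi>\<^sub>M ij\<in>{..<nmach I} \<times> {..<njobs I}. restrict_space borel {0..})"

definition realized :: "'a sos \<Rightarrow> 'a \<Rightarrow> realization" where
  "realized I \<omega> = (\<lambda>(i, j)\<in>{..<nmach I} \<times> {..<njobs I}. ptime I i j \<omega>)"

definition completion :: "realization \<Rightarrow> schedule \<Rightarrow> nat \<Rightarrow> real" where
  "completion p s j = snd (s j) + p (fst (s j), j)"

definition feasible :: "'a sos \<Rightarrow> realization \<Rightarrow> schedule \<Rightarrow> bool" where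
  "feasible I p s \<longleftrightarrow>
     (\<forall>j<njobs I. fst (s j) < nmach I \<and> rel I j \<le> snd (s j)) \<and>
     (\<forall>j<njobs I. \<forall>k<njobs I. j \<noteq> k \<and> fst (s j) = fst (s k) \<longrightarrow>
        completion p s j \<le> snd (s k) \<or> completion p s k \<le> snd (s j))"

text \<open>
  \<open>q\<close> cannot be told apart from \<open>p\<close> by what has been observed up to time \<open>t\<close> when schedule \<open>s\<close> is
  carried out under \<open>p\<close>: jobs completed by \<open>t\<close> have the same processing time, and jobs
  started but not completed by \<open>t\<close> would not be completed by \<open>t\<close> under \<open>q\<close> either.
\<close>

definition indistinguishable ::
    "'a sos \<Rightarrow> schedule \<Rightarrow> real \<Rightarrow> realization \<Rightarrow> realization \<Rightarrow> bool" where
  "indistinguishable I s t p q \<longleftrightarrow>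
     (\<forall>j<njobs I. snd (s j) \<le> t \<longrightarrow>
        (if completion p s j \<le> t then q (fst (s j), j) = p (fst (s j), j)
         else t < completion q s j))"

definition nonanticipative :: "'a sos \<Rightarrow> (realization \<Rightarrow> schedule) \<Rightarrow> bool" where
  "nonanticipative I \<pi> \<longleftrightarrow>
     (\<forall>p\<in>space (realizations I). \<forall>q\<in>space (realizations I). \<forall>t.
        indistinguishable I (\<pi> p) t p q \<longrightarrow>
        (\<forall>j<njobs I. snd (\<pi> p j) \<le> t \<or> snd (\<pi> q j) \<le> t \<longrightarrow> \<pi> q j = \<pi> p j))"

text \<open>
  Policies may be randomized: \<open>pol u\<close> is the deterministic policy used for the seed \<open>u\<close>, which is drawn
  from \<open>N\<close> independently of the processing times.
\<close>

definition scheduling_policy ::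
    "'a sos \<Rightarrow> 'u measure \<Rightarrow> ('u \<Rightarrow> realization \<Rightarrow> schedule) \<Rightarrow> bool" where
  "scheduling_policy I N pol \<longleftrightarrow>
     prob_space N \<and>
     (\<forall>u\<in>space N. nonanticipative I (pol u) \<and>
        (\<forall>p\<in>space (realizations I). feasible I p (pol u p))) \<and>
     (\<forall>j<njobs I. (\<lambda>(u, p). pol u p j)
        \<in> N \<Otimes>\<^sub>M realizations I \<rightarrow>\<^sub>M count_space UNIV \<Otimes>\<^sub>M borel)"

definition fixed_assignment_policy ::
    "'a sos \<Rightarrow> 'u measure \<Rightarrow> ('u \<Rightarrow> realization \<Rightarrow> schedule) \<Rightarrow> bool" where
  "fixed_assignment_policy I N pol \<longleftrightarrow>
     scheduling_policy I N pol \<and>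
     (\<forall>u\<in>space N. \<forall>p\<in>space (realizations I). \<forall>q\<in>space (realizations I). \<forall>j<njobs I.
        fst (pol u p j) = fst (pol u q j))"

text \<open>Expected costs are extended non-negative reals, since a policy may have infinite cost.\<close>

definition exp_cost :: "'a sos \<Rightarrow> (realization \<Rightarrow> schedule) \<Rightarrow> ennreal" where
  "exp_cost I \<pi> =
     (\<integral>\<^sup>+\<omega>. ennreal (\<Sum>j<njobs I. wt I j * completion (realized I \<omega>) (\<pi> (realized I \<omega>)) j) \<partial>prb I)"

definition randomized_exp_cost ::
    "'a sos \<Rightarrow> 'u measure \<Rightarrow> ('u \<Rightarrow> realization \<Rightarrow> schedule) \<Rightarrow> ennreal" where
  "randomized_exp_cost I N pol = (\<integral>\<^sup>+u. exp_cost I (pol u) \<partial>N)"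


subsection \<open>Virtual preemptive WSPT schedules\<close>

text \<open>A preemptive single-machine schedule gives the job processed at each time, if any.\<close>

type_synonym preemptive_schedule = "real \<Rightarrow> nat option"

definition busy :: "preemptive_schedule \<Rightarrow> nat \<Rightarrow> real \<Rightarrow> real" where
  "busy \<sigma> j t = (if \<sigma> t = Some j then 1 else 0)"

definition processed :: "preemptive_schedule \<Rightarrow> nat \<Rightarrow> real \<Rightarrow> real" where
  "processed \<sigma> j t = (LBINT s:{0..t}. busy \<sigma> j s)"

text \<open>\<open>tie i\<close> ranks the jobs in order to break ties between equal ratios on machine \<open>i\<close>.\<close>

definition tie_breaking :: "'a sos \<Rightarrow> (nat \<Rightarrow> nat \<Rightarrow> nat) \<Rightarrow> bool" where
  "tie_breaking I tie \<longleftrightarrow> (\<forall>i<nmach I. inj_on (tie i) {..<njobs I})"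

definition higher_priority ::
    "'a sos \<Rightarrow> (nat \<Rightarrow> nat \<Rightarrow> nat) \<Rightarrow> nat \<Rightarrow> nat \<Rightarrow> nat \<Rightarrow> bool" where
  "higher_priority I tie i j k \<longleftrightarrow>
     wt I j / pbar I i j > wt I k / pbar I i k \<or>
     wt I j / pbar I i j = wt I k / pbar I i k \<and> tie i j < tie i k"

definition available ::
    "'a sos \<Rightarrow> nat \<Rightarrow> nat set \<Rightarrow> preemptive_schedule \<Rightarrow> nat \<Rightarrow> real \<Rightarrow> bool" where
  "available I i J \<sigma> j t \<longleftrightarrow> j \<in> J \<and> rel I j \<le> t \<and> processed \<sigma> j t < pbar I i j"

definition preemptive_WSPT ::
    "'a sos \<Rightarrow> (nat \<Rightarrow> nat \<Rightarrow> nat) \<Rightarrow> nat \<Rightarrow> nat set \<Rightarrow> preemptive_schedule \<Rightarrow> bool" where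
  "preemptive_WSPT I tie i J \<sigma> \<longleftrightarrow>
     \<sigma> \<in> borel \<rightarrow>\<^sub>M count_space UNIV \<and>
     (\<forall>t j. \<sigma> t = Some j \<longleftrightarrow>
        available I i J \<sigma> j t \<and>
        (\<forall>k. available I i J \<sigma> k t \<and> k \<noteq> j \<longrightarrow> higher_priority I tie i j k))"

text \<open>
  For valid instances, injective \<open>tie i\<close> and \<open>J \<subseteq> {..<njobs I}\<close> there is exactly one such schedule
  (induct on \<open>J\<close>, adding the job of lowest priority).
\<close>

definition virtual_schedule ::
    "'a sos \<Rightarrow> (nat \<Rightarrow> nat \<Rightarrow> nat) \<Rightarrow> nat \<Rightarrow> nat set \<Rightarrow> preemptive_schedule" where
  "virtual_schedule I tie i J = (THE \<sigma>. preemptive_WSPT I tie i J \<sigma>)"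

definition mean_busy_time :: "'a sos \<Rightarrow> nat \<Rightarrow> preemptive_schedule \<Rightarrow> nat \<Rightarrow> real" where
  "mean_busy_time I i \<sigma> j = 1 / pbar I i j * (LBINT t:{0..}. busy \<sigma> j t * t)"

definition alpha_point :: "'a sos \<Rightarrow> nat \<Rightarrow> preemptive_schedule \<Rightarrow> nat \<Rightarrow> real \<Rightarrow> real" where
  "alpha_point I i \<sigma> j \<alpha> = Inf {t. 0 \<le> t \<and> \<alpha> * pbar I i j \<le> processed \<sigma> j t}"


subsection \<open>Greedy assignment\<close>

definition virtual_cost :: "'a sos \<Rightarrow> (nat \<Rightarrow> nat \<Rightarrow> nat) \<Rightarrow> nat \<Rightarrow> nat set \<Rightarrow> real" where
  "virtual_cost I tie i J =
     (\<Sum>k\<in>J. wt I k * (mean_busy_time I i (virtual_schedule I tie i J) k + pbar I i k / 2))"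

text \<open>
  \<open>arr\<close> ranks the jobs in the order in which they are dispatched; it follows the release dates, with
  an arbitrary order among jobs released at the same time.
\<close>

definition arrival_order :: "'a sos \<Rightarrow> (nat \<Rightarrow> nat) \<Rightarrow> bool" where
  "arrival_order I arr \<longleftrightarrow>
     inj_on arr {..<njobs I} \<and>
     (\<forall>j<njobs I. \<forall>k<njobs I. rel I j < rel I k \<longrightarrow> arr j < arr k)"

definition assigned_before :: "'a sos \<Rightarrow> (nat \<Rightarrow> nat) \<Rightarrow> (nat \<Rightarrow> nat) \<Rightarrow> nat \<Rightarrow> nat \<Rightarrow> nat set" where
  "assigned_before I arr a j i = {k. k < njobs I \<and> arr k < arr j \<and> a k = i}"

definition cost_increase ::
    "'a sos \<Rightarrow> (nat \<Rightarrow> nat \<Rightarrow> nat) \<Rightarrow> (nat \<Rightarrow> nat) \<Rightarrow> (nat \<Rightarrow> nat) \<Rightarrow> nat \<Rightarrow> nat \<Rightarrow> real" where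
  "cost_increase I tie arr a j i =
     virtual_cost I tie i (insert j (assigned_before I arr a j i)) -
     virtual_cost I tie i (assigned_before I arr a j i)"

text \<open>A relation rather than a function, so that ties between machines are broken arbitrarily.\<close>

definition greedy_assignment ::
    "'a sos \<Rightarrow> (nat \<Rightarrow> nat \<Rightarrow> nat) \<Rightarrow> (nat \<Rightarrow> nat) \<Rightarrow> (nat \<Rightarrow> nat) \<Rightarrow> bool" where
  "greedy_assignment I tie arr a \<longleftrightarrow>
     (\<forall>j<njobs I. a j < nmach I \<and>
        (\<forall>i<nmach I. cost_increase I tie arr a j (a j) \<le> cost_increase I tie arr a j i))"


subsection \<open>The policies GA-RSOS and GA-DSOS\<close>

definition queue_time ::
    "'a sos \<Rightarrow> (nat \<Rightarrow> nat \<Rightarrow> nat) \<Rightarrow> (nat \<Rightarrow> nat) \<Rightarrow> (nat \<Rightarrow> real) \<Rightarrow> nat \<Rightarrow> real" where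
  "queue_time I tie a \<alpha> j =
     alpha_point I (a j) (virtual_schedule I tie (a j) {k. k < njobs I \<and> a k = a j}) j (\<alpha> j)"

text \<open>
  \<open>fifo_start e d t ks j\<close> is the start time of job \<open>j\<close> on a machine that is free from time \<open>t\<close> on and
  processes the jobs \<open>ks\<close>, listed by the time \<open>e\<close> at which they enter the queue, with
  durations \<open>d\<close>.
\<close>

fun fifo_start ::
    "(nat \<Rightarrow> real) \<Rightarrow> (nat \<Rightarrow> real) \<Rightarrow> real \<Rightarrow> nat list \<Rightarrow> nat \<Rightarrow> real" where
  "fifo_start e d t [] j = 0"
| "fifo_start e d t (k # ks) j =
     (let s = max t (e k) in if j = k then s else fifo_start e d (s + d k) ks j)"

text \<open>
  Different jobs on one machine have different \<open>\<alpha>\<close>-points when all \<open>\<alpha>\<close> are positive, so the order of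
  the queue is unambiguous.
\<close>

definition ga_policy ::
    "'a sos \<Rightarrow> (nat \<Rightarrow> nat \<Rightarrow> nat) \<Rightarrow> (nat \<Rightarrow> nat) \<Rightarrow> (nat \<Rightarrow> real) \<Rightarrow> realization \<Rightarrow> schedule" where
  "ga_policy I tie a \<alpha> p j =
     (a j,
      fifo_start (queue_time I tie a \<alpha>) (\<lambda>k. p (a j, k)) 0
        (sort_key (queue_time I tie a \<alpha>) (filter (\<lambda>k. a k = a j) [0..<njobs I])) j)"

definition alpha_distribution :: "'a sos \<Rightarrow> (nat \<Rightarrow> real) measure" where
  "alpha_distribution I = (\<Pi>\<^sub>M j\<in>{..<njobs I}. uniform_measure lborel {0<..1})"

definition cost_GA_RSOS ::
    "'a sos \<Rightarrow> (nat \<Rightarrow> nat \<Rightarrow> nat) \<Rightarrow> (nat \<Rightarrow> nat) \<Rightarrow> ennreal" where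
  "cost_GA_RSOS I tie a = randomized_exp_cost I (alpha_distribution I) (ga_policy I tie a)"

definition golden_ratio :: real where
  "golden_ratio = (1 + sqrt 5) / 2"

definition cost_GA_DSOS ::
    "'a sos \<Rightarrow> (nat \<Rightarrow> nat \<Rightarrow> nat) \<Rightarrow> (nat \<Rightarrow> nat) \<Rightarrow> ennreal" where
  "cost_GA_DSOS I tie a = exp_cost I (ga_policy I tie a (\<lambda>j. golden_ratio - 1))"

end

theory Submission
  imports Defs
begin

text \<open>
  Both bounds compare with the virtual cost \<open>V\<close>, the sum of \<open>w\<^sub>j * (M\<^sub>j + p\<^sub>j / 2)\<close> over all jobs in the
  virtual schedules.

  \<^emph>\<open>Upper bounds.\<close> A job completes at most after its \<open>\<alpha>\<close>-point plus the processing times of the jobs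
  queued no later than itself. For random \<open>\<alpha>\<close>, the expected \<open>\<alpha>\<close>-point is \<open>M\<^sub>j\<close>, and the expected length
  of the queue at time \<open>t\<close> is the work done by time \<open>t\<close>, which gives \<open>2 * M\<^sub>j + p\<^sub>j\<close> and hence \<open>2 * V\<close>. For
  fixed \<open>\<alpha>\<close>, splitting the weights into layers of equal ratio \<open>w\<^sub>j / p\<^sub>j\<close> and time into busy periods of
  each layer gives the factor \<open>max (1 + 1 / \<alpha>) (2 + \<alpha>)\<close>, which is minimal for \<open>\<alpha> = \<phi> - 1\<close>.

  \<^emph>\<open>Lower bounds.\<close> Let \<open>Y\<^sub>i t\<close> be the weight not yet processed at time \<open>t\<close> in the virtual schedule of
  machine \<open>i\<close>. Assigning \<open>j\<close> to \<open>i\<close> costs at most \<open>w\<^sub>j * (T + p\<^sub>i\<^sub>j) + p\<^sub>i\<^sub>j * Y\<^sub>i T\<close> for every \<open>T\<close> after the release of \<open>j\<close>.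
  Taking \<open>T = 2 * t\<close> and averaging over the times \<open>t\<close> at which a competing policy processes \<open>j\<close> bounds \<open>V\<close>
  by \<open>(2 + \<Delta>)\<close> times the cost of the policy plus \<open>V / 2\<close>, because a non-anticipative policy chooses
  machine and start of \<open>j\<close> independently of the processing times of \<open>j\<close>. For a fixed-assignment policy, the
  competing schedule is replaced by the preemptive WSPT schedule of its own assignment, whose virtual cost is a
  lower bound on the expected cost of the policy, and \<open>\<Delta>\<close> disappears.
\<close>

text \<open>Availability in a virtual schedule refers to the amount already processed, so the
  schedule is given only as the solution of a fixed-point equation. The proof never follows single
  preemptions; it uses one formula. If the machine always works on \<open>U\<close> while a released
  job of \<open>U\<close> is unfinished, the unprocessed work of \<open>U\<close> at time t is the
  maximum over s in [0, t] of the total requirement of the jobs of \<open>U\<close> released at s or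
  later, minus t - s. The jobs with ratio above a threshold form such a set \<open>U\<close>, and
  weighted costs are nonnegative combinations over thresholds. Origin of the constants: a policy
  that runs j during [S, S + p) has first moment S * p + p^2 / 2, so the square of a random time
  appears and is bounded through \<open>\<Delta>\<close>. The virtual schedule of a fixed assignment
  runs deterministic counterparts, and comparing it with the policy averages only products of
  independent quantities. Absorbing V / 2 doubles the factors, so V is at most 4 + 2 *
  \<open>\<Delta>\<close> or 4 times the competing cost. The value \<open>\<alpha>\<close> =
  \<open>\<phi>\<close> - 1 solves 1 + 1 / \<open>\<alpha>\<close> = 2 +
  \<open>\<alpha>\<close>.\<close>

section \<open>Lebesgue measure of a set of times up to a given time\<close>

definition amount :: "real set \<Rightarrow> real \<Rightarrow> real" where
  "amount A t = measure lborel (A \<inter> {0..t})"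

lemma emeasure_Int_Icc_finite:
  fixes A :: "real set"
  shows "emeasure lborel (A \<inter> {a..b}) \<noteq> \<infinity>"
proof -
  have "emeasure lborel (A \<inter> {a..b}) \<le> emeasure lborel {a..b}"
    by (intro emeasure_mono) auto
  also have "\<dots> < \<infinity>" by (cases "a \<le> b") (auto simp: less_top[symmetric])
  finally show ?thesis by simp
qed

lemma fmeasurable_Int_Icc: "A \<in> sets borel \<Longrightarrow> A \<inter> {a..b} \<in> fmeasurable (lborel :: real measure)"
  using emeasure_Int_Icc_finite[of A a b] by (auto simp: fmeasurable_def less_top)

lemma amount_nonneg: "0 \<le> amount A t"
  by (simp add: amount_def)

lemma amount_mono_set: "A \<subseteq> B \<Longrightarrow> A \<in> sets borel \<Longrightarrow> B \<in> sets borel \<Longrightarrow> amount A t \<le> amount B t"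
  unfolding amount_def by (intro measure_mono_fmeasurable fmeasurable_Int_Icc) auto

lemma amount_diff:
  assumes "A \<in> sets borel" "0 \<le> s" "s \<le> t"
  shows "amount A t - amount A s = measure lborel (A \<inter> {s<..t})"
proof -
  have f: "A \<inter> {s<..t} \<in> fmeasurable lborel"
    by (rule fmeasurableI2[OF fmeasurable_Int_Icc[of A s t]]) (use assms in auto)
  have "A \<inter> {0..t} = (A \<inter> {0..s}) \<union> (A \<inter> {s<..t})" using assms by auto
  moreover have "measure lborel ((A \<inter> {0..s}) \<union> (A \<inter> {s<..t})) =
      measure lborel (A \<inter> {0..s}) + measure lborel (A \<inter> {s<..t})"
    using assms f fmeasurable_Int_Icc[OF assms(1), of 0 s]
    by (intro measure_Union) (auto simp: fmeasurable_def)
  ultimately show ?thesis by (simp add: amount_def)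
qed

lemma amount_mono:
  assumes "A \<in> sets borel" "s \<le> t"
  shows "amount A s \<le> amount A t"
  unfolding amount_def using assms
  by (intro measure_mono_fmeasurable fmeasurable_Int_Icc) auto

lemma amount_nonpos: "t \<le> 0 \<Longrightarrow> amount A t = 0"
proof -
  assume "t \<le> 0"
  have "measure lborel (A \<inter> {0..t}) \<le> measure lborel {0::real}"
  proof (cases "A \<inter> {0..t} \<in> sets lborel")
    case True
    then show ?thesis using \<open>t \<le> 0\<close>
      by (intro measure_mono_fmeasurable) (auto simp: fmeasurable_def)
  qed (simp add: measure_notin_sets)
  then show ?thesis by (simp add: amount_def measure_le_0_iff)
qed

lemma amount_diff_le:
  assumes "A \<in> sets borel" "s \<le> t"
  shows "amount A t - amount A s \<le> t - s"
proof -
  have *: "amount A t - amount A s \<le> t - s" if "0 \<le> s" "s \<le> t" for s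
  proof -
    have "measure lborel (A \<inter> {s<..t}) \<le> measure lborel {s<..t}"
      using that assms(1) by (intro measure_mono_fmeasurable) (auto simp: fmeasurable_def)
    then show ?thesis using amount_diff[OF assms(1) that] that by simp
  qed
  consider "t \<le> 0" | "0 \<le> s" | "s < 0" "0 < t" by linarith
  then show ?thesis
  proof cases
    case 3
    then show ?thesis using *[of 0] by (simp add: amount_nonpos)
  qed (use * assms in \<open>auto simp: amount_nonpos\<close>)
qed

lemma amount_diff_full:
  assumes "A \<in> sets borel" "0 \<le> s" "s \<le> t" "{s<..<t} \<subseteq> A"
  shows "amount A t - amount A s = t - s"
proof -
  have "measure lborel {s<..<t} \<le> measure lborel (A \<inter> {s<..t})"
    using assms by (intro measure_mono_fmeasurable fmeasurableI2[OF fmeasurable_Int_Icc[of A s t]]) auto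
  then show ?thesis
    using amount_diff[OF assms(1-3)] amount_diff_le[OF assms(1,3)] assms(3) by simp
qed

lemma amount_diff_none:
  assumes "A \<in> sets borel" "0 \<le> s" "s \<le> t" "A \<inter> {s<..<t} = {}"
  shows "amount A t = amount A s"
proof -
  have "A \<inter> {s<..t} \<subseteq> {t}" using assms(4) by force
  then have "measure lborel (A \<inter> {s<..t}) \<le> measure lborel {t}"
    using assms(1) by (intro measure_mono_fmeasurable) (auto simp: fmeasurable_def)
  then show ?thesis using amount_diff[OF assms(1-3)] by (simp add: measure_le_0_iff)
qed

lemma amount_UN:
  assumes "finite K" "\<And>k. k \<in> K \<Longrightarrow> A k \<in> sets borel" "disjoint_family_on A K"
  shows "amount (\<Union>k\<in>K. A k) t = (\<Sum>k\<in>K. amount (A k) t)"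
proof -
  have "(\<Union>k\<in>K. A k) \<inter> {0..t} = (\<Union>k\<in>K. A k \<inter> {0..t})" by auto
  also have "measure lborel \<dots> = (\<Sum>k\<in>K. measure lborel (A k \<inter> {0..t}))"
    using assms emeasure_Int_Icc_finite
    by (intro measure_finite_Union) (auto simp: disjoint_family_on_def)
  finally show ?thesis by (simp add: amount_def)
qed

lemma amount_lipschitz: "A \<in> sets borel \<Longrightarrow> \<bar>amount A t - amount A s\<bar> \<le> \<bar>t - s\<bar>"
  using amount_diff_le[of A s t] amount_diff_le[of A t s] amount_mono[of A s t] amount_mono[of A t s]
  by (cases "s \<le> t") auto

lemma continuous_on_amount: "A \<in> sets borel \<Longrightarrow> continuous_on S (amount A)"
  unfolding continuous_on_iff dist_real_def
  using amount_lipschitz[of A] by (meson le_less_trans)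

lemma borel_measurable_amount[measurable]: "A \<in> sets borel \<Longrightarrow> amount A \<in> borel_measurable borel"
  by (intro borel_measurable_continuous_onI continuous_on_amount)

lemma processed_eq_amount:
  "processed \<sigma> j t = amount {s. \<sigma> s = Some j} t"
proof -
  have "processed \<sigma> j t = (\<integral>s. indicator ({s. \<sigma> s = Some j} \<inter> {0..t}) s \<partial>lborel)"
    unfolding processed_def set_lebesgue_integral_def busy_def
    by (intro Bochner_Integration.integral_cong) (auto simp: indicator_def)
  then show ?thesis by (simp add: amount_def)
qed

text \<open>
  This is the fixed-point equation of a lowest-priority job with processing requirement \<open>c\<close> that may run
  only during \<open>A\<close>.
\<close>

lemma amount_truncated_less_iff:
  assumes "A \<in> sets borel" "0 < c"
  shows "amount (A \<inter> {s. amount A s < c}) t < c \<longleftrightarrow> amount A t < c"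
proof
  have B: "A \<inter> {s. amount A s < c} \<in> sets borel"
    using assms(1) borel_measurable_amount[OF assms(1)] by simp
  show "amount (A \<inter> {s. amount A s < c}) t < c" if "amount A t < c"
    using amount_mono_set[OF _ B assms(1), of t] that by auto
  show "amount A t < c" if less: "amount (A \<inter> {s. amount A s < c}) t < c"
  proof (rule ccontr)
    assume "\<not> amount A t < c"
    then have ge: "c \<le> amount A t" by simp
    then have "0 \<le> t" using assms(2) amount_nonpos[of t A] by linarith
    \<comment> \<open>Continuity of the amount yields a first time u at which it reaches c.\<close>
    have "compact {s\<in>{0..t}. c \<le> amount A s}"
    proof -
      have "closed {s\<in>{0..t}. c \<le> amount A s}"
        using continuous_closed_preimage[OF continuous_on_amount[OF assms(1), of "{0..t}"] closed_atLeastAtMost closed_atLeast[of c]]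
        by (simp add: vimage_def Int_def)
      then show ?thesis
        by (simp add: compact_eq_bounded_closed)
          (rule bounded_subset[OF bounded_closed_interval[of 0 t]], auto)
    qed
    moreover have "t \<in> {s\<in>{0..t}. c \<le> amount A s}" using ge \<open>0 \<le> t\<close> by auto
    ultimately obtain u where u: "0 \<le> u" "u \<le> t" "c \<le> amount A u"
        and least: "\<And>s. 0 \<le> s \<Longrightarrow> s \<le> t \<Longrightarrow> c \<le> amount A s \<Longrightarrow> u \<le> s"
      using compact_attains_inf[of "{s\<in>{0..t}. c \<le> amount A s}"] by auto
    \<comment> \<open>Strictly before u the truncation removes nothing, and the point u itself has
      measure zero, so the truncated set has also collected c by time u.\<close>
    have "A \<inter> {0..u} - {u} \<subseteq> A \<inter> {s. amount A s < c} \<inter> {0..u}"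
      using least u by force
    then have "measure lborel (A \<inter> {0..u} - {u}) \<le> amount (A \<inter> {s. amount A s < c}) u"
      unfolding amount_def[of "A \<inter> {s. amount A s < c}"]
      by (rule measure_mono_fmeasurable[OF _ _ fmeasurable_Int_Icc[OF B]])
        (use assms(1) in \<open>auto intro!: sets.Diff\<close>)
    moreover have "measure lborel (A \<inter> {0..u} - {u}) = amount A u"
    proof -
      have "emeasure lborel (A \<inter> {0..u} - {u}) = emeasure lborel (A \<inter> {0..u})"
        using assms(1) by (intro emeasure_Diff_null_set) (auto simp: null_sets_def)
      then show ?thesis by (simp add: amount_def measure_def)
    qed
    ultimately have "c \<le> amount (A \<inter> {s. amount A s < c}) t"
      using u amount_mono[OF B \<open>u \<le> t\<close>] by linarith
    with less show False by simp
  qed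
qed

section \<open>Existence and uniqueness of the virtual schedule\<close>

locale sos_machine =
  fixes I :: "'a sos" and tie :: "nat \<Rightarrow> nat \<Rightarrow> nat" and i :: nat
  assumes pbar_pos: "k < njobs I \<Longrightarrow> 0 < pbar I i k"
    and rel_nonneg: "k < njobs I \<Longrightarrow> 0 \<le> rel I k"
    and wt_nonneg: "k < njobs I \<Longrightarrow> 0 \<le> wt I k"
    and tie_inj: "inj_on (tie i) {..<njobs I}"
begin

abbreviation "hp \<equiv> higher_priority I tie i"

lemma hp_trans: "hp j k \<Longrightarrow> hp k l \<Longrightarrow> hp j l"
  by (auto simp: higher_priority_def)

lemma hp_asym: "hp j k \<Longrightarrow> \<not> hp k j"
  by (auto simp: higher_priority_def)

lemma hp_total: "j < njobs I \<Longrightarrow> k < njobs I \<Longrightarrow> j \<noteq> k \<Longrightarrow> hp j k \<or> hp k j"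
  using inj_onD[OF tie_inj, of j k] by (auto simp: higher_priority_def not_less order_less_le)

lemma ex_highest:
  assumes "finite A" "A \<noteq> {}" "A \<subseteq> {..<njobs I}"
  shows "\<exists>j\<in>A. \<forall>k\<in>A. k \<noteq> j \<longrightarrow> hp j k"
  using assms
proof (induction A rule: finite_ne_induct)
  case (insert x F)
  then obtain j where j: "j \<in> F" "\<forall>k\<in>F. k \<noteq> j \<longrightarrow> hp j k" by auto
  then have "hp x j \<or> hp j x" using hp_total[of x j] insert by auto
  then show ?case using j by (auto intro: hp_trans)
qed auto

lemma ex_lowest:
  assumes "finite A" "A \<noteq> {}" "A \<subseteq> {..<njobs I}"
  shows "\<exists>l\<in>A. \<forall>k\<in>A. k \<noteq> l \<longrightarrow> hp k l"
  using assms
proof (induction A rule: finite_ne_induct)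
  case (insert x F)
  then obtain j where j: "j \<in> F" "\<forall>k\<in>F. k \<noteq> j \<longrightarrow> hp k j" by auto
  then have "hp x j \<or> hp j x" using hp_total[of x j] insert by auto
  then show ?case using j by (auto intro: hp_trans)
qed auto

text \<open>A job of lowest priority never delays another job, so a schedule restricts to the
  remaining jobs. This makes it the natural job to add last in an induction on preemptive priority
  schedules.\<close>

lemma lowest_induct [consumes 2, case_names empty insert]:
  assumes "finite J" "J \<subseteq> {..<njobs I}"
    and "P {}"
    and step: "\<And>l J. finite J \<Longrightarrow> J \<subseteq> {..<njobs I} \<Longrightarrow> l < njobs I \<Longrightarrow> l \<notin> J \<Longrightarrow>
      \<forall>k\<in>J. hp k l \<Longrightarrow> P J \<Longrightarrow> P (insert l J)"
  shows "P J"
  using assms(1,2)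
proof (induction "card J" arbitrary: J)
  case 0
  then show ?case using assms(3) by auto
next
  case (Suc n)
  then have "J \<noteq> {}" by auto
  then obtain l where l: "l \<in> J" "\<forall>k\<in>J. k \<noteq> l \<longrightarrow> hp k l" 
    using ex_lowest[OF Suc.prems(1) _ Suc.prems(2)] by blast
  have "P (insert l (J - {l}))"
    using Suc l by (intro step Suc.hyps) auto
  then show ?case using l by (simp add: insert_absorb)
qed

lemma sets_busy: "\<sigma> \<in> borel \<rightarrow>\<^sub>M count_space UNIV \<Longrightarrow> {s::real. \<sigma> s = x} \<in> sets borel"
  using measurable_sets[of \<sigma> borel "count_space UNIV" "{x}"] by (simp add: vimage_def)

lemma WSPT_None_iff:
  assumes "preemptive_WSPT I tie i J \<sigma>" "J \<subseteq> {..<njobs I}"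
  shows "\<sigma> t = None \<longleftrightarrow> (\<forall>k. \<not> available I i J \<sigma> k t)"
proof
  assume "\<sigma> t = None"
  show "\<forall>k. \<not> available I i J \<sigma> k t"
  proof (rule ccontr)
    assume "\<not> ?thesis"
    then have "{k. available I i J \<sigma> k t} \<noteq> {}" by auto
    moreover have sub: "{k. available I i J \<sigma> k t} \<subseteq> {..<njobs I}"
      using assms(2) by (auto simp: available_def)
    ultimately obtain j where "available I i J \<sigma> j t" "\<forall>k. available I i J \<sigma> k t \<and> k \<noteq> j \<longrightarrow> hp j k"
      using ex_highest[of "{k. available I i J \<sigma> k t}"] finite_subset[OF sub] by auto
    then have "\<sigma> t = Some j" using assms(1) by (auto simp: preemptive_WSPT_def)
    with \<open>\<sigma> t = None\<close> show False by simp
  qed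
next
  assume "\<forall>k. \<not> available I i J \<sigma> k t"
  then show "\<sigma> t = None" using assms(1) by (cases "\<sigma> t") (auto simp: preemptive_WSPT_def)
qed

lemma processed_cong: "(\<And>s. \<sigma> s = Some k \<longleftrightarrow> \<tau> s = Some k) \<Longrightarrow> processed \<sigma> k t = processed \<tau> k t"
  by (simp add: processed_eq_amount)

text \<open>The priority conditions among the jobs of \<open>J\<close> never mention
  \<open>l\<close>: whenever one of them is available, it beats \<open>l\<close>. Idling instead of
  processing \<open>l\<close> therefore leaves a valid schedule.\<close>

lemma WSPT_remove_lowest:
  assumes "preemptive_WSPT I tie i (insert l J) \<sigma>" "l \<notin> J" "\<forall>k\<in>J. hp k l"
  shows "preemptive_WSPT I tie i J (\<lambda>t. if \<sigma> t = Some l then None else \<sigma> t)" (is "preemptive_WSPT _ _ _ _ ?\<tau>")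
proof -
  have [measurable]: "\<sigma> \<in> borel \<rightarrow>\<^sub>M count_space UNIV"
    using assms(1) by (simp add: preemptive_WSPT_def)
  have pr: "processed ?\<tau> k t = processed \<sigma> k t" if "k \<noteq> l" for k t
    using that by (intro processed_cong) auto
  have av: "available I i J ?\<tau> k t \<longleftrightarrow> available I i (insert l J) \<sigma> k t \<and> k \<noteq> l" for k t
    using assms(2) pr[of k t] by (cases "k = l") (auto simp: available_def)
  show ?thesis
    unfolding preemptive_WSPT_def
  proof (intro conjI allI)
    show "?\<tau> \<in> borel \<rightarrow>\<^sub>M count_space UNIV" by measurable
    fix t j
    have "?\<tau> t = Some j \<longleftrightarrow> \<sigma> t = Some j \<and> j \<noteq> l" by auto
    also have "\<dots> \<longleftrightarrow> available I i (insert l J) \<sigma> j t \<and> j \<noteq> l \<and>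
        (\<forall>k. available I i (insert l J) \<sigma> k t \<and> k \<noteq> j \<longrightarrow> hp j k)"
      using assms(1) by (auto simp: preemptive_WSPT_def)
    also have "\<dots> \<longleftrightarrow> available I i J ?\<tau> j t \<and>
        (\<forall>k. available I i J ?\<tau> k t \<and> k \<noteq> j \<longrightarrow> hp j k)"
      unfolding av using assms(3) by (auto simp: available_def)
    finally show "?\<tau> t = Some j \<longleftrightarrow> available I i J ?\<tau> j t \<and>
        (\<forall>k. available I i J ?\<tau> k t \<and> k \<noteq> j \<longrightarrow> hp j k)" .
  qed
qed

text \<open>The right-hand side mentions only the reduced schedule \<open>\<tau>\<close>, so
  \<open>\<tau>\<close> determines \<open>\<sigma>\<close>; this is the induction step of
  uniqueness. The lowest job runs exactly in the idle time of \<open>\<tau>\<close> after its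
  release until it has collected its requirement.\<close>

lemma WSPT_lowest_iff:
  assumes \<sigma>: "preemptive_WSPT I tie i (insert l J) \<sigma>"
    and J: "J \<subseteq> {..<njobs I}" "l < njobs I" "l \<notin> J" "\<forall>k\<in>J. hp k l"
    and \<tau>: "\<tau> = (\<lambda>t. if \<sigma> t = Some l then None else \<sigma> t)"
  shows "\<sigma> t = Some l \<longleftrightarrow> \<tau> t = None \<and> rel I l \<le> t \<and>
    amount {s. \<tau> s = None \<and> rel I l \<le> s} t < pbar I i l"
proof -
  have \<tau>W: "preemptive_WSPT I tie i J \<tau>" unfolding \<tau> by (rule WSPT_remove_lowest) fact+
  have [measurable]: "\<tau> \<in> borel \<rightarrow>\<^sub>M count_space UNIV" "\<sigma> \<in> borel \<rightarrow>\<^sub>M count_space UNIV"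
    using \<tau>W \<sigma> by (auto simp: preemptive_WSPT_def)
  define N where "N = {s. \<tau> s = None \<and> rel I l \<le> s}"
  define h where "h = processed \<sigma> l"
  have N: "N \<in> sets borel" unfolding N_def by measurable
  have pr: "processed \<tau> k t = processed \<sigma> k t" if "k \<noteq> l" for k t
    unfolding \<tau> using that by (intro processed_cong) auto
  have iff: "\<sigma> t = Some l \<longleftrightarrow> t \<in> N \<and> h t < pbar I i l" for t
  proof
    assume s: "\<sigma> t = Some l"
    then have "available I i (insert l J) \<sigma> l t" using \<sigma> by (auto simp: preemptive_WSPT_def)
    then show "t \<in> N \<and> h t < pbar I i l" using s by (auto simp: N_def \<tau> available_def h_def)
  next
    assume a: "t \<in> N \<and> h t < pbar I i l"
    then have "\<forall>k. \<not> available I i J \<tau> k t" using WSPT_None_iff[OF \<tau>W J(1)] by (auto simp: N_def)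
    then have "\<forall>k. available I i (insert l J) \<sigma> k t \<longrightarrow> k = l"
      using pr[of _ t] J(3) by (metis available_def insert_iff)
    moreover have "available I i (insert l J) \<sigma> l t" using a by (auto simp: available_def N_def h_def)
    ultimately show "\<sigma> t = Some l" using \<sigma> by (auto simp: preemptive_WSPT_def)
  qed
  have b: "{s. \<sigma> s = Some l} \<in> sets borel" by (intro sets_busy) measurable
  have hle: "h t \<le> amount N t" for t
    unfolding h_def processed_eq_amount using iff by (intro amount_mono_set b N) auto
  have "h t < pbar I i l \<longleftrightarrow> amount N t < pbar I i l"
  proof
    assume ht: "h t < pbar I i l"
    \<comment> \<open>As long as the job is unfinished it has used every available idle moment, so
      up to \<open>t\<close> its busy set coincides with \<open>N\<close>.\<close>
    have "h s < pbar I i l" if "s \<le> t" for s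
      using amount_mono[OF b that] ht by (simp add: h_def processed_eq_amount)
    then have "{s. \<sigma> s = Some l} \<inter> {0..t} = N \<inter> {0..t}" using iff by auto
    then show "amount N t < pbar I i l" using ht by (simp add: h_def processed_eq_amount amount_def)
  qed (use hle[of t] in auto)
  then show ?thesis using iff[of t] by (auto simp: N_def)
qed

lemma WSPT_unique:
  assumes "finite J" "J \<subseteq> {..<njobs I}"
    and "preemptive_WSPT I tie i J \<sigma>" "preemptive_WSPT I tie i J \<sigma>'"
  shows "\<sigma> = \<sigma>'"
  using assms
proof (induction J arbitrary: \<sigma> \<sigma>' rule: lowest_induct)
  case empty
  then show ?case using WSPT_None_iff[of "{}" \<sigma>] WSPT_None_iff[of "{}" \<sigma>']
    by (auto simp: available_def fun_eq_iff)
next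
  case (insert l J)
  let ?r = "\<lambda>\<sigma> t. if \<sigma> t = Some l then None else \<sigma> t"
  have eq: "?r \<sigma> = ?r \<sigma>'"
    by (intro insert.IH WSPT_remove_lowest insert)
  show ?case
  proof
    fix t
    have "\<sigma> t = Some l \<longleftrightarrow> \<sigma>' t = Some l"
      by (rule trans[OF WSPT_lowest_iff[OF insert.prems(1) insert.hyps(2-5) refl]
        WSPT_lowest_iff[OF insert.prems(2) insert.hyps(2-5) eq, symmetric]])
    then show "\<sigma> t = \<sigma>' t" using fun_cong[OF eq, of t] by (auto split: if_splits)
  qed
qed

lemma WSPT_exists:
  assumes "finite J" "J \<subseteq> {..<njobs I}"
  shows "\<exists>\<sigma>. preemptive_WSPT I tie i J \<sigma>"
  using assms
proof (induction J rule: lowest_induct)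
  case empty
  show ?case by (rule exI[of _ "\<lambda>_. None"]) (auto simp: preemptive_WSPT_def available_def)
next
  case (insert l J)
  then obtain \<tau> where \<tau>: "preemptive_WSPT I tie i J \<tau>" by auto
  then have [measurable]: "\<tau> \<in> borel \<rightarrow>\<^sub>M count_space UNIV" by (simp add: preemptive_WSPT_def)
  define N where "N = {s. \<tau> s = None \<and> rel I l \<le> s}"
  have N[measurable]: "N \<in> sets borel" unfolding N_def by measurable
  define c where "c = pbar I i l"
  have c: "0 < c" using insert pbar_pos by (simp add: c_def)
  \<comment> \<open>The new job receives the idle moments in \<open>N\<close>, cut off by the amount
    of \<open>N\<close> rather than by its own progress, which makes the definition
    non-circular.\<close>
  define \<sigma> where "\<sigma> t = (if t \<in> N \<and> amount N t < c then Some l else \<tau> t)" for t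
  have \<tau>l: "\<tau> t \<noteq> Some l" for t
    using \<tau> insert by (auto simp: preemptive_WSPT_def available_def)
  have k: "\<sigma> t = Some k \<longleftrightarrow> \<tau> t = Some k" if "k \<noteq> l" for t k
    using that by (auto simp: \<sigma>_def N_def)
  have l: "\<sigma> t = Some l \<longleftrightarrow> t \<in> N \<and> amount N t < c" for t
    using \<tau>l by (auto simp: \<sigma>_def)
  have pr: "processed \<sigma> k t = processed \<tau> k t" if "k \<noteq> l" for k t
    using k[OF that] by (intro processed_cong)
  have "{s. \<sigma> s = Some l} = N \<inter> {s. amount N s < c}" using l by auto
  \<comment> \<open>Availability asks for the progress of \<open>l\<close> under
    \<open>\<sigma>\<close> itself; the truncation lemma shows that both cut-offs agree.\<close>
  then have prl: "processed \<sigma> l t < c \<longleftrightarrow> amount N t < c" for t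
    using amount_truncated_less_iff[OF N c] by (simp add: processed_eq_amount)
  have av: "available I i (insert l J) \<sigma> k t \<longleftrightarrow>
      (if k = l then rel I l \<le> t \<and> amount N t < c else available I i J \<tau> k t)" for k t
    using prl pr by (auto simp: available_def c_def)
  have "preemptive_WSPT I tie i (insert l J) \<sigma>"
    unfolding preemptive_WSPT_def
  proof (intro conjI allI)
    show "\<sigma> \<in> borel \<rightarrow>\<^sub>M count_space UNIV" unfolding \<sigma>_def by measurable
    fix t j
    show "\<sigma> t = Some j \<longleftrightarrow> available I i (insert l J) \<sigma> j t \<and>
        (\<forall>k. available I i (insert l J) \<sigma> k t \<and> k \<noteq> j \<longrightarrow> hp j k)"
    proof (cases "j = l")
      case True
      have "\<sigma> t = Some l \<longleftrightarrow> (\<forall>k. \<not> available I i J \<tau> k t) \<and> rel I l \<le> t \<and> amount N t < c"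
        using l WSPT_None_iff[OF \<tau> insert.hyps(2)] by (auto simp: N_def)
      moreover have "\<not> hp l k" if "available I i J \<tau> k t" for k
        using that insert.hyps(5) hp_asym by (auto simp: available_def)
      moreover have "k \<noteq> l" if "available I i J \<tau> k t" for k
        using that insert.hyps(4) by (auto simp: available_def)
      ultimately show ?thesis unfolding True av by (metis (full_types))
    next
      case False
      have "\<sigma> t = Some j \<longleftrightarrow> available I i J \<tau> j t \<and> (\<forall>k. available I i J \<tau> k t \<and> k \<noteq> j \<longrightarrow> hp j k)"
        using k[OF False] \<tau> by (auto simp: preemptive_WSPT_def)
      then show ?thesis unfolding av using False insert.hyps(5) insert.hyps(4)
        by (auto simp: available_def)
    qed
  qed
  then show ?case by blast
qed

lemma WSPT_virtual_schedule:
  assumes "J \<subseteq> {..<njobs I}"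
  shows "preemptive_WSPT I tie i J (virtual_schedule I tie i J)"
proof -
  have "finite J" using assms finite_subset by blast
  then have "\<exists>!\<sigma>. preemptive_WSPT I tie i J \<sigma>"
    using WSPT_exists[OF _ assms] WSPT_unique[OF _ assms] by blast
  then show ?thesis unfolding virtual_schedule_def by (rule theI')
qed

end

section \<open>Backlogs of work-conserving schedules\<close>

text \<open>Unreleased jobs count with their full requirement. Hence the backlog never increases,
  and its integral over time also accounts for the release dates.\<close>

definition backlog :: "preemptive_schedule \<Rightarrow> (nat \<Rightarrow> real) \<Rightarrow> nat set \<Rightarrow> real \<Rightarrow> real" where
  "backlog \<sigma> p U t = (\<Sum>k\<in>U. p k - processed \<sigma> k t)"

definition work_conserving ::
    "preemptive_schedule \<Rightarrow> (nat \<Rightarrow> real) \<Rightarrow> (nat \<Rightarrow> real) \<Rightarrow> nat set \<Rightarrow> bool" where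
  "work_conserving \<sigma> p r U \<longleftrightarrow>
     (\<forall>t. \<forall>k\<in>U. r k \<le> t \<and> processed \<sigma> k t < p k \<longrightarrow> \<sigma> t \<in> Some ` U)"

text \<open>Priorities are left out on purpose. WSPT enters later only through the fact that every
  set of jobs with ratio above a threshold is work-conserving.\<close>

locale greedy_schedule =
  fixes J :: "nat set" and p r :: "nat \<Rightarrow> real" and \<sigma> :: preemptive_schedule
  assumes finite_jobs: "finite J"
    and p_pos: "k \<in> J \<Longrightarrow> 0 < p k"
    and r_nonneg: "k \<in> J \<Longrightarrow> 0 \<le> r k"
    and schedule_measurable: "\<sigma> \<in> borel \<rightarrow>\<^sub>M count_space UNIV"
    and scheduled: "\<sigma> t = Some k \<Longrightarrow> k \<in> J \<and> r k \<le> t \<and> processed \<sigma> k t < p k"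
    and conserving: "work_conserving \<sigma> p r J"
begin

lemma sets_busy: "{s. \<sigma> s = x} \<in> sets borel"
  using measurable_sets[OF schedule_measurable, of "{x}"] by (simp add: vimage_def)

lemma sets_busy_set: "{s. \<sigma> s \<in> X} \<in> sets borel"
  using measurable_sets[OF schedule_measurable, of X] by (simp add: vimage_def)

lemma processed_mono: "s \<le> t \<Longrightarrow> processed \<sigma> k s \<le> processed \<sigma> k t"
  unfolding processed_eq_amount by (intro amount_mono sets_busy)

lemma processed_nonneg: "0 \<le> processed \<sigma> k t"
  unfolding processed_eq_amount by (rule amount_nonneg)

lemma continuous_on_processed: "continuous_on S (processed \<sigma> k)"
  unfolding processed_eq_amount[abs_def] by (intro continuous_on_amount sets_busy)

lemma sum_processed: "finite U \<Longrightarrow> (\<Sum>k\<in>U. processed \<sigma> k t) = amount {s. \<sigma> s \<in> Some ` U} t"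
proof -
  assume "finite U"
  have "{s. \<sigma> s \<in> Some ` U} = (\<Union>k\<in>U. {s. \<sigma> s = Some k})" by auto
  moreover have "disjoint_family_on (\<lambda>k. {s. \<sigma> s = Some k}) U"
    by (auto simp: disjoint_family_on_def)
  ultimately show ?thesis
    using amount_UN[of U "\<lambda>k. {s. \<sigma> s = Some k}" t] \<open>finite U\<close>
    by (simp add: processed_eq_amount sets_busy)
qed

lemma sum_processed_diff_le:
  assumes "finite U" "s \<le> t"
  shows "(\<Sum>k\<in>U. processed \<sigma> k t) - (\<Sum>k\<in>U. processed \<sigma> k s) \<le> t - s"
  unfolding sum_processed[OF assms(1)] by (intro amount_diff_le sets_busy_set assms)

lemma sum_processed_le: "finite U \<Longrightarrow> 0 \<le> t \<Longrightarrow> (\<Sum>k\<in>U. processed \<sigma> k t) \<le> t"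
  using sum_processed_diff_le[of U 0 t] by (simp add: processed_eq_amount amount_nonpos)

lemma sum_processed_diff_busy:
  assumes "finite U" "0 \<le> s" "s \<le> t" "\<And>u. s < u \<Longrightarrow> u < t \<Longrightarrow> \<sigma> u \<in> Some ` U"
  shows "(\<Sum>k\<in>U. processed \<sigma> k t) - (\<Sum>k\<in>U. processed \<sigma> k s) = t - s"
  unfolding sum_processed[OF assms(1)] using assms
  by (intro amount_diff_full sets_busy_set) auto

lemma processed_diff_idle:
  assumes "0 \<le> s" "s \<le> t" "\<And>u. s < u \<Longrightarrow> u < t \<Longrightarrow> \<sigma> u \<noteq> Some k"
  shows "processed \<sigma> k t = processed \<sigma> k s"
  unfolding processed_eq_amount using assms by (intro amount_diff_none sets_busy) auto

lemma processed_unreleased: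
  assumes "k \<in> J" "t \<le> r k"
  shows "processed \<sigma> k t = 0"
proof (cases "0 \<le> t")
  case True
  have "{s. \<sigma> s = Some k} \<inter> {0..t} \<subseteq> {t}" using scheduled assms by force
  then have "measure lborel ({s. \<sigma> s = Some k} \<inter> {0..t}) \<le> measure lborel {t}"
    using sets_busy[of "Some k"] by (intro measure_mono_fmeasurable) (auto simp: fmeasurable_def)
  then show ?thesis by (simp add: processed_eq_amount amount_def measure_le_0_iff)
qed (simp add: processed_eq_amount amount_nonpos)

text \<open>The progress is continuous, so it would have to pass through the value
  \<open>p k\<close>; from that moment on the job is never scheduled again.\<close>

lemma processed_le:
  assumes "k \<in> J"
  shows "processed \<sigma> k t \<le> p k"
proof (rule ccontr)
  assume "\<not> ?thesis"
  then have gt: "p k < processed \<sigma> k t" by simp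
  then have "0 \<le> t" using p_pos[OF assms] amount_nonpos[of t] by (force simp: processed_eq_amount)
  have "processed \<sigma> k 0 = 0" by (simp add: processed_eq_amount amount_nonpos)
  then obtain s where s: "0 \<le> s" "s \<le> t" "processed \<sigma> k s = p k"
    using IVT'[of "processed \<sigma> k" 0 "p k" t] gt p_pos[OF assms] \<open>0 \<le> t\<close> continuous_on_processed by force
  have "\<sigma> u \<noteq> Some k" if "s < u" for u
    using scheduled[of u k] processed_mono[of s u k] s that by fastforce
  then show False using processed_diff_idle[OF s(1,2), of k] s(3) gt by simp
qed

lemma backlog_nonneg: "U \<subseteq> J \<Longrightarrow> 0 \<le> backlog \<sigma> p U t"
  unfolding backlog_def by (intro sum_nonneg) (use processed_le in force)

lemma continuous_on_backlog: "continuous_on S (backlog \<sigma> p U)"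
  unfolding backlog_def[abs_def] by (intro continuous_intros continuous_on_processed)

lemma finite_sub: "U \<subseteq> J \<Longrightarrow> finite U"
  using finite_jobs finite_subset by blast

lemma backlog_diff_le:
  assumes "U \<subseteq> J" "s \<le> t"
  shows "backlog \<sigma> p U s - backlog \<sigma> p U t \<le> t - s"
  using sum_processed_diff_le[OF finite_sub[OF assms(1)] assms(2)]
  by (simp add: backlog_def sum_subtractf)

lemma backlog_antimono: "s \<le> t \<Longrightarrow> backlog \<sigma> p U t \<le> backlog \<sigma> p U s"
  unfolding backlog_def by (intro sum_mono diff_left_mono processed_mono)

text \<open>The jobs released at \<open>s\<close> or later are untouched at time \<open>s\<close>,
  and at most \<open>t - s\<close> units of work can be done afterwards. This is one half of the
  formula for the backlog as a maximum over \<open>s\<close>.\<close>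

lemma backlog_ge:
  assumes "U \<subseteq> J" "s \<le> t"
  shows "(\<Sum>k | k \<in> U \<and> s \<le> r k. p k) - (t - s) \<le> backlog \<sigma> p U t"
proof -
  have fin: "finite U" by (rule finite_sub[OF assms(1)])
  have "(\<Sum>k | k \<in> U \<and> s \<le> r k. p k) = (\<Sum>k | k \<in> U \<and> s \<le> r k. p k - processed \<sigma> k s)"
    using processed_unreleased assms by (intro sum.cong) auto
  also have "\<dots> \<le> backlog \<sigma> p U s"
    unfolding backlog_def using fin processed_le assms(1) by (intro sum_mono2) auto
  finally show ?thesis using backlog_diff_le[OF assms] by linarith
qed

text \<open>The time \<open>s\<close> is the start of the busy period of \<open>U\<close> that covers \<open>t\<close>.\<close>

lemma busy_period_start:
  assumes "U \<subseteq> J" "work_conserving \<sigma> p r U" "0 \<le> t"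
  obtains s where "0 \<le> s" "s \<le> t" "\<And>k. k \<in> U \<Longrightarrow> r k < s \<Longrightarrow> processed \<sigma> k s = p k"
    "\<And>u. s < u \<Longrightarrow> u \<le> t \<Longrightarrow> \<sigma> u \<in> Some ` U"
proof -
  \<comment> \<open>The candidates are the times at which all jobs of \<open>U\<close> released
    strictly earlier are complete; the last one before \<open>t\<close> starts the busy period. The
    strict inequality makes the supremum itself a candidate.\<close>
  define Z where "Z = {s. 0 \<le> s \<and> s \<le> t \<and> (\<forall>k\<in>U. r k < s \<longrightarrow> processed \<sigma> k s = p k)}"
  have ne: "0 \<in> Z" using assms r_nonneg by (force simp: Z_def)
  have bdd: "bdd_above Z" by (auto simp: Z_def bdd_above_def)
  define s where "s = Sup Z"
  have "0 \<le> s" unfolding s_def by (rule cSup_upper[OF ne bdd])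
  moreover have "s \<le> t" unfolding s_def by (rule cSup_least) (use ne in \<open>auto simp: Z_def\<close>)
  moreover have "processed \<sigma> k s = p k" if k: "k \<in> U" "r k < s" for k
  proof -
    obtain z where z: "z \<in> Z" "r k < z"
      using k(2) ne less_cSupD[of Z "r k"] unfolding s_def by blast
    then have "z \<le> s" unfolding s_def by (intro cSup_upper bdd)
    then show ?thesis using z k processed_mono[of z s k] processed_le[of k s] assms(1)
      by (force simp: Z_def)
  qed
  moreover have "\<sigma> u \<in> Some ` U" if su: "s < u" "u \<le> t" for u
  proof -
    have "u \<notin> Z" using cSup_upper[OF _ bdd, of u] su by (auto simp: s_def)
    then obtain k where "k \<in> U" "r k < u" "processed \<sigma> k u \<noteq> p k"
      using su \<open>0 \<le> s\<close> by (auto simp: Z_def)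
    then show ?thesis using assms(1,2) processed_le[of k u] unfolding work_conserving_def
      by (metis less_eq_real_def subsetD)
  qed
  ultimately show thesis using that by blast
qed

text \<open>At the start of the busy period covering \<open>t\<close>, the bound of
  \<open>backlog_ge\<close> is tight: older jobs are complete, and from then on the machine works on
  \<open>U\<close> without a break.\<close>

lemma backlog_attained:
  assumes "U \<subseteq> J" "work_conserving \<sigma> p r U" "0 \<le> t"
  obtains s where "0 \<le> s" "s \<le> t" "backlog \<sigma> p U t = (\<Sum>k | k \<in> U \<and> s \<le> r k. p k) - (t - s)"
proof -
  obtain s where s: "0 \<le> s" "s \<le> t" "\<And>k. k \<in> U \<Longrightarrow> r k < s \<Longrightarrow> processed \<sigma> k s = p k"
    "\<And>u. s < u \<Longrightarrow> u \<le> t \<Longrightarrow> \<sigma> u \<in> Some ` U"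
    using busy_period_start[OF assms] by blast
  have fin: "finite U" by (rule finite_sub[OF assms(1)])
  have "(\<Sum>k | k \<in> U \<and> s \<le> r k. p k) = (\<Sum>k\<in>U. if s \<le> r k then p k else 0)"
    using fin by (simp add: sum.If_cases Int_def)
  also have "\<dots> = backlog \<sigma> p U s"
    unfolding backlog_def using s(3) processed_unreleased assms(1) by (intro sum.cong) auto
  also have "\<dots> = backlog \<sigma> p U t + (t - s)"
    using sum_processed_diff_busy[OF fin s(1,2)] s(4) by (simp add: backlog_def sum_subtractf)
  finally show thesis using that s by force
qed

lemma completed_eventually: "\<exists>H\<ge>0. \<forall>t\<ge>H. \<forall>k\<in>J. processed \<sigma> k t = p k"
proof (intro exI conjI allI impI ballI)
  \<comment> \<open>A crude horizon: the sum of the release dates bounds the last release, and a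
    busy period starting by then is over after the total requirement.\<close>
  let ?H = "(\<Sum>k\<in>J. r k) + (\<Sum>k\<in>J. p k)"
  have nn: "0 \<le> (\<Sum>k\<in>J. r k)" "0 \<le> (\<Sum>k\<in>J. p k)"
    using r_nonneg p_pos by (intro sum_nonneg; force)+
  then show "0 \<le> ?H" by simp
  fix t k assume t: "?H \<le> t" and k: "k \<in> J"
  have "0 \<le> t" using t nn by linarith
  then obtain s where s: "0 \<le> s" "s \<le> t" "backlog \<sigma> p J t = (\<Sum>k | k \<in> J \<and> s \<le> r k. p k) - (t - s)"
    using backlog_attained[OF order_refl conserving] by blast
  have "backlog \<sigma> p J t \<le> 0"
  proof (cases "s \<le> (\<Sum>k\<in>J. r k)")
    case True
    have "(\<Sum>k | k \<in> J \<and> s \<le> r k. p k) \<le> (\<Sum>k\<in>J. p k)"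
      using finite_jobs p_pos by (intro sum_mono2) (auto intro: less_imp_le)
    then show ?thesis using s t True by linarith
  next
    case False
    have "r l \<le> (\<Sum>k\<in>J. r k)" if "l \<in> J" for l
      using member_le_sum[of l J r] that finite_jobs r_nonneg by auto
    then have "{k. k \<in> J \<and> s \<le> r k} = {}" using False by force
    then show ?thesis using s by (simp only: sum.empty)
  qed
  moreover have "p k - processed \<sigma> k t \<le> backlog \<sigma> p J t"
    unfolding backlog_def using member_le_sum[of k J "\<lambda>k. p k - processed \<sigma> k t"]
      k finite_jobs processed_le by auto
  ultimately show "processed \<sigma> k t = p k" using processed_le[OF k, of t] by linarith
qed

end

text \<open>The time \<open>s\<close> that attains the backlog of \<open>U\<close> in the first
  schedule is also admissible in the lower bound for \<open>U'\<close> in the second. This compares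
  two schedules without relating their decisions.\<close>

lemma backlog_mono:
  assumes "greedy_schedule J p r \<sigma>" "greedy_schedule J' p r \<sigma>'"
    and "U \<subseteq> J" "work_conserving \<sigma> p r U" "U \<subseteq> U'" "U' \<subseteq> J'" "0 \<le> t"
  shows "backlog \<sigma> p U t \<le> backlog \<sigma>' p U' t"
proof -
  interpret A: greedy_schedule J p r \<sigma> by fact
  interpret B: greedy_schedule J' p r \<sigma>' by fact
  obtain s where s: "0 \<le> s" "s \<le> t" "backlog \<sigma> p U t = (\<Sum>k | k \<in> U \<and> s \<le> r k. p k) - (t - s)"
    using A.backlog_attained assms(3,4,7) by blast
  have "(\<Sum>k | k \<in> U \<and> s \<le> r k. p k) \<le> (\<Sum>k | k \<in> U' \<and> s \<le> r k. p k)"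
    using assms(5,6) B.finite_sub[OF assms(6)] B.p_pos by (intro sum_mono2) (force intro: less_imp_le)+
  then show ?thesis using s B.backlog_ge[OF assms(6) s(2)] by linarith
qed

lemma integral_positive_part_linear:
  fixes c r H :: real
  assumes "0 \<le> c" "r + c \<le> H"
  shows "((\<lambda>t. max 0 (c - (t - r))) has_integral c\<^sup>2 / 2) {r..H}"
proof -
  have "((\<lambda>t. c - (t - r)) has_integral (c * ((r + c) - r) - ((r + c) - r)\<^sup>2 / 2) - (c * (r - r) - (r - r)\<^sup>2 / 2)) {r..r + c}"
    using assms by (intro fundamental_theorem_of_calculus)
      (auto intro!: derivative_eq_intros simp: has_real_derivative_iff_has_vector_derivative[symmetric] field_simps)
  then have "((\<lambda>t. c - (t - r)) has_integral c\<^sup>2 / 2) {r..r + c}"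
    by (simp add: power2_eq_square)
  then have 1: "((\<lambda>t. max 0 (c - (t - r))) has_integral c\<^sup>2 / 2) {r..r + c}"
    by (rule has_integral_eq[rotated]) auto
  have 2: "((\<lambda>t. max 0 (c - (t - r))) has_integral 0) {r + c..H}"
    by (rule has_integral_eq[OF _ has_integral_0]) auto
  from has_integral_combine[OF _ _ 1 2] assms show ?thesis by simp
qed

text \<open>Inserting a last-released job \<open>j\<close> delays \<open>U\<close> as if \<open>j\<close> were processed behind the current backlog.\<close>

lemma integral_backlog_insert_le:
  assumes "greedy_schedule J p r \<sigma>" "greedy_schedule J' p r \<sigma>'"
    and "U \<subseteq> J" "insert j U \<subseteq> J'" "work_conserving \<sigma>' p r (insert j U)" "j \<notin> U"
    and "\<And>k. k \<in> U \<Longrightarrow> r k \<le> r j" and H: "r j + backlog \<sigma> p U (r j) + p j \<le> H"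
  shows "integral {0..H} (backlog \<sigma>' p (insert j U)) \<le>
    integral {0..H} (backlog \<sigma> p U) + p j * r j + p j * backlog \<sigma> p U (r j) + (p j)\<^sup>2 / 2"
proof -
  interpret A: greedy_schedule J p r \<sigma> by fact
  interpret B: greedy_schedule J' p r \<sigma>' by fact
  define d where "d = backlog \<sigma> p U (r j)"
  have d: "0 \<le> d" unfolding d_def by (rule A.backlog_nonneg) fact
  have pj: "0 < p j" and rj: "0 \<le> r j" using B.p_pos B.r_nonneg assms(4) by auto
  have fin: "finite U" using A.finite_sub assms(3) by blast
  have sum_ins: "(\<Sum>k | k \<in> insert j U \<and> s \<le> r k. p k) = p j + (\<Sum>k | k \<in> U \<and> s \<le> r k. p k)"
    if "s \<le> r j" for s
  proof -
    have "{k. k \<in> insert j U \<and> s \<le> r k} = insert j {k. k \<in> U \<and> s \<le> r k}" using that by auto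
    then show ?thesis using fin assms(6) by simp
  qed
  \<comment> \<open>Before the release of \<open>j\<close>, its requirement is added as a constant;
    the same time \<open>s\<close> serves both schedules.\<close>
  have early: "backlog \<sigma>' p (insert j U) t \<le> backlog \<sigma> p U t + p j" if t: "0 \<le> t" "t \<le> r j" for t
  proof -
    obtain s where s: "0 \<le> s" "s \<le> t"
        "backlog \<sigma>' p (insert j U) t = (\<Sum>k | k \<in> insert j U \<and> s \<le> r k. p k) - (t - s)"
      using B.backlog_attained[OF assms(4,5) t(1)] by blast
    then show ?thesis using sum_ins[of s] t A.backlog_ge[OF assms(3) s(2)] by linarith
  qed
  have late: "backlog \<sigma>' p (insert j U) t \<le> max 0 ((d + p j) - (t - r j))" if t: "r j \<le> t" for t
  proof -
    have "0 \<le> t" using t rj by linarith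
    then obtain s where s: "0 \<le> s" "s \<le> t"
        "backlog \<sigma>' p (insert j U) t = (\<Sum>k | k \<in> insert j U \<and> s \<le> r k. p k) - (t - s)"
      using B.backlog_attained[OF assms(4,5)] by blast
    show ?thesis
    proof (cases "s \<le> r j")
      case True
      then show ?thesis using s sum_ins[OF True] A.backlog_ge[OF assms(3) True] unfolding d_def by linarith
    next
      case False
      then have "{k. k \<in> insert j U \<and> s \<le> r k} = {}" using assms(7) by force
      then show ?thesis using s by (simp only: sum.empty)
    qed
  qed
  \<comment> \<open>The old backlog drains at most at unit rate, so it lies above a triangle of
    height \<open>d\<close>, while \<open>late\<close> puts the new one below a triangle of height
    \<open>d + p j\<close>. The two areas differ by
    \<open>p j * d + (p j)\<^sup>2 / 2\<close>.\<close>
  have lower: "max 0 (d - (t - r j)) \<le> backlog \<sigma> p U t" if t: "r j \<le> t" for t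
    using A.backlog_diff_le[OF assms(3) t] A.backlog_nonneg[OF assms(3), of t] unfolding d_def by linarith
  have rH: "r j \<le> H" using H d pj unfolding d_def by linarith
  note ints = integrable_continuous_real[OF A.continuous_on_backlog] integrable_continuous_real[OF B.continuous_on_backlog]
  have split: "integral {0..H} f = integral {0..r j} f + integral {r j..H} f"
    if "\<And>a b. f integrable_on {a..b}" for f :: "real \<Rightarrow> real"
    using Henstock_Kurzweil_Integration.integral_combine[of 0 "r j" H f] rj rH that by simp
  have "integral {0..r j} (backlog \<sigma>' p (insert j U)) \<le> integral {0..r j} (\<lambda>t. backlog \<sigma> p U t + p j)"
    using early by (intro integral_le ints integrable_add) auto
  also have "\<dots> = integral {0..r j} (backlog \<sigma> p U) + p j * r j"
    using rj by (subst Henstock_Kurzweil_Integration.integral_add) (auto intro: ints)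
  finally have e1: "integral {0..r j} (backlog \<sigma>' p (insert j U)) \<le>
      integral {0..r j} (backlog \<sigma> p U) + p j * r j" .
  have i1: "((\<lambda>t. max 0 ((d + p j) - (t - r j))) has_integral (d + p j)\<^sup>2 / 2) {r j..H}"
    using d pj H by (intro integral_positive_part_linear) (auto simp: d_def)
  have i2: "((\<lambda>t. max 0 (d - (t - r j))) has_integral d\<^sup>2 / 2) {r j..H}"
    using d pj H by (intro integral_positive_part_linear) (auto simp: d_def)
  have "integral {r j..H} (backlog \<sigma>' p (insert j U)) \<le> (d + p j)\<^sup>2 / 2"
    using late by (intro has_integral_le[OF integrable_integral[OF ints(2)] i1]) auto
  moreover have "d\<^sup>2 / 2 \<le> integral {r j..H} (backlog \<sigma> p U)"
    using lower by (intro has_integral_le[OF i2 integrable_integral[OF ints(1)]]) auto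
  ultimately have e2: "integral {r j..H} (backlog \<sigma>' p (insert j U)) \<le>
      integral {r j..H} (backlog \<sigma> p U) + p j * d + (p j)\<^sup>2 / 2"
    by (simp add: power2_eq_square algebra_simps)
  show ?thesis using e1 e2 split[OF ints(1), of U] split[OF ints(2), of "insert j U"] unfolding d_def by linarith
qed

section \<open>Mean busy times, layers and busy periods\<close>

lemma nn_integral_Icc_eq_integral:
  fixes f :: "real \<Rightarrow> real"
  assumes "continuous_on {a..b} f" "\<And>x. a \<le> x \<Longrightarrow> x \<le> b \<Longrightarrow> 0 \<le> f x"
  shows "(\<integral>\<^sup>+x. ennreal (f x) * indicator {a..b} x \<partial>lborel) = ennreal (integral {a..b} f)"
proof -
  have int: "set_integrable lborel {a..b} f" by (rule borel_integrable_atLeastAtMost'[OF assms(1)])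
  have "(\<integral>\<^sup>+x. ennreal (f x) * indicator {a..b} x \<partial>lborel) =
      (\<integral>\<^sup>+x. ennreal (indicator {a..b} x *\<^sub>R f x) \<partial>lborel)"
    by (intro nn_integral_cong) (auto simp: indicator_def)
  also have "\<dots> = ennreal (\<integral>x. indicator {a..b} x *\<^sub>R f x \<partial>lborel)"
    using int assms(2) unfolding set_integrable_def
    by (intro nn_integral_eq_integral) (auto simp: indicator_def)
  also have "\<dots> = ennreal (integral {a..b} f)"
    using set_borel_integral_eq_integral(2)[OF int] by (simp add: set_lebesgue_integral_def)
  finally show ?thesis .
qed

text \<open>Layer-cake argument: t is the integral of the indicator of s < t over s >= 0, and
  exchanging the integrals leaves the part of \<open>A\<close> that lies after s. Applied to a busy
  set, it turns a mean busy time into the integral of the unprocessed work.\<close>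

lemma nn_integral_time_amount:
  assumes A[measurable]: "A \<in> sets borel" and H: "0 \<le> H" and disj: "emeasure lborel (A \<inter> {H<..}) = 0"
  shows "(\<integral>\<^sup>+t. ennreal t * indicator (A \<inter> {0..}) t \<partial>lborel) =
    ennreal (integral {0..H} (\<lambda>s. amount A H - amount A s))"
proof -
  let ?f = "\<lambda>s t. indicator (A \<inter> {0..H}) t * (if 0 \<le> s \<and> s < t then 1 else 0) :: ennreal"
  have "AE t in lborel. t \<notin> A \<inter> {H<..}"
    using A disj by (intro AE_not_in) (auto simp: null_sets_def)
  then have "(\<integral>\<^sup>+t. ennreal t * indicator (A \<inter> {0..}) t \<partial>lborel) =
      (\<integral>\<^sup>+t. (\<integral>\<^sup>+s. ?f s t \<partial>lborel) \<partial>lborel)"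
  proof (intro nn_integral_cong_AE, elim eventually_mono)
    fix t :: real
    assume t: "t \<notin> A \<inter> {H<..}"
    have "(\<integral>\<^sup>+s. ?f s t \<partial>lborel) = (\<integral>\<^sup>+s. indicator (A \<inter> {0..H}) t * indicator {0..<t} s \<partial>lborel)"
      by (intro nn_integral_cong) (auto simp: indicator_def)
    also have "\<dots> = indicator (A \<inter> {0..H}) t * emeasure lborel {0..<t}"
      by (simp add: nn_integral_cmult)
    also have "\<dots> = ennreal t * indicator (A \<inter> {0..}) t"
      using t by (cases "0 \<le> t") (auto simp: indicator_def)
    finally show "ennreal t * indicator (A \<inter> {0..}) t = (\<integral>\<^sup>+s. ?f s t \<partial>lborel)" by simp
  qed
  also have "\<dots> = (\<integral>\<^sup>+s. (\<integral>\<^sup>+t. ?f s t \<partial>lborel) \<partial>lborel)"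
    by (intro lborel_pair.Fubini') measurable
  also have "\<dots> = (\<integral>\<^sup>+s. ennreal (amount A H - amount A s) * indicator {0..H} s \<partial>lborel)"
  proof (intro nn_integral_cong)
    fix s :: real
    have "(\<integral>\<^sup>+t. ?f s t \<partial>lborel) = (\<integral>\<^sup>+t. indicator (if 0 \<le> s then A \<inter> {s<..H} else {}) t \<partial>lborel)"
      by (intro nn_integral_cong) (auto simp: indicator_def)
    also have "\<dots> = emeasure lborel (if 0 \<le> s then A \<inter> {s<..H} else {})"
      using A by (intro nn_integral_indicator) auto
    also have "\<dots> = ennreal (amount A H - amount A s) * indicator {0..H} s"
    proof (cases "0 \<le> s \<and> s \<le> H")
      case True
      have "A \<inter> {s<..H} \<in> fmeasurable lborel"
        by (rule fmeasurableI2[OF fmeasurable_Int_Icc[of A s H]]) (use A in auto)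
      then show ?thesis using True amount_diff[OF A, of s H]
        by (simp add: emeasure_eq_measure2)
    qed auto
    finally show "(\<integral>\<^sup>+t. ?f s t \<partial>lborel) = ennreal (amount A H - amount A s) * indicator {0..H} s" .
  qed
  also have "\<dots> = ennreal (integral {0..H} (\<lambda>s. amount A H - amount A s))"
    using A amount_mono[OF A]
    by (intro nn_integral_Icc_eq_integral continuous_intros continuous_on_amount) auto
  finally show ?thesis .
qed

section \<open>Decomposition of weighted sums into threshold layers\<close>

text \<open>The coefficient at a value is the gap to the next larger value, so the sum over all
  smaller values telescopes.\<close>

lemma layer_coefficients:
  fixes V :: "real set"
  assumes "finite V" "\<forall>x\<in>V. 0 \<le> x"
  shows "\<exists>c. (\<forall>x. 0 \<le> c x) \<and> (\<forall>y\<in>insert 0 V. y = (\<Sum>x | x \<in> insert 0 V \<and> x < y. c x))"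
  using assms
proof (induction V rule: finite_linorder_max_induct)
  case empty
  show ?case
    by (intro exI[of _ "\<lambda>_. 0"] conjI ballI)
      (simp_all only: sum.neutral_const insert_iff empty_iff simp_thms order_refl)
next
  case (insert b V)
  then obtain c where c: "\<forall>x. 0 \<le> c x" "\<forall>y\<in>insert 0 V. y = (\<Sum>x | x \<in> insert 0 V \<and> x < y. c x)" by auto
  show ?case
  proof (cases "b = 0")
    case True
    then show ?thesis using c by auto
  next
    case False
    then have b: "0 < b" using insert by auto
    define m where "m = Max (insert 0 V)"
    have m: "m \<in> insert 0 V" "\<And>x. x \<in> insert 0 V \<Longrightarrow> x \<le> m"
      unfolding m_def using insert.hyps(1) by (intro Max_in Max_ge; simp)+
    then have "m < b" using insert.hyps(2) b by auto
    note m = m this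
    have below: "{x. x \<in> insert 0 (insert b V) \<and> x < y} = {x. x \<in> insert 0 V \<and> x < y}"
      if "y \<le> b" for y using that by auto
    have top: "{x. x \<in> insert 0 V \<and> x < b} = insert m {x. x \<in> insert 0 V \<and> x < m}"
      using m by force
    \<comment> \<open>No value of \<open>insert 0 V\<close> exceeds the old maximum
      \<open>m\<close>, so the coefficient at \<open>m\<close> does not occur in the old sums and
      may be set to the new gap.\<close>
    let ?c = "c(m := b - m)"
    have old: "(\<Sum>x | x \<in> insert 0 V \<and> x < y. ?c x) = (\<Sum>x | x \<in> insert 0 V \<and> x < y. c x)" if "y \<le> m" for y
      using that by (intro sum.cong) auto
    have "(\<Sum>x | x \<in> insert 0 V \<and> x < b. ?c x) = (b - m) + (\<Sum>x | x \<in> insert 0 V \<and> x < m. ?c x)"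
      unfolding top using insert by (subst sum.insert) auto
    also have "\<dots> = b" using old[of m] c(2) m(1) by auto
    finally have "b = (\<Sum>x | x \<in> insert 0 V \<and> x < b. ?c x)" by simp
    moreover have "y = (\<Sum>x | x \<in> insert 0 V \<and> x < y. ?c x)" if "y \<in> insert 0 V" for y
      using old[of y] m(2)[OF that] c(2) that by auto
    moreover have "y \<le> b" if "y \<in> insert 0 V" for y using m(2)[OF that] m(3) by simp
    ultimately have "y = (\<Sum>x | x \<in> insert 0 (insert b V) \<and> x < y. ?c x)" if "y \<in> insert 0 (insert b V)" for y
      using that below[of y] by (metis insert_iff order_refl)
    moreover have "0 \<le> ?c x" for x using c(1) m(3) by auto
    ultimately show ?thesis by blast
  qed
qed

text \<open>Summation by parts, with coefficients that serve all subsets \<open>A\<close> and all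
  functions \<open>X\<close> at once. Weighted statements about WSPT thereby reduce to unweighted
  ones about the jobs with ratio above a threshold.\<close>

lemma layer_decomposition:
  fixes q :: "'b \<Rightarrow> real"
  assumes "finite J" "\<And>k. k \<in> J \<Longrightarrow> 0 \<le> q k"
  obtains V c where "finite V" "\<And>x. 0 \<le> c x" "\<And>x. x \<in> V \<Longrightarrow> 0 \<le> x"
    "\<And>A X. A \<subseteq> J \<Longrightarrow> (\<Sum>k\<in>A. q k * X k) = (\<Sum>x\<in>V. c x * (\<Sum>k | k \<in> A \<and> x < q k. X k))"
proof -
  define V where "V = insert 0 (q ` J)"
  obtain c where c: "\<forall>x. 0 \<le> c x" "\<forall>y\<in>V. y = (\<Sum>x | x \<in> V \<and> x < y. c x)"
    using layer_coefficients[of "q ` J"] assms unfolding V_def by auto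
  have fin: "finite V" using assms by (simp add: V_def)
  have "(\<Sum>k\<in>A. q k * X k) = (\<Sum>x\<in>V. c x * (\<Sum>k | k \<in> A \<and> x < q k. X k))" if A: "A \<subseteq> J" for A X
  proof -
    have finA: "finite A" using A assms finite_subset by blast
    have "(\<Sum>k\<in>A. q k * X k) = (\<Sum>k\<in>A. \<Sum>x\<in>V. if x < q k then c x * X k else 0)"
    proof (intro sum.cong refl)
      fix k assume "k \<in> A"
      then have "q k \<in> V" using A by (auto simp: V_def)
      then have "q k = (\<Sum>x\<in>V. if x < q k then c x else 0)"
        using c(2) fin by (simp add: sum.If_cases Int_def)
      then have "q k * X k = (\<Sum>x\<in>V. (if x < q k then c x else 0) * X k)"
        by (metis sum_distrib_right)
      then show "q k * X k = (\<Sum>x\<in>V. if x < q k then c x * X k else 0)"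
        by (simp add: if_distrib[of "\<lambda>z. z * X k"] cong: if_cong)
    qed
    also have "\<dots> = (\<Sum>x\<in>V. \<Sum>k\<in>A. if x < q k then c x * X k else 0)" by (rule sum.swap)
    also have "\<dots> = (\<Sum>x\<in>V. c x * (\<Sum>k | k \<in> A \<and> x < q k. X k))"
      using finA by (simp add: sum.If_cases Int_def sum_distrib_left)
    finally show ?thesis .
  qed
  moreover have "0 \<le> x" if "x \<in> V" for x using that assms by (auto simp: V_def)
  ultimately show thesis using that[of V c] c fin by blast
qed

lemma sum_le_by_layers:
  fixes q X Y :: "'b \<Rightarrow> real"
  assumes "finite J" "\<And>k. k \<in> J \<Longrightarrow> 0 \<le> q k"
    and "\<And>x. 0 \<le> x \<Longrightarrow> (\<Sum>k | k \<in> J \<and> x < q k. X k) \<le> (\<Sum>k | k \<in> J \<and> x < q k. Y k)"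
  shows "(\<Sum>k\<in>J. q k * X k) \<le> (\<Sum>k\<in>J. q k * Y k)"
proof (rule layer_decomposition[OF assms(1,2)])
  fix V c assume V: "finite V" "\<And>x. 0 \<le> c x" "\<And>x. x \<in> V \<Longrightarrow> 0 \<le> x"
    "\<And>A X. A \<subseteq> J \<Longrightarrow> (\<Sum>k\<in>A. q k * X k) = (\<Sum>x\<in>V. c x * (\<Sum>k | k \<in> A \<and> x < q k. X k))"
  show ?thesis unfolding V(4)[OF order_refl]
    by (intro sum_mono mult_left_mono assms(3) V)
qed

section \<open>Busy times as integrals and decomposition into busy periods\<close>

context greedy_schedule
begin

lemma not_busy_after_completion:
  assumes "k \<in> J" "processed \<sigma> k H = p k"
  shows "{s. \<sigma> s = Some k} \<inter> {H..} = {}"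
  using scheduled[of _ k] processed_mono[of H _ k] assms by force

lemma nn_integral_busy_time:
  assumes "k \<in> J" "0 \<le> H" "processed \<sigma> k H = p k"
  shows "(\<integral>\<^sup>+t. ennreal t * indicator ({s. \<sigma> s = Some k} \<inter> {0..}) t \<partial>lborel) =
    ennreal (integral {0..H} (\<lambda>t. p k - processed \<sigma> k t))"
proof -
  have "{s. \<sigma> s = Some k} \<inter> {H<..} = {}" using not_busy_after_completion[OF assms(1,3)] by force
  then show ?thesis
    using nn_integral_time_amount[OF sets_busy assms(2), of "Some k"] assms(3)
    by (simp add: processed_eq_amount)
qed

lemma integrable_busy_time: "k \<in> J \<Longrightarrow> integrable lborel (\<lambda>t. indicator {0..} t * (busy \<sigma> k t * t))"
  and integral_busy_time: "k \<in> J \<Longrightarrow> 0 \<le> H \<Longrightarrow> processed \<sigma> k H = p k \<Longrightarrow>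
    (LBINT t:{0..}. busy \<sigma> k t * t) = integral {0..H} (\<lambda>t. p k - processed \<sigma> k t)"
proof -
  have meas: "(\<lambda>t. indicator {0..} t * (busy \<sigma> k t * t)) \<in> borel_measurable lborel"
  proof -
    have "busy \<sigma> k = indicator {s. \<sigma> s = Some k}" by (auto simp: busy_def indicator_def)
    then show ?thesis using sets_busy[of "Some k"] by simp
  qed
  have nn: "(\<integral>\<^sup>+t. ennreal (indicator {0..} t * (busy \<sigma> k t * t)) \<partial>lborel) =
      ennreal (integral {0..H} (\<lambda>t. p k - processed \<sigma> k t))"
    if "k \<in> J" "0 \<le> H" "processed \<sigma> k H = p k" for H
    unfolding nn_integral_busy_time[OF that, symmetric]
    by (intro nn_integral_cong) (auto simp: indicator_def busy_def)
  {
    assume k: "k \<in> J" "0 \<le> H" "processed \<sigma> k H = p k"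
    have "0 \<le> integral {0..H} (\<lambda>t. p k - processed \<sigma> k t)"
      using processed_le[OF k(1)] by (intro integral_nonneg integrable_continuous_real continuous_intros continuous_on_processed) auto
    then show "(LBINT t:{0..}. busy \<sigma> k t * t) = integral {0..H} (\<lambda>t. p k - processed \<sigma> k t)"
      unfolding set_lebesgue_integral_def
      using nn[OF k] meas by (subst integral_eq_nn_integral) (auto simp: busy_def indicator_def)
  }
  {
    assume k: "k \<in> J"
    obtain H where "0 \<le> H" "processed \<sigma> k H = p k" using completed_eventually k by blast
    then show "integrable lborel (\<lambda>t. indicator {0..} t * (busy \<sigma> k t * t))"
      using nn[OF k] meas by (intro integrableI_nonneg) (auto simp: busy_def indicator_def)
  }
qed

text \<open>The last busy period is split off: \<open>B\<close> holds the jobs of \<open>U\<close>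
  released from its start on, and all other jobs of \<open>U\<close> are complete by then. Hence
  \<open>B\<close> alone occupies the machine for exactly its total requirement.\<close>

lemma busy_period_induct [consumes 2, case_names empty period]:
  assumes "U \<subseteq> J" "work_conserving \<sigma> p r U" "Q {}"
    and step: "\<And>U B s. U \<subseteq> J \<Longrightarrow> B \<subseteq> J \<Longrightarrow> U \<inter> B = {} \<Longrightarrow> 0 \<le> s \<Longrightarrow> (\<And>k. k \<in> B \<Longrightarrow> s \<le> r k) \<Longrightarrow>
      (\<And>u. s < u \<Longrightarrow> u < s + sum p B \<Longrightarrow> \<sigma> u \<in> Some ` B) \<Longrightarrow> Q U \<Longrightarrow> Q (U \<union> B)"
  shows "Q U"
  using assms(1,2)
proof (induction "card U" arbitrary: U rule: less_induct)
  case less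
  show ?case
  proof (cases "U = {}")
    case False
    have fin: "finite U" by (rule finite_sub[OF less.prems(1)])
    \<comment> \<open>The busy period covering the last release date is the last one.\<close>
    define R where "R = Max (r ` U)"
    have R: "\<And>k. k \<in> U \<Longrightarrow> r k \<le> R" "R \<in> r ` U" using fin False by (auto simp: R_def)
    then have "0 \<le> R" using r_nonneg less.prems(1) by auto
    then obtain s where s: "0 \<le> s" "s \<le> R" "\<And>k. k \<in> U \<Longrightarrow> r k < s \<Longrightarrow> processed \<sigma> k s = p k"
      "\<And>u. s < u \<Longrightarrow> u \<le> R \<Longrightarrow> \<sigma> u \<in> Some ` U"
      using busy_period_start[OF less.prems] by blast
    define B where "B = {k\<in>U. s \<le> r k}"
    define U' where "U' = {k\<in>U. r k < s}"
    have U: "U = U' \<union> B" "U' \<inter> B = {}" by (auto simp: U'_def B_def)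
    have sub: "U' \<subseteq> J" "B \<subseteq> J" using less.prems by (auto simp: U'_def B_def)
    have "B \<noteq> {}" using R(2) s(2) by (auto simp: B_def)
    then have "card U' < card U" using fin U by (intro psubset_card_mono) auto
    have completed: "processed \<sigma> k u = p k" if "k \<in> U'" "s \<le> u" for k u
      using that s(3)[of k] processed_mono[of s u k] processed_le[of k u] sub by (force simp: U'_def)
    \<comment> \<open>A job of \<open>U'\<close> can be unfinished only before \<open>s\<close>, and
      whatever part of \<open>U\<close> runs then was released before \<open>s\<close>, hence
      belongs to \<open>U'\<close>.\<close>
    have wc: "work_conserving \<sigma> p r U'"
      unfolding work_conserving_def
    proof (intro allI ballI impI)
      fix t k assume k: "k \<in> U'" and a: "r k \<le> t \<and> processed \<sigma> k t < p k"
      then have "t < s" using completed[OF k, of t] by (cases "s \<le> t") auto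
      moreover have "\<sigma> t \<in> Some ` U" using less.prems(2) k a U(1) unfolding work_conserving_def by blast
      ultimately show "\<sigma> t \<in> Some ` U'" using scheduled by (force simp: U'_def)
    qed
    have inB: "\<sigma> u \<in> Some ` B" if u: "\<sigma> u \<in> Some ` U" "s < u" for u
    proof -
      obtain l where l: "l \<in> U" "\<sigma> u = Some l" using u(1) by auto
      then have "l \<notin> U'" using scheduled[OF l(2)] completed[of l u] u(2) by auto
      then show ?thesis using l U by auto
    qed
    have busy: "\<sigma> u \<in> Some ` B" if u: "s < u" "u < s + sum p B" for u
    proof (cases "u \<le> R")
      case True
      then show ?thesis using inB s(4) u by blast
    next
      case False
      \<comment> \<open>All of \<open>B\<close> was untouched at \<open>s\<close>, and too little
        time has passed to finish it.\<close>
      have "\<exists>k\<in>B. processed \<sigma> k u < p k"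
      proof (rule ccontr)
        assume "\<not> ?thesis"
        then have "sum p B \<le> (\<Sum>k\<in>B. processed \<sigma> k u)" by (intro sum_mono) force
        moreover have "(\<Sum>k\<in>B. processed \<sigma> k s) = 0"
          using processed_unreleased sub(2) by (intro sum.neutral) (auto simp: B_def)
        ultimately show False
          using sum_processed_diff_le[OF finite_sub[OF sub(2)], of s u] u by linarith
      qed
      then obtain k where "k \<in> B" "processed \<sigma> k u < p k" by blast
      moreover have "r k \<le> u" using R(1)[of k] \<open>k \<in> B\<close> False by (auto simp: B_def)
      ultimately have "\<sigma> u \<in> Some ` U"
        using less.prems(2) U(1) unfolding work_conserving_def by blast
      then show ?thesis using inB u by blast
    qed
    have "Q U'" using less.hyps[OF \<open>card U' < card U\<close> sub(1) wc] .
    then show ?thesis unfolding U(1)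
      by (intro step[OF sub U(2) s(1)]) (use busy in \<open>auto simp: B_def\<close>)
  qed (simp add: assms(3))
qed

context
  fixes B s
  assumes B: "B \<subseteq> J" and s: "0 \<le> s" "\<And>k. k \<in> B \<Longrightarrow> s \<le> r k"
    and busy: "\<And>u. s < u \<Longrightarrow> u < s + sum p B \<Longrightarrow> \<sigma> u \<in> Some ` B"
begin

lemma sum_p_nonneg: "0 \<le> sum p B"
  using B p_pos by (intro sum_nonneg) (force intro: less_imp_le)

lemma backlog_busy_period_before: "t \<le> s \<Longrightarrow> backlog \<sigma> p B t = sum p B"
  unfolding backlog_def using processed_unreleased B s(2) by (intro sum.cong) force+

lemma backlog_busy_period_during:
  assumes "s \<le> t" "t \<le> s + sum p B"
  shows "backlog \<sigma> p B t = sum p B - (t - s)"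
proof -
  have "(\<Sum>k\<in>B. processed \<sigma> k s) = 0"
    using processed_unreleased B s by (intro sum.neutral) auto
  then show ?thesis
    using sum_processed_diff_busy[OF finite_sub[OF B] s(1) assms(1)] busy assms(2)
    by (simp add: backlog_def sum_subtractf)
qed

lemma backlog_busy_period_after: "s + sum p B \<le> t \<Longrightarrow> backlog \<sigma> p B t = 0"
  using backlog_antimono[of "s + sum p B" t B] backlog_busy_period_during[of "s + sum p B"]
    backlog_nonneg[OF B, of t] sum_p_nonneg by simp

text \<open>The area of a rectangle up to \<open>s\<close>, followed by a triangle that drains at
  unit rate.\<close>

lemma integral_backlog_busy_period:
  assumes "s + sum p B \<le> H"
  shows "integral {0..H} (backlog \<sigma> p B) = s * sum p B + (sum p B)\<^sup>2 / 2"
proof -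
  have "(backlog \<sigma> p B has_integral s * sum p B) {0..s}"
    using has_integral_const_real[of "sum p B" 0 s] s(1)
    by (subst has_integral_cong[where g="\<lambda>_. sum p B"]) (auto simp: backlog_busy_period_before)
  moreover have "(backlog \<sigma> p B has_integral (sum p B)\<^sup>2 / 2) {s..H}"
    using integral_positive_part_linear[OF sum_p_nonneg assms]
  proof (rule has_integral_eq[rotated])
    fix t assume "t \<in> {s..H}"
    then show "max 0 (sum p B - (t - s)) = backlog \<sigma> p B t"
      using backlog_busy_period_during[of t] backlog_busy_period_after[of t]
      by (cases "t \<le> s + sum p B") auto
  qed
  ultimately show ?thesis
    using has_integral_combine[of 0 s H] s(1) assms sum_p_nonneg by (intro integral_unique) auto
qed

lemma processed_other_job:
  assumes "k \<notin> B" "s \<le> t" "t \<le> s + sum p B"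
  shows "processed \<sigma> k t = processed \<sigma> k s"
  using assms s(1) busy by (intro processed_diff_idle) force+

end

end

section \<open>The cost of inserting a job\<close>

context sos_machine
begin

abbreviation "ratio k \<equiv> wt I k / pbar I i k"

lemma ratio_nonneg: "k < njobs I \<Longrightarrow> 0 \<le> ratio k"
  using pbar_pos[of k] wt_nonneg[of k] by simp

lemma WSPT_greedy_schedule:
  assumes "preemptive_WSPT I tie i J \<sigma>" "J \<subseteq> {..<njobs I}"
  shows "greedy_schedule J (pbar I i) (rel I) \<sigma>"
proof
  show "finite J" using assms(2) finite_subset by blast
  show "work_conserving \<sigma> (pbar I i) (rel I) J"
    unfolding work_conserving_def
  proof (intro allI ballI impI)
    fix t k assume "k \<in> J" "rel I k \<le> t \<and> processed \<sigma> k t < pbar I i k"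
    then have "\<sigma> t \<noteq> None" using WSPT_None_iff[OF assms, of t] by (auto simp: available_def)
    then show "\<sigma> t \<in> Some ` J" using assms(1) by (auto simp: preemptive_WSPT_def available_def)
  qed
qed (use assms pbar_pos rel_nonneg in \<open>auto simp: preemptive_WSPT_def available_def\<close>)

text \<open>The processed job has at least the ratio of every available job, so it lies above the
  threshold as soon as some available job does.\<close>

lemma WSPT_work_conserving_layer:
  assumes "preemptive_WSPT I tie i J \<sigma>" "J \<subseteq> {..<njobs I}"
  shows "work_conserving \<sigma> (pbar I i) (rel I) {k. k \<in> J \<and> x < ratio k}"
  unfolding work_conserving_def
proof (intro allI ballI impI)
  fix t k
  assume k: "k \<in> {k. k \<in> J \<and> x < ratio k}" and a: "rel I k \<le> t \<and> processed \<sigma> k t < pbar I i k"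
  then have av: "available I i J \<sigma> k t" by (auto simp: available_def)
  then obtain l where l: "\<sigma> t = Some l" using WSPT_None_iff[OF assms, of t] by auto
  moreover have "\<sigma> t = Some l \<longleftrightarrow> available I i J \<sigma> l t \<and>
      (\<forall>k. available I i J \<sigma> k t \<and> k \<noteq> l \<longrightarrow> hp l k)"
    using assms(1) by (simp add: preemptive_WSPT_def)
  ultimately have "available I i J \<sigma> l t" "l = k \<or> hp l k" using av by auto
  then have "l \<in> J" "ratio k \<le> ratio l" by (auto simp: available_def higher_priority_def)
  then show "\<sigma> t \<in> Some ` {k. k \<in> J \<and> x < ratio k}" using l k by auto
qed

abbreviation "vs J \<equiv> virtual_schedule I tie i J"

lemmas vs_greedy = WSPT_greedy_schedule[OF WSPT_virtual_schedule]
lemmas vs_layer = WSPT_work_conserving_layer[OF WSPT_virtual_schedule]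

text \<open>Up to scaling, the dual variable of machine \<open>i\<close> at time \<open>t\<close>.\<close>

definition residual_weight :: "nat set \<Rightarrow> real \<Rightarrow> real" where
  "residual_weight J t = (\<Sum>k\<in>J. ratio k * (pbar I i k - processed (vs J) k t))"

lemma continuous_on_residual_weight:
  assumes "J \<subseteq> {..<njobs I}"
  shows "continuous_on S (residual_weight J)"
proof -
  interpret greedy_schedule J "pbar I i" "rel I" "vs J" using assms assms by (rule vs_greedy)
  show ?thesis unfolding residual_weight_def[abs_def]
    by (intro continuous_intros continuous_on_processed)
qed

lemma residual_weight_nonneg:
  assumes "J \<subseteq> {..<njobs I}"
  shows "0 \<le> residual_weight J t"
proof -
  interpret greedy_schedule J "pbar I i" "rel I" "vs J" using assms assms by (rule vs_greedy)
  have "0 \<le> ratio k * (pbar I i k - processed (vs J) k t)" if "k \<in> J" for k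
    using assms that processed_le[OF that] by (intro mult_nonneg_nonneg ratio_nonneg) auto
  then show ?thesis unfolding residual_weight_def by (rule sum_nonneg)
qed

text \<open>Since \<open>pbar I i k\<close> times the mean busy time is the integral of the
  unprocessed part of \<open>k\<close>, the weighted mean busy times are the area under the residual
  weight.\<close>

lemma virtual_cost_eq:
  assumes J: "J \<subseteq> {..<njobs I}" and H: "0 \<le> H" "\<And>k. k \<in> J \<Longrightarrow> processed (vs J) k H = pbar I i k"
  shows "virtual_cost I tie i J = integral {0..H} (residual_weight J) + (\<Sum>k\<in>J. wt I k * pbar I i k / 2)"
proof -
  interpret greedy_schedule J "pbar I i" "rel I" "vs J" using J J by (rule vs_greedy)
  have "integral {0..H} (residual_weight J) =
      (\<Sum>k\<in>J. integral {0..H} (\<lambda>t. ratio k * (pbar I i k - processed (vs J) k t)))"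
    unfolding residual_weight_def[abs_def]
    by (intro integral_sum finite_jobs integrable_continuous_real continuous_intros continuous_on_processed)
  also have "\<dots> = (\<Sum>k\<in>J. wt I k * mean_busy_time I i (vs J) k)"
    using integral_busy_time[OF _ H] by (intro sum.cong) (auto simp: mean_busy_time_def)
  finally show ?thesis
    by (simp add: virtual_cost_def distrib_left sum.distrib)
qed

text \<open>Holds layer by layer, by comparing backlogs. It allows the jobs present at a dispatch to
  be replaced by all jobs that the machine finally receives.\<close>

lemma residual_weight_mono:
  assumes "J \<subseteq> J'" "J' \<subseteq> {..<njobs I}" "0 \<le> t"
  shows "residual_weight J t \<le> residual_weight J' t"
proof (rule layer_decomposition[of J' ratio])
  fix V c assume V: "finite V" "\<And>x. 0 \<le> c x" "\<And>x. x \<in> V \<Longrightarrow> 0 \<le> x"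
    "\<And>A X. A \<subseteq> J' \<Longrightarrow> (\<Sum>k\<in>A. ratio k * X k) = (\<Sum>x\<in>V. c x * (\<Sum>k | k \<in> A \<and> x < ratio k. X k))"
  have J: "J \<subseteq> {..<njobs I}" using assms by auto
  have "backlog (vs J) (pbar I i) {k. k \<in> J \<and> x < ratio k} t \<le>
      backlog (vs J') (pbar I i) {k. k \<in> J' \<and> x < ratio k} t" for x
    using assms by (intro backlog_mono[OF vs_greedy[OF J J] vs_greedy[OF assms(2,2)]] vs_layer J) auto
  then show ?thesis
    unfolding residual_weight_def V(4)[OF assms(1)] V(4)[OF order_refl] backlog_def
    by (intro sum_mono mult_left_mono V)
next
  show "finite J'" using assms finite_subset by blast
qed (use assms ratio_nonneg in auto)

text \<open>Inserting \<open>j\<close> changes only the layers below its ratio, whose coefficients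
  add up to \<open>ratio j\<close>. Each of them grows by \<open>?p j\<close> times the release
  date, the backlog at release and half of \<open>?p j\<close>. Passing from the release to
  \<open>T\<close> loses nothing, because the backlog drops by at most the elapsed time. The higher
  layers are padded with their backlog at \<open>T\<close>, which completes the residual
  weight.\<close>

lemma virtual_cost_insert_le:
  assumes J: "J \<subseteq> {..<njobs I}" and j: "j < njobs I" "j \<notin> J" "\<And>k. k \<in> J \<Longrightarrow> rel I k \<le> rel I j"
    and T: "rel I j \<le> T"
  shows "virtual_cost I tie i (insert j J) - virtual_cost I tie i J \<le>
    wt I j * (T + pbar I i j) + pbar I i j * residual_weight J T"
proof (rule layer_decomposition[of "insert j J" ratio])
  show fin: "finite (insert j J)" using J finite_subset by auto
  show "0 \<le> ratio k" if "k \<in> insert j J" for k using that J j ratio_nonneg by auto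
  fix V c assume V: "finite V" "\<And>x. 0 \<le> c x" "\<And>x. x \<in> V \<Longrightarrow> 0 \<le> x"
    "\<And>A X. A \<subseteq> insert j J \<Longrightarrow> (\<Sum>k\<in>A. ratio k * X k) = (\<Sum>x\<in>V. c x * (\<Sum>k | k \<in> A \<and> x < ratio k. X k))"
  let ?p = "pbar I i" and ?J' = "insert j J"
  have J': "?J' \<subseteq> {..<njobs I}" using J j by auto
  interpret A: greedy_schedule J ?p "rel I" "vs J" using J J by (rule vs_greedy)
  interpret B: greedy_schedule ?J' ?p "rel I" "vs ?J'" using J' J' by (rule vs_greedy)
  obtain H1 H2 where H1: "\<And>t k. H1 \<le> t \<Longrightarrow> k \<in> J \<Longrightarrow> processed (vs J) k t = ?p k"
    and H2: "\<And>t k. H2 \<le> t \<Longrightarrow> k \<in> ?J' \<Longrightarrow> processed (vs ?J') k t = ?p k"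
    using A.completed_eventually B.completed_eventually by blast
  define H where "H = max (max H1 H2) (max 0 (rel I j + sum ?p J + ?p j))"
  have H: "0 \<le> H" "H1 \<le> H" "H2 \<le> H" "rel I j + sum ?p J + ?p j \<le> H" by (auto simp: H_def)
  define U where "U x = {k. k \<in> J \<and> x < ratio k}" for x
  define U' where "U' x = {k. k \<in> ?J' \<and> x < ratio k}" for x
  have rw: "residual_weight J = (\<lambda>t. \<Sum>x\<in>V. c x * backlog (vs J) ?p (U x) t)"
    unfolding residual_weight_def[abs_def] V(4)[OF subset_insertI] backlog_def U_def ..
  have rw': "residual_weight ?J' = (\<lambda>t. \<Sum>x\<in>V. c x * backlog (vs ?J') ?p (U' x) t)"
    unfolding residual_weight_def[abs_def] V(4)[OF order_refl] backlog_def U'_def ..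
  have irw: "integral {0..H} (residual_weight J) = (\<Sum>x\<in>V. c x * integral {0..H} (backlog (vs J) ?p (U x)))"
    unfolding rw using V(1)
    by (subst integral_sum) (auto intro!: integrable_continuous_real continuous_intros A.continuous_on_backlog)
  have irw': "integral {0..H} (residual_weight ?J') = (\<Sum>x\<in>V. c x * integral {0..H} (backlog (vs ?J') ?p (U' x)))"
    unfolding rw' using V(1)
    by (subst integral_sum) (auto intro!: integrable_continuous_real continuous_intros B.continuous_on_backlog)
  have pj: "0 < ?p j" using j(1) by (rule pbar_pos)
  have step: "integral {0..H} (backlog (vs ?J') ?p (U' x)) \<le> integral {0..H} (backlog (vs J) ?p (U x)) +
      (if x < ratio j then ?p j * (T + ?p j / 2) else 0) + ?p j * backlog (vs J) ?p (U x) T" for x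
  proof (cases "x < ratio j")
    case True
    have U': "U' x = insert j (U x)" using True by (auto simp: U_def U'_def)
    have "backlog (vs J) ?p (U x) (rel I j) \<le> (\<Sum>k\<in>U x. ?p k)"
      unfolding backlog_def using A.processed_nonneg by (intro sum_mono) auto
    also have "\<dots> \<le> sum ?p J"
      using A.finite_jobs A.p_pos by (intro sum_mono2) (auto simp: U_def intro: less_imp_le)
    finally have "rel I j + backlog (vs J) ?p (U x) (rel I j) + ?p j \<le> H" using H(4) by linarith
    then have "integral {0..H} (backlog (vs ?J') ?p (insert j (U x))) \<le>
      integral {0..H} (backlog (vs J) ?p (U x)) + ?p j * rel I j + ?p j * backlog (vs J) ?p (U x) (rel I j) + (?p j)\<^sup>2 / 2"
      using j vs_layer[OF J' J', of x, folded U'_def, unfolded U']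
      by (intro integral_backlog_insert_le[OF A.greedy_schedule_axioms B.greedy_schedule_axioms]) (auto simp: U_def)
    moreover have "backlog (vs J) ?p (U x) (rel I j) \<le> backlog (vs J) ?p (U x) T + (T - rel I j)"
      using A.backlog_diff_le[of "U x", OF _ T] by (auto simp: U_def)
    then have "?p j * backlog (vs J) ?p (U x) (rel I j) \<le> ?p j * (backlog (vs J) ?p (U x) T + (T - rel I j))"
      using pj by (intro mult_left_mono) auto
    ultimately show ?thesis using True unfolding U' by (simp add: algebra_simps power2_eq_square)
  next
    case False
    have U': "U' x = U x" using False by (auto simp: U_def U'_def)
    have "integral {0..H} (backlog (vs ?J') ?p (U x)) \<le> integral {0..H} (backlog (vs J) ?p (U x))"
      using vs_layer[OF J' J', of x, folded U'_def, unfolded U']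
      by (intro integral_le integrable_continuous_real A.continuous_on_backlog B.continuous_on_backlog
          backlog_mono[OF B.greedy_schedule_axioms A.greedy_schedule_axioms]) (auto simp: U_def)
    moreover have "0 \<le> ?p j * backlog (vs J) ?p (U x) T"
      using pj by (intro mult_nonneg_nonneg A.backlog_nonneg) (auto simp: U_def)
    ultimately show ?thesis using False unfolding U' by simp
  qed
  have "integral {0..H} (residual_weight ?J') \<le> (\<Sum>x\<in>V. c x * (integral {0..H} (backlog (vs J) ?p (U x)) +
      (if x < ratio j then ?p j * (T + ?p j / 2) else 0) + ?p j * backlog (vs J) ?p (U x) T))"
    unfolding irw' by (intro sum_mono mult_left_mono step V)
  also have "\<dots> = integral {0..H} (residual_weight J) +
      (\<Sum>x\<in>V. c x * (if x < ratio j then ?p j * (T + ?p j / 2) else 0)) + ?p j * residual_weight J T"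
    unfolding irw by (simp add: rw distrib_left sum.distrib sum_distrib_left mult_ac)
  also have "(\<Sum>x\<in>V. c x * (if x < ratio j then ?p j * (T + ?p j / 2) else 0)) =
      (\<Sum>k\<in>{j}. ratio k * (?p j * (T + ?p j / 2)))"
  proof -
    have "{k. k \<in> {j} \<and> x < ratio k} = (if x < ratio j then {j} else {})" for x by auto
    then show ?thesis by (subst V(4)) (auto intro!: sum.cong)
  qed
  also have "\<dots> = wt I j * (T + ?p j / 2)" using pj by simp
  finally have "integral {0..H} (residual_weight ?J') \<le>
      integral {0..H} (residual_weight J) + wt I j * (T + ?p j / 2) + ?p j * residual_weight J T" .
  moreover have "virtual_cost I tie i J = integral {0..H} (residual_weight J) + (\<Sum>k\<in>J. wt I k * ?p k / 2)"
    using H H1 by (intro virtual_cost_eq J) auto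
  moreover have "virtual_cost I tie i ?J' = integral {0..H} (residual_weight ?J') + (\<Sum>k\<in>?J'. wt I k * ?p k / 2)"
    using H H2 by (intro virtual_cost_eq J') auto
  ultimately show ?thesis using fin j(2) by (simp add: algebra_simps)
qed

text \<open>The arrival order respects release dates, so \<open>j\<close> is a last-released job
  among those dispatched so far. The final set of jobs makes the bound independent of the moment of
  dispatch.\<close>

lemma cost_increase_le:
  assumes "arrival_order I arr" "j < njobs I" "rel I j \<le> T"
  shows "cost_increase I tie arr a j i \<le>
    wt I j * (T + pbar I i j) + pbar I i j * residual_weight {k. k < njobs I \<and> a k = i} T"
proof -
  let ?J = "assigned_before I arr a j i"
  have "cost_increase I tie arr a j i \<le> wt I j * (T + pbar I i j) + pbar I i j * residual_weight ?J T"
    unfolding cost_increase_def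
  proof (rule virtual_cost_insert_le)
    show "rel I k \<le> rel I j" if "k \<in> ?J" for k
      using that assms(1,2) unfolding assigned_before_def arrival_order_def
      by (metis (mono_tags, lifting) linorder_not_le mem_Collect_eq order_less_asym)
  qed (use assms in \<open>auto simp: assigned_before_def\<close>)
  also have "residual_weight ?J T \<le> residual_weight {k. k < njobs I \<and> a k = i} T"
    using assms rel_nonneg[of j] by (intro residual_weight_mono) (auto simp: assigned_before_def)
  finally show ?thesis using pbar_pos[OF assms(2)] by (simp add: mult_left_mono)
qed

end

section \<open>Telescoping of the greedy increments and dual fitting on one machine\<close>

lemma sum_insertion_increments:
  fixes f :: "nat set \<Rightarrow> real" and rank :: "nat \<Rightarrow> nat"
  assumes "finite S" "inj_on rank S" "f {} = 0"
  shows "f S = (\<Sum>j\<in>S. f (insert j {k\<in>S. rank k < rank j}) - f {k\<in>S. rank k < rank j})"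
  using assms(1,2)
proof (induction S rule: finite_ranking_induct[where f=rank])
  case (insert x S)
  show ?case
  proof (cases "x \<in> S")
    case True
    then show ?thesis using insert by (simp add: insert_absorb)
  next
    case False
    have less: "rank y < rank x" if "y \<in> S" for y
      using insert.hyps(2)[OF that] inj_onD[OF insert.prems, of x y] that False
      by (metis insertCI le_neq_implies_less)
    have "{k \<in> insert x S. rank k < rank x} = S" using less by auto
    moreover have "{k \<in> insert x S. rank k < rank j} = {k\<in>S. rank k < rank j}" if "j \<in> S" for j
      using less[OF that] by auto
    ultimately show ?thesis
      using insert False by (simp add: inj_on_insert cong: sum.cong)
  qed
qed (simp add: assms(3))

context sos_machine
begin

lemma virtual_cost_telescope:
  assumes "arrival_order I arr"
  shows "virtual_cost I tie i {k. k < njobs I \<and> a k = i} =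
    (\<Sum>j | j < njobs I \<and> a j = i. cost_increase I tie arr a j i)"
proof -
  let ?S = "{k. k < njobs I \<and> a k = i}"
  have eq: "assigned_before I arr a j i = {k\<in>?S. arr k < arr j}" for j
    by (auto simp: assigned_before_def)
  have "inj_on arr ?S" using assms unfolding arrival_order_def by (auto intro: inj_on_subset)
  then show ?thesis
    using sum_insertion_increments[of ?S arr "virtual_cost I tie i"]
    by (simp add: cost_increase_def eq virtual_cost_def)
qed

text \<open>
  The bound on the cost increase is used at time \<open>2 * t\<close> for each time \<open>t\<close> at which the competing schedule
  works on \<open>j\<close>. Slowing down by the factor two makes the residual weights contribute only
  half of the virtual cost, which can be moved to the left-hand side later.
\<close>

lemma greedy_dual_fitting:
  assumes arr: "arrival_order I arr" and K: "finite K" "K \<subseteq> {..<njobs I}"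
    and \<delta>: "\<And>j. j \<in> K \<Longrightarrow> \<delta> j \<le> cost_increase I tie arr a j i"
    and Z: "\<And>j. j \<in> K \<Longrightarrow> Z j \<in> sets borel" "\<And>j. j \<in> K \<Longrightarrow> Z j \<subseteq> {rel I j..}"
      "disjoint_family_on Z K"
    and int: "\<And>j. j \<in> K \<Longrightarrow> integrable lborel (\<lambda>t. indicator (Z j) t :: real)"
      "\<And>j. j \<in> K \<Longrightarrow> integrable lborel (\<lambda>t. indicator (Z j) t * t)"
  shows "(\<Sum>j\<in>K. \<delta> j * (\<integral>t. indicator (Z j) t \<partial>lborel) / pbar I i j) \<le>
    (\<Sum>j\<in>K. wt I j * (2 * (\<integral>t. indicator (Z j) t * t \<partial>lborel) / pbar I i j + (\<integral>t. indicator (Z j) t \<partial>lborel))) +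
    virtual_cost I tie i {k. k < njobs I \<and> a k = i} / 2"
proof -
  let ?S = "{k. k < njobs I \<and> a k = i}" and ?p = "pbar I i"
  have S: "?S \<subseteq> {..<njobs I}" by auto
  interpret greedy_schedule ?S ?p "rel I" "vs ?S" using S S by (rule vs_greedy)
  obtain H where H: "0 \<le> H" "\<And>t k. H \<le> t \<Longrightarrow> k \<in> ?S \<Longrightarrow> processed (vs ?S) k t = ?p k"
    using completed_eventually by blast
  define Y where "Y = residual_weight ?S"
  \<comment> \<open>The residual weight run at double speed; by substitution its integral is half
    that of \<open>Y\<close>.\<close>
  define G where "G t = indicator {0..} t * Y (2 * t)" for t :: real
  have Y_cont: "continuous_on A Y" for A unfolding Y_def by (rule continuous_on_residual_weight[OF S])
  have Y_nonneg: "0 \<le> Y t" for t unfolding Y_def by (rule residual_weight_nonneg[OF S])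
  have Y_zero: "Y t = 0" if "H \<le> t" for t
    unfolding Y_def residual_weight_def using H(2)[OF that] by simp
  have Yset: "set_integrable lborel {0..H} Y" by (rule borel_integrable_atLeastAtMost'[OF Y_cont])
  have eqY: "(\<lambda>t. indicator {0..} t * Y t) = (\<lambda>t. indicator {0..H} t *\<^sub>R Y t)"
    using Y_zero by (auto simp: indicator_def fun_eq_iff)
  have Yint: "integrable lborel (\<lambda>t. indicator {0..} t * Y t)"
    using Yset unfolding set_integrable_def eqY .
  have Yval: "(\<integral>t. indicator {0..} t * Y t \<partial>lborel) = integral {0..H} Y"
    unfolding eqY using set_borel_integral_eq_integral(2)[OF Yset] by (simp add: set_lebesgue_integral_def)
  have G_alt: "G = (\<lambda>t. indicator {0..} (0 + 2 * t) * Y (0 + 2 * t))"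
    by (auto simp: G_def indicator_def fun_eq_iff zero_le_mult_iff)
  have Gint: "integrable lborel G"
    unfolding G_alt using lborel_integrable_real_affine[OF Yint, of 2 0] by simp
  have "(\<integral>t. G t \<partial>lborel) = integral {0..H} Y / 2"
    unfolding G_alt using lborel_integral_real_affine[of 2 "\<lambda>t. indicator {0..} t * Y t" 0] Yval by simp
  also have "\<dots> \<le> virtual_cost I tie i ?S / 2"
  proof -
    have "0 \<le> (\<Sum>k\<in>?S. wt I k * ?p k / 2)"
      using wt_nonneg less_imp_le[OF pbar_pos] by (intro sum_nonneg) auto
    then show ?thesis using virtual_cost_eq[OF S H(1)] H(2) unfolding Y_def by auto
  qed
  finally have G_le: "(\<integral>t. G t \<partial>lborel) \<le> virtual_cost I tie i ?S / 2" .
  have Gnn: "0 \<le> G t" for t using Y_nonneg by (simp add: G_def)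
  have intG: "integrable lborel (\<lambda>t. indicator (Z j) t * G t)" if "j \<in> K" for j
    using integrable_mult_indicator[OF _ Gint, of "Z j"] Z(1)[OF that] by simp
  \<comment> \<open>The bound on the increment at time \<open>2 * t\<close> is integrated over t in
    \<open>Z j\<close> and divided by the mean length of \<open>j\<close>.\<close>
  have single: "\<delta> j * (\<integral>t. indicator (Z j) t \<partial>lborel) / ?p j \<le>
      wt I j * (2 * (\<integral>t. indicator (Z j) t * t \<partial>lborel) / ?p j + (\<integral>t. indicator (Z j) t \<partial>lborel)) +
      (\<integral>t. indicator (Z j) t * G t \<partial>lborel)" if j: "j \<in> K" for j
  proof -
    have jn: "j < njobs I" using K j by auto
    have pj: "0 < ?p j" by (rule pbar_pos[OF jn])
    have "(\<integral>t. \<delta> j * indicator (Z j) t \<partial>lborel) \<le>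
        (\<integral>t. wt I j * (2 * (indicator (Z j) t * t) + ?p j * indicator (Z j) t) + ?p j * (indicator (Z j) t * G t) \<partial>lborel)"
    proof (rule integral_mono)
      show "integrable lborel (\<lambda>t. \<delta> j * indicator (Z j) t)" using int(1)[OF j] by simp
      show "integrable lborel (\<lambda>t. wt I j * (2 * (indicator (Z j) t * t) + ?p j * indicator (Z j) t) + ?p j * (indicator (Z j) t * G t))"
        using int[OF j] intG[OF j] by simp
      fix t :: real
      show "\<delta> j * indicator (Z j) t \<le>
          wt I j * (2 * (indicator (Z j) t * t) + ?p j * indicator (Z j) t) + ?p j * (indicator (Z j) t * G t)"
      proof (cases "t \<in> Z j")
        case True
        then have "rel I j \<le> t" using Z(2)[OF j] by auto
        then have "0 \<le> t" "rel I j \<le> 2 * t" using rel_nonneg[OF jn] by auto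
        then show ?thesis
          using cost_increase_le[OF arr jn, of "2 * t" a] \<delta>[OF j] True by (simp add: G_def Y_def)
      qed simp
    qed
    also have "\<dots> = wt I j * (2 * (\<integral>t. indicator (Z j) t * t \<partial>lborel) + ?p j * (\<integral>t. indicator (Z j) t \<partial>lborel)) +
        ?p j * (\<integral>t. indicator (Z j) t * G t \<partial>lborel)"
      using int[OF j] intG[OF j] by simp
    finally show ?thesis using pj by (simp add: field_simps)
  qed
  have "(\<Sum>j\<in>K. \<integral>t. indicator (Z j) t * G t \<partial>lborel) = (\<integral>t. (\<Sum>j\<in>K. indicator (Z j) t * G t) \<partial>lborel)"
    using intG by (intro Bochner_Integration.integral_sum[symmetric])
  also have "\<dots> \<le> (\<integral>t. G t \<partial>lborel)"
  proof (rule integral_mono)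
    show "integrable lborel (\<lambda>t. \<Sum>j\<in>K. indicator (Z j) t * G t)"
      by (rule Bochner_Integration.integrable_sum) (rule intG)
    fix t :: real
    \<comment> \<open>The competing schedule works on at most one job at a time, so the residual
      weight is charged at most once at each t.\<close>
    have "(\<Sum>j\<in>K. indicator (Z j) t) = (indicator (\<Union>j\<in>K. Z j) t :: real)"
      using K(1) Z(3) by (simp add: indicator_UN_disjoint)
    then show "(\<Sum>j\<in>K. indicator (Z j) t * G t) \<le> G t"
      using Gnn[of t] by (simp add: sum_distrib_right[symmetric] indicator_def)
  qed (rule Gint)
  finally have "(\<Sum>j\<in>K. \<integral>t. indicator (Z j) t * G t \<partial>lborel) \<le> virtual_cost I tie i ?S / 2"
    using G_le by linarith
  moreover have "(\<Sum>j\<in>K. \<delta> j * (\<integral>t. indicator (Z j) t \<partial>lborel) / ?p j) \<le>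
      (\<Sum>j\<in>K. wt I j * (2 * (\<integral>t. indicator (Z j) t * t \<partial>lborel) / ?p j + (\<integral>t. indicator (Z j) t \<partial>lborel)) +
      (\<integral>t. indicator (Z j) t * G t \<partial>lborel))"
    by (intro sum_mono single)
  ultimately show ?thesis by (simp add: sum.distrib)
qed

end

section \<open>Non-anticipative policies\<close>

lemma realizations_space:
  "p \<in> space (realizations I) \<longleftrightarrow>
    (\<forall>ik\<in>{..<nmach I} \<times> {..<njobs I}. 0 \<le> p ik) \<and> (\<forall>ik. ik \<notin> {..<nmach I} \<times> {..<njobs I} \<longrightarrow> p ik = undefined)"
  by (auto simp: realizations_def space_PiM PiE_iff extensional_def space_restrict_space)

lemma indistinguishableI:
  assumes "\<And>k. k < njobs I \<Longrightarrow> snd (s k) \<le> t \<Longrightarrow> q (fst (s k), k) = p (fst (s k), k)"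
  shows "indistinguishable I s t p q"
  using assms by (auto simp: indistinguishable_def completion_def)

text \<open>The processing time of a job cannot be observed before the job has started. On a common
  machine, an earlier start in one realization would come at a time when the other realization still
  looks the same, which forces equal decisions.\<close>

lemma nonanticipative_own_times:
  assumes na: "nonanticipative I \<pi>" and p: "p \<in> space (realizations I)" and q: "q \<in> space (realizations I)"
    and j: "j < njobs I" and eq: "\<And>i k. k \<noteq> j \<Longrightarrow> p (i, k) = q (i, k)"
  shows "\<pi> p j = \<pi> q j"
proof (cases "fst (\<pi> p j) = fst (\<pi> q j)")
  case True
  have le: "snd (\<pi> p j) \<le> snd (\<pi> q j)" if p: "p \<in> space (realizations I)" and q: "q \<in> space (realizations I)"
    and eq: "\<And>i k. k \<noteq> j \<Longrightarrow> p (i, k) = q (i, k)" for p q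
  proof (rule ccontr)
    assume less: "\<not> ?thesis"
    have "indistinguishable I (\<pi> p) (snd (\<pi> q j)) p q"
    proof (rule indistinguishableI)
      fix k assume "snd (\<pi> p k) \<le> snd (\<pi> q j)"
      then have "k \<noteq> j" using less by auto
      then show "q (fst (\<pi> p k), k) = p (fst (\<pi> p k), k)" using eq by simp
    qed
    then have "\<pi> q j = \<pi> p j" using na p q j unfolding nonanticipative_def by blast
    with less show False by simp
  qed
  have "snd (\<pi> p j) = snd (\<pi> q j)" using le[OF p q eq] le[OF q p eq[symmetric]] by simp
  with True show ?thesis by (simp add: prod_eq_iff)
next
  case False
  define q' where "q' = p((fst (\<pi> q j), j) := q (fst (\<pi> q j), j))"
  have q': "q' \<in> space (realizations I)" using p q by (auto simp: realizations_space q'_def)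
  have "indistinguishable I (\<pi> p) (snd (\<pi> p j)) p q'"
    using False by (intro indistinguishableI) (auto simp: q'_def)
  then have 1: "\<pi> q' j = \<pi> p j" using na p q' j unfolding nonanticipative_def by blast
  have "q' (fst (\<pi> q k), k) = q (fst (\<pi> q k), k)" for k
    using eq[of k] by (cases "k = j") (auto simp: q'_def)
  then have "indistinguishable I (\<pi> q) (snd (\<pi> q j)) q q'" by (intro indistinguishableI)
  then have 2: "\<pi> q' j = \<pi> q j" using na q q' j unfolding nonanticipative_def by blast
  from 1 2 show ?thesis by simp
qed

locale sos_valid =
  fixes I :: "'a sos"
  assumes inst: "sos_instance I"
begin

sublocale prob_space "prb I"
  using inst by (simp add: sos_instance_def)

abbreviation "n \<equiv> njobs I"
abbreviation "m \<equiv> nmach I"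

lemma wt_ge_0: "j < n \<Longrightarrow> 0 \<le> wt I j"
  and rel_ge_0: "j < n \<Longrightarrow> 0 \<le> rel I j"
  and integrable_ptime: "i < m \<Longrightarrow> j < n \<Longrightarrow> integrable (prb I) (ptime I i j)"
  and ptime_ge_0: "i < m \<Longrightarrow> j < n \<Longrightarrow> \<omega> \<in> space (prb I) \<Longrightarrow> 0 \<le> ptime I i j \<omega>"
  and pbar_gt_0: "i < m \<Longrightarrow> j < n \<Longrightarrow> 0 < pbar I i j"
  and indep_jobs: "indep_vars (\<lambda>j. \<Pi>\<^sub>M i\<in>{..<m}. borel) (\<lambda>j \<omega>. \<lambda>i\<in>{..<m}. ptime I i j \<omega>) {..<n}"
  using inst by (auto simp: sos_instance_def)

lemma realized_in_space: "\<omega> \<in> space (prb I) \<Longrightarrow> realized I \<omega> \<in> space (realizations I)"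
  using ptime_ge_0 by (auto simp: realizations_space realized_def)

definition other_jobs :: "nat \<Rightarrow> 'a \<Rightarrow> nat \<Rightarrow> nat \<Rightarrow> real" where
  "other_jobs j \<omega> = (\<lambda>k\<in>{..<n} - {j}. \<lambda>i\<in>{..<m}. ptime I i k \<omega>)"

abbreviation "others_space j \<equiv> Pi\<^sub>M ({..<n} - {j}) (\<lambda>_. Pi\<^sub>M {..<m} (\<lambda>_. borel :: real measure))"

text \<open>Completes the times of the other jobs to a realization. The value 0 for job
  \<open>j\<close> is arbitrary, and the maximum with 0 gives a valid realization for every
  argument, so measurability can be shown on the whole product space.\<close>

definition fill :: "nat \<Rightarrow> (nat \<Rightarrow> nat \<Rightarrow> real) \<Rightarrow> realization" where
  "fill j x = (\<lambda>ik\<in>{..<m} \<times> {..<n}. if snd ik = j then 0 else max 0 (x (snd ik) (fst ik)))"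

lemma measurable_other_jobs: "other_jobs j \<in> prb I \<rightarrow>\<^sub>M others_space j"
  unfolding other_jobs_def[abs_def]
  using integrable_ptime by (intro measurable_restrict) auto

lemma measurable_others_component:
  assumes "k < n" "k \<noteq> j" "i < m"
  shows "(\<lambda>x. x k i) \<in> borel_measurable (others_space j)"
proof -
  have "(\<lambda>x. x k) \<in> others_space j \<rightarrow>\<^sub>M Pi\<^sub>M {..<m} (\<lambda>_. borel :: real measure)"
    using assms by (intro measurable_component_singleton) auto
  then show ?thesis
    by (rule measurable_compose) (use assms in \<open>auto intro: measurable_component_singleton\<close>)
qed

lemma measurable_fill: "fill j \<in> others_space j \<rightarrow>\<^sub>M realizations I"
  unfolding realizations_def fill_def[abs_def]
proof (rule measurable_restrict)
  fix ik assume "ik \<in> {..<m} \<times> {..<n}"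
  then show "(\<lambda>x. if snd ik = j then 0 else max 0 (x (snd ik) (fst ik))) \<in> others_space j \<rightarrow>\<^sub>M restrict_space borel {0..}"
    using measurable_others_component[of "snd ik" j "fst ik"]
    by (cases "snd ik = j") (auto intro!: measurable_restrict_space2 borel_measurable_max)
qed

lemma own_job_indep:
  fixes h :: "(nat \<Rightarrow> nat \<Rightarrow> real) \<Rightarrow> real" and g :: "real \<Rightarrow> real"
  assumes "j < n" "i < m" and h: "h \<in> borel_measurable (others_space j)" and g: "g \<in> borel_measurable borel"
    and int: "integrable (prb I) (\<lambda>\<omega>. h (other_jobs j \<omega>))" "integrable (prb I) (\<lambda>\<omega>. g (ptime I i j \<omega>))"
  shows "integrable (prb I) (\<lambda>\<omega>. h (other_jobs j \<omega>) * g (ptime I i j \<omega>))"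
    and "(\<integral>\<omega>. h (other_jobs j \<omega>) * g (ptime I i j \<omega>) \<partial>prb I) =
      (\<integral>\<omega>. h (other_jobs j \<omega>) \<partial>prb I) * (\<integral>\<omega>. g (ptime I i j \<omega>) \<partial>prb I)"
proof -
  let ?X = "\<lambda>j \<omega>. \<lambda>i\<in>{..<m}. ptime I i j \<omega>" and ?B = "\<lambda>j::nat. \<Pi>\<^sub>M i\<in>{..<m}. (borel :: real measure)"
  have "indep_var (Pi\<^sub>M ({..<n} - {j}) ?B) (\<lambda>\<omega>. restrict (\<lambda>k. ?X k \<omega>) ({..<n} - {j}))
      (Pi\<^sub>M {j} ?B) (\<lambda>\<omega>. restrict (\<lambda>k. ?X k \<omega>) {j})"
    using assms(1) by (intro indep_var_restrict[OF indep_jobs]) auto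
  moreover have "(\<lambda>f. g (f j i)) \<in> borel_measurable (Pi\<^sub>M {j} ?B)"
  proof -
    have "(\<lambda>f. f j) \<in> Pi\<^sub>M {j} ?B \<rightarrow>\<^sub>M Pi\<^sub>M {..<m} (\<lambda>_. borel :: real measure)"
      by (intro measurable_component_singleton) auto
    then have "(\<lambda>f. f j i) \<in> borel_measurable (Pi\<^sub>M {j} ?B)"
      by (rule measurable_compose) (use assms(2) in \<open>auto intro: measurable_component_singleton\<close>)
    then show ?thesis using g by (rule measurable_compose)
  qed
  ultimately have "indep_var borel (h \<circ> (\<lambda>\<omega>. restrict (\<lambda>k. ?X k \<omega>) ({..<n} - {j})))
      borel ((\<lambda>f. g (f j i)) \<circ> (\<lambda>\<omega>. restrict (\<lambda>k. ?X k \<omega>) {j}))"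
    using h by (intro indep_var_compose)
  then have "indep_var borel (\<lambda>\<omega>. h (other_jobs j \<omega>)) borel (\<lambda>\<omega>. g (ptime I i j \<omega>))"
    using assms(2) by (simp add: o_def other_jobs_def)
  from indep_var_integrable[OF this int] indep_var_lebesgue_integral[OF this int]
  show "integrable (prb I) (\<lambda>\<omega>. h (other_jobs j \<omega>) * g (ptime I i j \<omega>))"
    and "(\<integral>\<omega>. h (other_jobs j \<omega>) * g (ptime I i j \<omega>) \<partial>prb I) =
      (\<integral>\<omega>. h (other_jobs j \<omega>) \<partial>prb I) * (\<integral>\<omega>. g (ptime I i j \<omega>) \<partial>prb I)" .
qed

end

locale sos_policy = sos_valid I for I :: "'a sos" +
  fixes \<pi> :: "realization \<Rightarrow> schedule"
  assumes nonant: "nonanticipative I \<pi>"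
    and feas: "p \<in> space (realizations I) \<Longrightarrow> feasible I p (\<pi> p)"
    and meas: "j < njobs I \<Longrightarrow> (\<lambda>p. \<pi> p j) \<in> realizations I \<rightarrow>\<^sub>M count_space UNIV \<Otimes>\<^sub>M borel"
begin

definition start :: "nat \<Rightarrow> 'a \<Rightarrow> real" where
  "start j \<omega> = snd (\<pi> (realized I \<omega>) j)"

definition on_machine :: "nat \<Rightarrow> nat \<Rightarrow> 'a \<Rightarrow> real" where
  "on_machine i j \<omega> = (if fst (\<pi> (realized I \<omega>) j) = i then 1 else 0)"

text \<open>The start of \<open>j\<close> as a function of the other jobs alone, the form in which
  independence across jobs applies.\<close>

definition start_fn :: "nat \<Rightarrow> (nat \<Rightarrow> nat \<Rightarrow> real) \<Rightarrow> real" where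
  "start_fn j x = snd (\<pi> (fill j x) j)"

definition on_machine_fn :: "nat \<Rightarrow> nat \<Rightarrow> (nat \<Rightarrow> nat \<Rightarrow> real) \<Rightarrow> real" where
  "on_machine_fn i j x = (if fst (\<pi> (fill j x) j) = i then 1 else 0)"

lemma policy_other_jobs:
  assumes "\<omega> \<in> space (prb I)" "j < n"
  shows "\<pi> (realized I \<omega>) j = \<pi> (fill j (other_jobs j \<omega>)) j"
proof (rule nonanticipative_own_times[OF nonant realized_in_space[OF assms(1)] _ assms(2)])
  show "fill j (other_jobs j \<omega>) \<in> space (realizations I)"
    by (auto simp: realizations_space fill_def)
  show "realized I \<omega> (i, k) = fill j (other_jobs j \<omega>) (i, k)" if "k \<noteq> j" for i k
    using that ptime_ge_0[of i k \<omega>] assms(1) by (auto simp: realized_def fill_def other_jobs_def)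
qed

lemma start_eq: "\<omega> \<in> space (prb I) \<Longrightarrow> j < n \<Longrightarrow> start j \<omega> = start_fn j (other_jobs j \<omega>)"
  and on_machine_eq: "\<omega> \<in> space (prb I) \<Longrightarrow> j < n \<Longrightarrow> on_machine i j \<omega> = on_machine_fn i j (other_jobs j \<omega>)"
  by (simp_all add: start_def start_fn_def on_machine_def on_machine_fn_def policy_other_jobs)

lemma measurable_start_fn: "j < n \<Longrightarrow> start_fn j \<in> borel_measurable (others_space j)"
  unfolding start_fn_def[abs_def]
  by (intro measurable_compose[OF measurable_fill] measurable_compose[OF meas] measurable_snd)

lemma measurable_on_machine_fn: "j < n \<Longrightarrow> on_machine_fn i j \<in> borel_measurable (others_space j)"
  unfolding on_machine_fn_def[abs_def]
  by (intro measurable_compose[OF measurable_fill] measurable_compose[OF meas]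
      measurable_compose[OF measurable_fst]) (auto intro: borel_measurable_count_space)

lemma measurable_start: "j < n \<Longrightarrow> start j \<in> borel_measurable (prb I)"
  using measurable_compose[OF measurable_other_jobs measurable_start_fn]
  by (subst measurable_cong[OF start_eq]) auto

lemma measurable_on_machine: "j < n \<Longrightarrow> on_machine i j \<in> borel_measurable (prb I)"
  using measurable_compose[OF measurable_other_jobs measurable_on_machine_fn]
  by (subst measurable_cong[OF on_machine_eq]) auto

lemma integrable_on_machine: "j < n \<Longrightarrow> integrable (prb I) (on_machine i j)"
  by (rule integrable_const_bound[of _ 1]) (auto simp: on_machine_def intro: measurable_on_machine)

definition assign_prob :: "nat \<Rightarrow> nat \<Rightarrow> real" where
  "assign_prob i j = (\<integral>\<omega>. on_machine i j \<omega> \<partial>prb I)"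

abbreviation "mean_start_cost j \<equiv> (\<integral>\<omega>. wt I j * start j \<omega> \<partial>prb I)"
abbreviation "mean_length j \<equiv> (\<Sum>i<m. assign_prob i j * pbar I i j)"

lemma machine_valid: "\<omega> \<in> space (prb I) \<Longrightarrow> j < n \<Longrightarrow> fst (\<pi> (realized I \<omega>) j) < m"
  and start_ge_rel: "\<omega> \<in> space (prb I) \<Longrightarrow> j < n \<Longrightarrow> rel I j \<le> start j \<omega>"
  using feas[OF realized_in_space] by (auto simp: feasible_def start_def)

lemma start_nonneg: "\<omega> \<in> space (prb I) \<Longrightarrow> j < n \<Longrightarrow> 0 \<le> start j \<omega>"
  using start_ge_rel rel_ge_0 by force

lemma sum_on_machine:
  assumes "\<omega> \<in> space (prb I)" "j < n"
  shows "(\<Sum>i<m. on_machine i j \<omega> * f i) = f (fst (\<pi> (realized I \<omega>) j))"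
proof -
  have "(\<Sum>i<m. on_machine i j \<omega> * f i) = (\<Sum>i<m. if i = fst (\<pi> (realized I \<omega>) j) then f i else 0)"
    by (intro sum.cong) (auto simp: on_machine_def)
  then show ?thesis using machine_valid[OF assms] by simp
qed

lemma sum_assign_prob:
  assumes "j < n"
  shows "(\<Sum>i<m. assign_prob i j) = 1"
proof -
  have "(\<Sum>i<m. assign_prob i j) = (\<integral>\<omega>. (\<Sum>i<m. on_machine i j \<omega>) \<partial>prb I)"
    unfolding assign_prob_def using integrable_on_machine[OF assms]
    by (intro Bochner_Integration.integral_sum[symmetric]) auto
  also have "\<dots> = (\<integral>\<omega>. 1 \<partial>prb I)"
    using sum_on_machine[OF _ assms, of _ "\<lambda>_. 1"] by (intro Bochner_Integration.integral_cong) auto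
  finally show ?thesis by (simp add: prob_space)
qed

lemma assign_prob_nonneg: "0 \<le> assign_prob i j"
  unfolding assign_prob_def by (intro Bochner_Integration.integral_nonneg) (simp add: on_machine_def)

lemma on_machine_indep:
  fixes g :: "real \<Rightarrow> real"
  assumes "j < n" "i < m" and g: "g \<in> borel_measurable borel" "integrable (prb I) (\<lambda>\<omega>. g (ptime I i j \<omega>))"
  shows "integrable (prb I) (\<lambda>\<omega>. on_machine i j \<omega> * g (ptime I i j \<omega>))"
    and "(\<integral>\<omega>. on_machine i j \<omega> * g (ptime I i j \<omega>) \<partial>prb I) = assign_prob i j * (\<integral>\<omega>. g (ptime I i j \<omega>) \<partial>prb I)"
proof -
  have int: "integrable (prb I) (\<lambda>\<omega>. on_machine_fn i j (other_jobs j \<omega>))"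
    using integrable_on_machine[OF assms(1)] on_machine_eq[OF _ assms(1)]
    by (subst Bochner_Integration.integrable_cong[OF refl, of _ _ "on_machine i j"]) auto
  note ind = own_job_indep[OF assms(1,2) measurable_on_machine_fn[OF assms(1)] g(1) int g(2)]
  show "integrable (prb I) (\<lambda>\<omega>. on_machine i j \<omega> * g (ptime I i j \<omega>))"
    using ind(1) on_machine_eq[OF _ assms(1)]
    by (subst Bochner_Integration.integrable_cong[OF refl, of _ _ "\<lambda>\<omega>. on_machine_fn i j (other_jobs j \<omega>) * g (ptime I i j \<omega>)"]) auto
  have "(\<integral>\<omega>. on_machine i j \<omega> * g (ptime I i j \<omega>) \<partial>prb I) =
      (\<integral>\<omega>. on_machine_fn i j (other_jobs j \<omega>) * g (ptime I i j \<omega>) \<partial>prb I)"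
    using on_machine_eq[OF _ assms(1)] by (intro Bochner_Integration.integral_cong) auto
  moreover have "(\<integral>\<omega>. on_machine_fn i j (other_jobs j \<omega>) \<partial>prb I) = assign_prob i j"
    unfolding assign_prob_def using on_machine_eq[OF _ assms(1)] by (intro Bochner_Integration.integral_cong) auto
  ultimately show "(\<integral>\<omega>. on_machine i j \<omega> * g (ptime I i j \<omega>) \<partial>prb I) = assign_prob i j * (\<integral>\<omega>. g (ptime I i j \<omega>) \<partial>prb I)"
    using ind(2) by simp
qed

text \<open>The factor \<open>c\<close> stays inside the integrals: finite cost makes the weighted
  start integrable, whereas the start of a job of weight zero may have infinite expectation.\<close>

lemma weighted_start_indep:
  assumes "j < n" "i < m" and int: "integrable (prb I) (\<lambda>\<omega>. c * start j \<omega>)"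
  shows "integrable (prb I) (\<lambda>\<omega>. on_machine i j \<omega> * (c * start j \<omega>))"
    and "integrable (prb I) (\<lambda>\<omega>. on_machine i j \<omega> * (c * start j \<omega>) * ptime I i j \<omega>)"
    and "(\<integral>\<omega>. on_machine i j \<omega> * (c * start j \<omega>) * ptime I i j \<omega> \<partial>prb I) =
      (\<integral>\<omega>. on_machine i j \<omega> * (c * start j \<omega>) \<partial>prb I) * pbar I i j"
proof -
  let ?h = "\<lambda>x. on_machine_fn i j x * (c * start_fn j x)"
  have h: "?h \<in> borel_measurable (others_space j)"
    using measurable_start_fn[OF assms(1)] measurable_on_machine_fn[OF assms(1)] by measurable
  show int2: "integrable (prb I) (\<lambda>\<omega>. on_machine i j \<omega> * (c * start j \<omega>))"
  proof (rule Bochner_Integration.integrable_bound[OF int])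
    show "(\<lambda>\<omega>. on_machine i j \<omega> * (c * start j \<omega>)) \<in> borel_measurable (prb I)"
      using measurable_start[OF assms(1)] measurable_on_machine[OF assms(1)] by measurable
  qed (auto simp: on_machine_def)
  have eq: "on_machine i j \<omega> * (c * start j \<omega>) = ?h (other_jobs j \<omega>)" if "\<omega> \<in> space (prb I)" for \<omega>
    using start_eq[OF that assms(1)] on_machine_eq[OF that assms(1)] by simp
  have int3: "integrable (prb I) (\<lambda>\<omega>. ?h (other_jobs j \<omega>))"
    using iffD1[OF Bochner_Integration.integrable_cong[OF refl eq] int2] .
  note ind = own_job_indep[OF assms(1,2) h, of "\<lambda>x. x", OF measurable_ident_sets[OF refl] int3 integrable_ptime[OF assms(2,1)]]
  show "integrable (prb I) (\<lambda>\<omega>. on_machine i j \<omega> * (c * start j \<omega>) * ptime I i j \<omega>)"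
    by (rule iffD2[OF Bochner_Integration.integrable_cong[OF refl] ind(1)]) (simp only: eq)
  have "(\<integral>\<omega>. on_machine i j \<omega> * (c * start j \<omega>) * ptime I i j \<omega> \<partial>prb I) = (\<integral>\<omega>. ?h (other_jobs j \<omega>) * ptime I i j \<omega> \<partial>prb I)"
    by (rule Bochner_Integration.integral_cong) (simp_all only: eq)
  moreover have "(\<integral>\<omega>. on_machine i j \<omega> * (c * start j \<omega>) \<partial>prb I) = (\<integral>\<omega>. ?h (other_jobs j \<omega>) \<partial>prb I)"
    by (rule Bochner_Integration.integral_cong) (simp_all only: eq)
  ultimately show "(\<integral>\<omega>. on_machine i j \<omega> * (c * start j \<omega>) * ptime I i j \<omega> \<partial>prb I) =
      (\<integral>\<omega>. on_machine i j \<omega> * (c * start j \<omega>) \<partial>prb I) * pbar I i j"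
    using ind(2) by (simp add: pbar_def)
qed

lemma completion_eq:
  assumes "\<omega> \<in> space (prb I)" "j < n"
  shows "completion (realized I \<omega>) (\<pi> (realized I \<omega>)) j = start j \<omega> + (\<Sum>i<m. on_machine i j \<omega> * ptime I i j \<omega>)"
  unfolding sum_on_machine[OF assms, of "\<lambda>i. ptime I i j \<omega>"]
  using machine_valid[OF assms] assms(2) by (simp add: completion_def start_def realized_def)

lemma
  assumes fin: "exp_cost I \<pi> < \<infinity>"
  shows integrable_weighted_start: "j < n \<Longrightarrow> integrable (prb I) (\<lambda>\<omega>. wt I j * start j \<omega>)"
    and exp_cost_eq: "exp_cost I \<pi> = ennreal (\<Sum>j<n. mean_start_cost j +
      wt I j * mean_length j)"
proof -
  let ?c = "\<lambda>\<omega> j. completion (realized I \<omega>) (\<pi> (realized I \<omega>)) j"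
  have c_ge: "start j \<omega> \<le> ?c \<omega> j" if "\<omega> \<in> space (prb I)" "j < n" for j \<omega>
    unfolding completion_eq[OF that] using ptime_ge_0 that
    by (auto intro!: sum_nonneg mult_nonneg_nonneg simp: on_machine_def)
  show int: "integrable (prb I) (\<lambda>\<omega>. wt I j * start j \<omega>)" if j: "j < n" for j
  proof (rule integrableI_nonneg)
    show "(\<lambda>\<omega>. wt I j * start j \<omega>) \<in> borel_measurable (prb I)" using measurable_start[OF j] by measurable
    show "AE \<omega> in prb I. 0 \<le> wt I j * start j \<omega>" using wt_ge_0[OF j] start_nonneg[OF _ j] by auto
    have "(\<integral>\<^sup>+\<omega>. ennreal (wt I j * start j \<omega>) \<partial>prb I) \<le> exp_cost I \<pi>"
      unfolding exp_cost_def
    proof (intro nn_integral_mono ennreal_leI)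
      fix \<omega> assume \<omega>: "\<omega> \<in> space (prb I)"
      have nn: "0 \<le> wt I k * ?c \<omega> k" if "k < n" for k
        using wt_ge_0[OF that] start_nonneg[OF \<omega> that] c_ge[OF \<omega> that] by (intro mult_nonneg_nonneg) auto
      have "wt I j * start j \<omega> \<le> wt I j * ?c \<omega> j" using c_ge[OF \<omega> j] wt_ge_0[OF j] by (rule mult_left_mono)
      also have "\<dots> \<le> (\<Sum>k<n. wt I k * ?c \<omega> k)"
        using nn j by (intro member_le_sum[of j _ "\<lambda>k. wt I k * ?c \<omega> k"]) auto
      finally show "wt I j * start j \<omega> \<le> (\<Sum>k<n. wt I k * ?c \<omega> k)" .
    qed
    then show "(\<integral>\<^sup>+\<omega>. ennreal (wt I j * start j \<omega>) \<partial>prb I) < \<infinity>" using fin by (rule le_less_trans)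
  qed
  let ?f = "\<lambda>\<omega>. \<Sum>j<n. wt I j * start j \<omega> + wt I j * (\<Sum>i<m. on_machine i j \<omega> * ptime I i j \<omega>)"
  have int_f: "integrable (prb I) (\<lambda>\<omega>. on_machine i j \<omega> * ptime I i j \<omega>)"
    and val_f: "(\<integral>\<omega>. on_machine i j \<omega> * ptime I i j \<omega> \<partial>prb I) = assign_prob i j * pbar I i j" if "j < n" "i < m" for i j
    using on_machine_indep[OF that, of "\<lambda>x. x"] integrable_ptime that by (auto simp: pbar_def)
  have "exp_cost I \<pi> = (\<integral>\<^sup>+\<omega>. ennreal (?f \<omega>) \<partial>prb I)"
    unfolding exp_cost_def
    by (intro nn_integral_cong arg_cong[where f=ennreal] sum.cong refl) (simp add: completion_eq distrib_left)
  also have "\<dots> = ennreal (\<integral>\<omega>. ?f \<omega> \<partial>prb I)"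
  proof (rule nn_integral_eq_integral)
    show "integrable (prb I) ?f"
      using int int_f by (intro Bochner_Integration.integrable_sum Bochner_Integration.integrable_add integrable_mult_right) auto
    show "AE \<omega> in prb I. 0 \<le> ?f \<omega>"
      using wt_ge_0 start_nonneg ptime_ge_0
      by (intro AE_I2 sum_nonneg add_nonneg_nonneg mult_nonneg_nonneg) (auto simp: on_machine_def)
  qed
  also have "(\<integral>\<omega>. ?f \<omega> \<partial>prb I) = (\<Sum>j<n. mean_start_cost j +
      wt I j * mean_length j)"
  proof -
    have 1: "integrable (prb I) (\<lambda>\<omega>. wt I j * (\<Sum>i<m. on_machine i j \<omega> * ptime I i j \<omega>))" if "j < n" for j
      using int_f that by (intro integrable_mult_right Bochner_Integration.integrable_sum) auto
    have 2: "(\<integral>\<omega>. wt I j * (\<Sum>i<m. on_machine i j \<omega> * ptime I i j \<omega>) \<partial>prb I) =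
        wt I j * mean_length j" if "j < n" for j
      using int_f val_f that by simp
    show ?thesis
      using int 1 2 by (subst Bochner_Integration.integral_sum)
        (auto intro!: sum.cong Bochner_Integration.integrable_add simp del: integrable_mult_right_iff)
  qed
  finally show "exp_cost I \<pi> = ennreal (\<Sum>j<n. mean_start_cost j +
      wt I j * mean_length j)" .
qed

end

section \<open>Greedy assignment versus an arbitrary policy\<close>

text \<open>Half-open intervals keep jobs that run back to back disjoint; the missing end point is a
  null set.\<close>

lemma has_bochner_integral_time_interval:
  fixes a b :: real
  assumes "0 \<le> a" "a \<le> b"
  shows "has_bochner_integral lborel (\<lambda>t. indicator {a..<b} t * t) ((b\<^sup>2 - a\<^sup>2) / 2)"
proof -
  have "has_bochner_integral lborel (\<lambda>t. t * indicator {a..b} t) (b\<^sup>2 / 2 - a\<^sup>2 / 2)"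
    using assms by (intro has_bochner_integral_FTC_Icc_nonneg)
      (auto intro!: derivative_eq_intros simp: has_real_derivative_iff_has_vector_derivative[symmetric])
  moreover have "AE t in lborel. t * indicator {a..b} t = indicator {a..<b} t * t"
    using AE_lborel_singleton[of b] by eventually_elim (auto simp: indicator_def)
  ultimately show ?thesis
    by (subst has_bochner_integral_cong_AE[where g="\<lambda>t. t * indicator {a..b} t"]) (auto simp: diff_divide_distrib)
qed

locale sos_greedy = sos_valid I for I :: "'a sos" +
  fixes tie :: "nat \<Rightarrow> nat \<Rightarrow> nat" and arr :: "nat \<Rightarrow> nat" and a :: "nat \<Rightarrow> nat"
  assumes tie: "tie_breaking I tie" and arrival: "arrival_order I arr"
    and greedy: "greedy_assignment I tie arr a"
begin

lemma machine: "i < m \<Longrightarrow> sos_machine I tie i"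
  using tie wt_ge_0 rel_ge_0 pbar_gt_0 by unfold_locales (auto simp: tie_breaking_def)

abbreviation "jobs_on b i \<equiv> {k. k < n \<and> b k = (i::nat)}"

definition total_virtual_cost :: real where
  "total_virtual_cost = (\<Sum>i<m. virtual_cost I tie i (jobs_on a i))"

definition greedy_increase :: "nat \<Rightarrow> real" where
  "greedy_increase j = cost_increase I tie arr a j (a j)"

lemma sum_by_machine:
  assumes "\<And>j. j < n \<Longrightarrow> b j < m"
  shows "(\<Sum>i<m. \<Sum>j\<in>jobs_on b i. f i j) = (\<Sum>j<n. f (b j) j)"
proof -
  have "(\<Sum>i<m. \<Sum>j\<in>jobs_on b i. f i j) = (\<Sum>i<m. \<Sum>j | j \<in> {..<n} \<and> b j = i. f (b j) j)"
    by (intro sum.cong) auto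
  also have "\<dots> = (\<Sum>j<n. f (b j) j)" using assms by (intro sum.group) auto
  finally show ?thesis .
qed

lemma a_less: "j < n \<Longrightarrow> a j < m"
  using greedy by (simp add: greedy_assignment_def)

lemma total_virtual_cost_eq: "total_virtual_cost = (\<Sum>j<n. greedy_increase j)"
proof -
  have "total_virtual_cost = (\<Sum>i<m. \<Sum>j\<in>jobs_on a i. cost_increase I tie arr a j i)"
    unfolding total_virtual_cost_def
    using sos_machine.virtual_cost_telescope[OF machine arrival] by (intro sum.cong) auto
  then show ?thesis using sum_by_machine[OF a_less] by (simp add: greedy_increase_def)
qed

text \<open>The interface to any competing schedule: \<open>Z j\<close> are the times at which it
  works on \<open>j\<close> on machine \<open>b j\<close>, with length \<open>q j\<close> and first
  moment \<open>T j\<close>. Greediness enters because the increment on the chosen machine is at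
  most the one on \<open>b j\<close>.\<close>

lemma total_dual_fitting:
  assumes b: "\<And>j. j < n \<Longrightarrow> b j < m"
    and Z: "\<And>j. j < n \<Longrightarrow> Z j \<in> sets borel" "\<And>j. j < n \<Longrightarrow> Z j \<subseteq> {rel I j..}"
      "\<And>j k. j < n \<Longrightarrow> k < n \<Longrightarrow> j \<noteq> k \<Longrightarrow> b j = b k \<Longrightarrow> Z j \<inter> Z k = {}"
    and int: "\<And>j. j < n \<Longrightarrow> has_bochner_integral lborel (\<lambda>t. indicator (Z j) t) (q j)"
      "\<And>j. j < n \<Longrightarrow> has_bochner_integral lborel (\<lambda>t. indicator (Z j) t * t) (T j)"
  shows "(\<Sum>j<n. greedy_increase j * q j / pbar I (b j) j) \<le>
    (\<Sum>j<n. wt I j * (2 * T j / pbar I (b j) j + q j)) + total_virtual_cost / 2"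
proof -
  have ints: "integrable lborel (\<lambda>t. indicator (Z j) t :: real)" "integrable lborel (\<lambda>t. indicator (Z j) t * t)"
    and vals: "(\<integral>t. indicator (Z j) t \<partial>lborel) = q j" "(\<integral>t. indicator (Z j) t * t \<partial>lborel) = T j" if "j < n" for j
    using int[OF that] by (auto simp: has_bochner_integral_iff)
  have "(\<Sum>j\<in>jobs_on b i. greedy_increase j * q j / pbar I i j) \<le>
      (\<Sum>j\<in>jobs_on b i. wt I j * (2 * T j / pbar I i j + q j)) + virtual_cost I tie i (jobs_on a i) / 2"
    if i: "i < m" for i
  proof -
    have "(\<Sum>j\<in>jobs_on b i. greedy_increase j * (\<integral>t. indicator (Z j) t \<partial>lborel) / pbar I i j) \<le>
      (\<Sum>j\<in>jobs_on b i. wt I j * (2 * (\<integral>t. indicator (Z j) t * t \<partial>lborel) / pbar I i j + (\<integral>t. indicator (Z j) t \<partial>lborel))) +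
      virtual_cost I tie i (jobs_on a i) / 2"
    proof (rule sos_machine.greedy_dual_fitting[OF machine[OF i] arrival])
      show "greedy_increase j \<le> cost_increase I tie arr a j i" if "j \<in> jobs_on b i" for j
        using greedy i that by (simp add: greedy_increase_def greedy_assignment_def)
      show "disjoint_family_on Z (jobs_on b i)" using Z(3) by (auto simp: disjoint_family_on_def)
    qed (use Z(1,2) ints in auto)
    then show ?thesis using vals by simp
  qed
  then have "(\<Sum>i<m. \<Sum>j\<in>jobs_on b i. greedy_increase j * q j / pbar I i j) \<le>
      (\<Sum>i<m. (\<Sum>j\<in>jobs_on b i. wt I j * (2 * T j / pbar I i j + q j)) + virtual_cost I tie i (jobs_on a i) / 2)"
    by (intro sum_mono) auto
  then show ?thesis
    using sum_by_machine[where b=b and f="\<lambda>i j. greedy_increase j * q j / pbar I i j", OF b]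
      sum_by_machine[where b=b and f="\<lambda>i j. wt I j * (2 * T j / pbar I i j + q j)", OF b]
    unfolding total_virtual_cost_def sum_divide_distrib sum.distrib by linarith
qed

text \<open>Dual fitting is applied to each realized schedule and then averaged. Since machine and
  start of a job are independent of its own times, all expectations factor, and only the second
  moment of a processing time brings in \<open>\<Delta>\<close>.\<close>

lemma policy_lower_bound:
  assumes "sos_policy I \<pi>" and cv: "sqCV_bounded I \<Delta>" and \<Delta>: "0 \<le> \<Delta>"
  shows "ennreal total_virtual_cost \<le> ennreal (4 + 2 * \<Delta>) * exp_cost I \<pi>"
proof (cases "exp_cost I \<pi> < \<infinity>")
  case False
  then have "exp_cost I \<pi> = \<infinity>" by (simp add: less_top[symmetric])
  then show ?thesis using \<Delta> by (simp add: ennreal_mult_top)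
next
  case fin: True
  interpret sos_policy I \<pi> by fact
  let ?V = total_virtual_cost
  have path: "(\<Sum>j<n. \<Sum>i<m. greedy_increase j / pbar I i j * (on_machine i j \<omega> * ptime I i j \<omega>)) \<le>
      (\<Sum>j<n. \<Sum>i<m. 2 / pbar I i j * (on_machine i j \<omega> * (wt I j * start j \<omega>) * ptime I i j \<omega>) +
        wt I j / pbar I i j * (on_machine i j \<omega> * (ptime I i j \<omega>)\<^sup>2) +
        wt I j * (on_machine i j \<omega> * ptime I i j \<omega>)) + ?V / 2"
    if \<omega>: "\<omega> \<in> space (prb I)" for \<omega>
  proof -
    define b where "b j = fst (\<pi> (realized I \<omega>) j)" for j
    have b: "b j < m" if "j < n" for j using machine_valid[OF \<omega> that] by (simp add: b_def)
    have p: "0 \<le> ptime I (b j) j \<omega>" if "j < n" for j using ptime_ge_0[OF b[OF that] that \<omega>] .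
    have comp: "completion (realized I \<omega>) (\<pi> (realized I \<omega>)) j = start j \<omega> + ptime I (b j) j \<omega>" if "j < n" for j
      using b[OF that] that by (simp add: completion_def start_def b_def realized_def)
    have "(\<Sum>j<n. greedy_increase j * ptime I (b j) j \<omega> / pbar I (b j) j) \<le>
      (\<Sum>j<n. wt I j * (2 * (((start j \<omega> + ptime I (b j) j \<omega>)\<^sup>2 - (start j \<omega>)\<^sup>2) / 2) / pbar I (b j) j + ptime I (b j) j \<omega>)) + ?V / 2"
    proof (rule total_dual_fitting[where Z="\<lambda>j. {start j \<omega>..<start j \<omega> + ptime I (b j) j \<omega>}"])
      show "{start j \<omega>..<start j \<omega> + ptime I (b j) j \<omega>} \<subseteq> {rel I j..}" if "j < n" for j
        using start_ge_rel[OF \<omega> that] by auto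
      show "{start j \<omega>..<start j \<omega> + ptime I (b j) j \<omega>} \<inter> {start k \<omega>..<start k \<omega> + ptime I (b k) k \<omega>} = {}"
        if "j < n" "k < n" "j \<noteq> k" "b j = b k" for j k
      proof -
        have "completion (realized I \<omega>) (\<pi> (realized I \<omega>)) j \<le> start k \<omega> \<or>
            completion (realized I \<omega>) (\<pi> (realized I \<omega>)) k \<le> start j \<omega>"
          using feas[OF realized_in_space[OF \<omega>]] that unfolding feasible_def b_def start_def by blast
        then show ?thesis using comp that by auto
      qed
      show "has_bochner_integral lborel (\<lambda>t. indicator {start j \<omega>..<start j \<omega> + ptime I (b j) j \<omega>} t) (ptime I (b j) j \<omega>)"
        if "j < n" for j
        using p[OF that] has_bochner_integral_real_indicator[of "{start j \<omega>..<start j \<omega> + ptime I (b j) j \<omega>}" lborel] by simp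
      show "has_bochner_integral lborel (\<lambda>t. indicator {start j \<omega>..<start j \<omega> + ptime I (b j) j \<omega>} t * t)
          (((start j \<omega> + ptime I (b j) j \<omega>)\<^sup>2 - (start j \<omega>)\<^sup>2) / 2)" if "j < n" for j
        using p[OF that] start_nonneg[OF \<omega> that] by (intro has_bochner_integral_time_interval) auto
    qed (use b in auto)
    moreover have "greedy_increase j * ptime I (b j) j \<omega> / pbar I (b j) j =
        (\<Sum>i<m. greedy_increase j / pbar I i j * (on_machine i j \<omega> * ptime I i j \<omega>))" if "j < n" for j
      using sum_on_machine[OF \<omega> that, of "\<lambda>i. greedy_increase j / pbar I i j * ptime I i j \<omega>"]
      by (simp add: b_def mult_ac)
    moreover have "wt I j * (2 * (((start j \<omega> + ptime I (b j) j \<omega>)\<^sup>2 - (start j \<omega>)\<^sup>2) / 2) / pbar I (b j) j + ptime I (b j) j \<omega>) =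
        (\<Sum>i<m. 2 / pbar I i j * (on_machine i j \<omega> * (wt I j * start j \<omega>) * ptime I i j \<omega>) +
        wt I j / pbar I i j * (on_machine i j \<omega> * (ptime I i j \<omega>)\<^sup>2) + wt I j * (on_machine i j \<omega> * ptime I i j \<omega>))"
      if "j < n" for j
    proof -
      have "0 < pbar I (b j) j" using pbar_gt_0 b that by blast
      then have "wt I j * (2 * (((start j \<omega> + ptime I (b j) j \<omega>)\<^sup>2 - (start j \<omega>)\<^sup>2) / 2) / pbar I (b j) j + ptime I (b j) j \<omega>) =
          2 / pbar I (b j) j * (wt I j * start j \<omega> * ptime I (b j) j \<omega>) +
          wt I j / pbar I (b j) j * (ptime I (b j) j \<omega>)\<^sup>2 + wt I j * ptime I (b j) j \<omega>"
        by (simp add: field_simps power2_eq_square)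
      also have "\<dots> = (\<Sum>i<m. on_machine i j \<omega> * (2 / pbar I i j * (wt I j * start j \<omega> * ptime I i j \<omega>) +
          wt I j / pbar I i j * (ptime I i j \<omega>)\<^sup>2 + wt I j * ptime I i j \<omega>))"
        using sum_on_machine[OF \<omega> that, of "\<lambda>i. 2 / pbar I i j * (wt I j * start j \<omega> * ptime I i j \<omega>) +
          wt I j / pbar I i j * (ptime I i j \<omega>)\<^sup>2 + wt I j * ptime I i j \<omega>"] by (simp add: b_def)
      finally show ?thesis by (simp add: distrib_left mult_ac)
    qed
    ultimately show ?thesis by simp
  qed
  note start_int = integrable_weighted_start[OF fin]
  have sq_int: "integrable (prb I) (\<lambda>\<omega>. (ptime I i j \<omega>)\<^sup>2)" if "j < n" "i < m" for i j
    using cv that by (auto simp: sqCV_bounded_def)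
  have sq_le: "(\<integral>\<omega>. (ptime I i j \<omega>)\<^sup>2 \<partial>prb I) \<le> (1 + \<Delta>) * (pbar I i j)\<^sup>2" if "j < n" "i < m" for i j
  proof -
    have "(\<integral>\<omega>. (ptime I i j \<omega> - pbar I i j)\<^sup>2 \<partial>prb I) = (\<integral>\<omega>. (ptime I i j \<omega>)\<^sup>2 \<partial>prb I) - (pbar I i j)\<^sup>2"
      unfolding pbar_def by (intro variance_eq integrable_ptime sq_int that)
    moreover have "sqCV I i j \<le> \<Delta>" using cv that by (auto simp: sqCV_bounded_def)
    ultimately show ?thesis using pbar_gt_0[OF that(2,1)] by (simp add: sqCV_def field_simps)
  qed
  have i1: "integrable (prb I) (\<lambda>\<omega>. on_machine i j \<omega> * ptime I i j \<omega>)"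
    and v1: "(\<integral>\<omega>. on_machine i j \<omega> * ptime I i j \<omega> \<partial>prb I) = assign_prob i j * pbar I i j" if "j < n" "i < m" for i j
    using on_machine_indep[OF that, of "\<lambda>x. x"] integrable_ptime that by (auto simp: pbar_def)
  have i2: "integrable (prb I) (\<lambda>\<omega>. on_machine i j \<omega> * (ptime I i j \<omega>)\<^sup>2)"
    and v2: "(\<integral>\<omega>. on_machine i j \<omega> * (ptime I i j \<omega>)\<^sup>2 \<partial>prb I) = assign_prob i j * (\<integral>\<omega>. (ptime I i j \<omega>)\<^sup>2 \<partial>prb I)"
    if "j < n" "i < m" for i j
    using on_machine_indep[OF that, of "\<lambda>x. x\<^sup>2"] sq_int that by auto
  note i3 = weighted_start_indep(2)[OF _ _ start_int] and v3 = weighted_start_indep(3)[OF _ _ start_int]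
    and i4 = weighted_start_indep(1)[OF _ _ start_int]
  let ?L = "\<lambda>\<omega>. \<Sum>j<n. \<Sum>i<m. greedy_increase j / pbar I i j * (on_machine i j \<omega> * ptime I i j \<omega>)"
  let ?t = "\<lambda>i j \<omega>. 2 / pbar I i j * (on_machine i j \<omega> * (wt I j * start j \<omega>) * ptime I i j \<omega>) +
        wt I j / pbar I i j * (on_machine i j \<omega> * (ptime I i j \<omega>)\<^sup>2) +
        wt I j * (on_machine i j \<omega> * ptime I i j \<omega>)"
  have iL: "integrable (prb I) ?L"
    by (intro Bochner_Integration.integrable_sum integrable_mult_right i1) auto
  have it: "integrable (prb I) (?t i j)" if "j < n" "i < m" for i j
    using that by (intro Bochner_Integration.integrable_add integrable_mult_right i1 i2 i3)
  \<comment> \<open>The division by the mean length cancels in expectation, and the assignment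
    probabilities of each job add up to 1.\<close>
  have vL: "(\<integral>\<omega>. ?L \<omega> \<partial>prb I) = ?V"
  proof -
    have "(\<integral>\<omega>. ?L \<omega> \<partial>prb I) = (\<Sum>j<n. \<Sum>i<m. \<integral>\<omega>. greedy_increase j / pbar I i j * (on_machine i j \<omega> * ptime I i j \<omega>) \<partial>prb I)"
    proof (subst Bochner_Integration.integral_sum)
      fix j assume "j \<in> {..<n}"
      then show "integrable (prb I) (\<lambda>\<omega>. \<Sum>i<m. greedy_increase j / pbar I i j * (on_machine i j \<omega> * ptime I i j \<omega>))"
        by (intro Bochner_Integration.integrable_sum integrable_mult_right i1) auto
    qed (intro sum.cong refl Bochner_Integration.integral_sum integrable_mult_right i1; simp)
    also have "\<dots> = (\<Sum>j<n. \<Sum>i<m. greedy_increase j * assign_prob i j)"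
    proof (intro sum.cong refl)
      fix j i assume "j \<in> {..<n}" "i \<in> {..<m}"
      then show "(\<integral>\<omega>. greedy_increase j / pbar I i j * (on_machine i j \<omega> * ptime I i j \<omega>) \<partial>prb I) = greedy_increase j * assign_prob i j"
        using pbar_gt_0[of i j] v1[of j i] by (subst integral_mult_right_zero) simp
    qed
    also have "\<dots> = ?V" by (simp add: sum_distrib_left[symmetric] sum_assign_prob total_virtual_cost_eq)
    finally show ?thesis .
  qed
  \<comment> \<open>The coefficient \<open>2 + \<Delta>\<close> consists of
    \<open>1 + \<Delta>\<close> from the second moment and 1 from the length of the processing
    interval.\<close>
  have vt: "(\<integral>\<omega>. ?t i j \<omega> \<partial>prb I) \<le> 2 * (\<integral>\<omega>. on_machine i j \<omega> * (wt I j * start j \<omega>) \<partial>prb I) +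
      (2 + \<Delta>) * (wt I j * (assign_prob i j * pbar I i j))" if ji: "j < n" "i < m" for i j
  proof -
    have pos: "0 < pbar I i j" by (rule pbar_gt_0[OF ji(2,1)])
    have "(\<integral>\<omega>. ?t i j \<omega> \<partial>prb I) = 2 / pbar I i j * ((\<integral>\<omega>. on_machine i j \<omega> * (wt I j * start j \<omega>) \<partial>prb I) * pbar I i j) +
        wt I j / pbar I i j * (assign_prob i j * (\<integral>\<omega>. (ptime I i j \<omega>)\<^sup>2 \<partial>prb I)) + wt I j * (assign_prob i j * pbar I i j)"
      unfolding v1[OF ji, symmetric] v2[OF ji, symmetric] v3[OF ji ji(1), symmetric]
      using i1[OF ji] i2[OF ji] i3[OF ji ji(1)]
      by (simp only: Bochner_Integration.integral_add integrable_mult_right Bochner_Integration.integrable_add integral_mult_right_zero)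
    also have "\<dots> \<le> 2 / pbar I i j * ((\<integral>\<omega>. on_machine i j \<omega> * (wt I j * start j \<omega>) \<partial>prb I) * pbar I i j) +
        wt I j / pbar I i j * (assign_prob i j * ((1 + \<Delta>) * (pbar I i j)\<^sup>2)) + wt I j * (assign_prob i j * pbar I i j)"
      using sq_le[OF ji] wt_ge_0[OF ji(1)] pos assign_prob_nonneg
      by (intro add_mono mult_left_mono order_refl) auto
    also have "\<dots> = 2 * (\<integral>\<omega>. on_machine i j \<omega> * (wt I j * start j \<omega>) \<partial>prb I) +
      (2 + \<Delta>) * (wt I j * (assign_prob i j * pbar I i j))"
      using pos by (simp add: field_simps power2_eq_square)
    finally show ?thesis .
  qed
  have sumi: "(\<Sum>i<m. \<integral>\<omega>. on_machine i j \<omega> * (wt I j * start j \<omega>) \<partial>prb I) = mean_start_cost j" if "j < n" for j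
  proof -
    have "(\<Sum>i<m. \<integral>\<omega>. on_machine i j \<omega> * (wt I j * start j \<omega>) \<partial>prb I) = (\<integral>\<omega>. (\<Sum>i<m. on_machine i j \<omega> * (wt I j * start j \<omega>)) \<partial>prb I)"
      by (intro Bochner_Integration.integral_sum[symmetric] i4) (use that in auto)
    also have "\<dots> = mean_start_cost j"
      using sum_on_machine[OF _ that] by (intro Bochner_Integration.integral_cong) auto
    finally show ?thesis .
  qed
  let ?C = "\<Sum>j<n. mean_start_cost j + wt I j * mean_length j"
  have "?V \<le> (\<integral>\<omega>. (\<Sum>j<n. \<Sum>i<m. ?t i j \<omega>) + ?V / 2 \<partial>prb I)"
  proof -
    have "integrable (prb I) (\<lambda>\<omega>. \<Sum>j<n. \<Sum>i<m. ?t i j \<omega>)"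
      by (intro Bochner_Integration.integrable_sum it) (simp_all only: lessThan_iff)
    then have "(\<integral>\<omega>. ?L \<omega> \<partial>prb I) \<le> (\<integral>\<omega>. (\<Sum>j<n. \<Sum>i<m. ?t i j \<omega>) + ?V / 2 \<partial>prb I)"
      by (intro integral_mono iL Bochner_Integration.integrable_add path integrable_const)
    then show ?thesis unfolding vL .
  qed
  also have "\<dots> = (\<Sum>j<n. \<Sum>i<m. \<integral>\<omega>. ?t i j \<omega> \<partial>prb I) + ?V / 2"
  proof -
    have "(\<integral>\<omega>. (\<Sum>j<n. \<Sum>i<m. ?t i j \<omega>) + ?V / 2 \<partial>prb I) = (\<integral>\<omega>. (\<Sum>j<n. \<Sum>i<m. ?t i j \<omega>) \<partial>prb I) + ?V / 2"
    proof (subst Bochner_Integration.integral_add)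
      show "integrable (prb I) (\<lambda>\<omega>. \<Sum>j<n. \<Sum>i<m. ?t i j \<omega>)"
        by (intro Bochner_Integration.integrable_sum it) (simp_all only: lessThan_iff)
    qed (simp_all only: integrable_const lebesgue_integral_const prob_space scaleR_one)
    also have "(\<integral>\<omega>. (\<Sum>j<n. \<Sum>i<m. ?t i j \<omega>) \<partial>prb I) = (\<Sum>j<n. \<integral>\<omega>. (\<Sum>i<m. ?t i j \<omega>) \<partial>prb I)"
      by (intro Bochner_Integration.integral_sum Bochner_Integration.integrable_sum it) (simp_all only: lessThan_iff)
    also have "\<dots> = (\<Sum>j<n. \<Sum>i<m. \<integral>\<omega>. ?t i j \<omega> \<partial>prb I)"
      by (intro sum.cong refl Bochner_Integration.integral_sum it) (simp_all only: lessThan_iff)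
    finally show ?thesis .
  qed
  also have "(\<Sum>j<n. \<Sum>i<m. \<integral>\<omega>. ?t i j \<omega> \<partial>prb I) \<le>
      (\<Sum>j<n. \<Sum>i<m. 2 * (\<integral>\<omega>. on_machine i j \<omega> * (wt I j * start j \<omega>) \<partial>prb I) + (2 + \<Delta>) * (wt I j * (assign_prob i j * pbar I i j)))"
    by (intro sum_mono vt) (simp_all only: lessThan_iff)
  also have "\<dots> = (\<Sum>j<n. 2 * mean_start_cost j + (2 + \<Delta>) * (wt I j * mean_length j))"
    by (simp add: sum.distrib sum_distrib_left[symmetric] sumi)
  also have "\<dots> \<le> (\<Sum>j<n. (2 + \<Delta>) * (mean_start_cost j + wt I j * mean_length j))"
  proof (intro sum_mono)
    fix j assume "j \<in> {..<n}"
    then have "0 \<le> mean_start_cost j"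
      using wt_ge_0[of j] start_nonneg[of _ j] by (intro Bochner_Integration.integral_nonneg) auto
    then show "2 * mean_start_cost j + (2 + \<Delta>) * (wt I j * mean_length j) \<le>
        (2 + \<Delta>) * (mean_start_cost j + wt I j * mean_length j)"
      using \<Delta> by (simp add: distrib_left distrib_right)
  qed
  also have "\<dots> = (2 + \<Delta>) * ?C" by (simp add: sum_distrib_left)
  \<comment> \<open>Half of \<open>?V\<close> is moved to the left-hand side, and the inequality is
    doubled.\<close>
  finally have "?V \<le> (4 + 2 * \<Delta>) * ?C" by (simp add: algebra_simps)
  moreover have "ennreal (4 + 2 * \<Delta>) * exp_cost I \<pi> = ennreal ((4 + 2 * \<Delta>) * ?C)"
    unfolding exp_cost_eq[OF fin] using \<Delta> by (intro ennreal_mult'[symmetric]) simp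
  ultimately show ?thesis by (simp add: ennreal_leI)
qed

end

section \<open>Greedy assignment versus a fixed-assignment policy\<close>

lemma sum_disjoint_intervals_le:
  fixes S p :: "nat \<Rightarrow> real"
  assumes "finite B" "s \<le> e" "\<And>k. k \<in> B \<Longrightarrow> s \<le> S k \<and> 0 \<le> p k \<and> S k + p k \<le> e"
    and "\<And>j k. j \<in> B \<Longrightarrow> k \<in> B \<Longrightarrow> j \<noteq> k \<Longrightarrow> S j + p j \<le> S k \<or> S k + p k \<le> S j"
  shows "sum p B \<le> e - s"
proof -
  have "sum p B = (\<Sum>k\<in>B. measure lborel {S k..<S k + p k})"
    using assms(3) by (intro sum.cong) auto
  also have "\<dots> = measure lborel (\<Union>k\<in>B. {S k..<S k + p k})"
    using assms(1,3) assms(4)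
    by (intro measure_finite_Union[symmetric]) (fastforce simp: disjoint_family_on_def)+
  also have "\<dots> \<le> measure lborel {s..e}"
    using assms(1-3) by (intro measure_mono_fmeasurable) (fastforce, auto simp: fmeasurable_def)
  finally show ?thesis using assms(2) by simp
qed

text \<open>The job that starts last has waited for all others to run after \<open>s\<close>, so its
  start pays for all its pairs. The factor 2 arises because every unordered pair occurs twice on the
  left.\<close>

lemma sum_pairs_le_weighted_starts:
  fixes S p :: "nat \<Rightarrow> real"
  assumes "finite B" "\<And>k. k \<in> B \<Longrightarrow> s \<le> S k \<and> 0 \<le> p k"
    and "\<And>j k. j \<in> B \<Longrightarrow> k \<in> B \<Longrightarrow> j \<noteq> k \<Longrightarrow> S j + p j \<le> S k \<or> S k + p k \<le> S j"
  shows "(\<Sum>j\<in>B. \<Sum>k\<in>B - {j}. p j * p k) \<le> 2 * (\<Sum>j\<in>B. p j * (S j - s))"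
  using assms
proof (induction B rule: finite_ranking_induct[where f=S])
  case (insert x B)
  show ?case
  proof (cases "x \<in> B")
    case True
    then show ?thesis using insert by (simp add: insert_absorb)
  next
    case False
    \<comment> \<open>A job of length zero may start together with another job that is still to run,
      but its products vanish anyway.\<close>
    have "sum p B \<le> S x - s" if "p x \<noteq> 0"
    proof (rule sum_disjoint_intervals_le)
      have "0 < p x" using that insert.prems(1)[of x] by auto
      then have "S k + p k \<le> S x" if "k \<in> B" for k
        using insert.prems(2)[of x k] insert.hyps(2)[OF that] that False by force
      then show "s \<le> S k \<and> 0 \<le> p k \<and> S k + p k \<le> S x" if "k \<in> B" for k
        using insert.prems(1)[of k] that by auto
    qed (use insert in auto)
    then have x: "p x * sum p B \<le> p x * (S x - s)"
      using insert.prems(1)[of x] by (cases "p x = 0") (auto intro: mult_left_mono)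
    have "(\<Sum>j\<in>B. \<Sum>k\<in>insert x B - {j}. p j * p k) = (\<Sum>j\<in>B. p j * p x + (\<Sum>k\<in>B - {j}. p j * p k))"
    proof (intro sum.cong refl)
      fix j assume "j \<in> B"
      then have "insert x B - {j} = insert x (B - {j})" using False by auto
      then show "(\<Sum>k\<in>insert x B - {j}. p j * p k) = p j * p x + (\<Sum>k\<in>B - {j}. p j * p k)"
        using insert.hyps(1) False by simp
    qed
    also have "\<dots> = p x * sum p B + (\<Sum>j\<in>B. \<Sum>k\<in>B - {j}. p j * p k)"
      by (simp add: sum.distrib sum_distrib_left mult.commute)
    finally have "(\<Sum>j\<in>insert x B. \<Sum>k\<in>insert x B - {j}. p j * p k) =
        2 * (p x * sum p B) + (\<Sum>j\<in>B. \<Sum>k\<in>B - {j}. p j * p k)"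
      using insert.hyps(1) False by (simp add: sum_distrib_left)
    also have "\<dots> \<le> 2 * (p x * (S x - s)) + 2 * (\<Sum>j\<in>B. p j * (S j - s))"
      using x insert by (intro add_mono) auto
    finally show ?thesis using insert.hyps(1) False by simp
  qed
qed simp

lemma sum_square_split:
  fixes p :: "nat \<Rightarrow> real"
  assumes "finite B"
  shows "(sum p B)\<^sup>2 = (\<Sum>j\<in>B. (p j)\<^sup>2) + (\<Sum>j\<in>B. \<Sum>k\<in>B - {j}. p j * p k)"
proof -
  have "(sum p B)\<^sup>2 = (\<Sum>j\<in>B. \<Sum>k\<in>B. p j * p k)" by (simp add: power2_eq_square sum_product)
  also have "\<dots> = (\<Sum>j\<in>B. (p j)\<^sup>2 + (\<Sum>k\<in>B - {j}. p j * p k))"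
    using assms by (intro sum.cong refl) (simp add: sum.remove power2_eq_square)
  finally show ?thesis by (simp add: sum.distrib)
qed

context sos_machine
begin

text \<open>Each layer is work-conserving and splits into busy periods. Layers have nonnegative
  thresholds, so all jobs concerned have positive weight; later this makes their start times
  integrable.\<close>

lemma sum_le_by_busy_periods:
  assumes J: "J \<subseteq> {..<njobs I}"
    and le: "\<And>B s. B \<subseteq> J \<Longrightarrow> (\<And>k. k \<in> B \<Longrightarrow> 0 < wt I k) \<Longrightarrow> 0 \<le> s \<Longrightarrow> (\<And>k. k \<in> B \<Longrightarrow> s \<le> rel I k) \<Longrightarrow>
      (\<And>u. s < u \<Longrightarrow> u < s + sum (pbar I i) B \<Longrightarrow> vs J u \<in> Some ` B) \<Longrightarrow> sum X B \<le> sum Y B"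
  shows "(\<Sum>k\<in>J. ratio k * X k) \<le> (\<Sum>k\<in>J. ratio k * Y k)"
proof -
  interpret G: greedy_schedule J "pbar I i" "rel I" "vs J" using J J by (rule vs_greedy)
  have layer: "(\<forall>k\<in>U. 0 < wt I k) \<longrightarrow> sum X U \<le> sum Y U"
    if "U \<subseteq> J" "work_conserving (vs J) (pbar I i) (rel I) U" for U
    using that
  proof (induction rule: G.busy_period_induct)
    case (period U B s)
    show ?case
    proof
      assume pos: "\<forall>k\<in>U \<union> B. 0 < wt I k"
      have "sum X B \<le> sum Y B" by (rule le[of B s]) (use period pos in auto)
      moreover have "sum X U \<le> sum Y U" using period(7) pos by auto
      ultimately show "sum X (U \<union> B) \<le> sum Y (U \<union> B)"
        using G.finite_sub[OF period(1)] G.finite_sub[OF period(2)] period(3) by (simp add: sum.union_disjoint)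
    qed
  qed simp
  show ?thesis
  proof (rule sum_le_by_layers[OF G.finite_jobs])
    show "0 \<le> ratio k" if "k \<in> J" for k using that J ratio_nonneg by auto
    fix x :: real assume "0 \<le> x"
    have "0 < wt I k" if "k \<in> J" "x < ratio k" for k
    proof -
      have "0 < ratio k" using that \<open>0 \<le> x\<close> by linarith
      then show ?thesis using G.p_pos[OF that(1)] by (simp add: zero_less_divide_iff)
    qed
    then show "sum X {k. k \<in> J \<and> x < ratio k} \<le> sum Y {k. k \<in> J \<and> x < ratio k}"
      using layer[OF _ vs_layer[OF J J, of x]] by auto
  qed
qed

text \<open>The requirements times the mean busy times add up to the integral of the backlog of
  \<open>B\<close>, which for a single busy period does not depend on the order of the jobs.\<close>

lemma busy_period_mean_busy_times:
  assumes J: "J \<subseteq> {..<njobs I}" and B: "B \<subseteq> J" and s: "0 \<le> s" "\<And>k. k \<in> B \<Longrightarrow> s \<le> rel I k"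
    and busy: "\<And>u. s < u \<Longrightarrow> u < s + sum (pbar I i) B \<Longrightarrow> vs J u \<in> Some ` B"
  shows "(\<Sum>k\<in>B. pbar I i k * (mean_busy_time I i (vs J) k + pbar I i k / 2)) =
    s * sum (pbar I i) B + (sum (pbar I i) B)\<^sup>2 / 2 + (\<Sum>k\<in>B. (pbar I i k)\<^sup>2 / 2)"
proof -
  let ?p = "pbar I i"
  interpret G: greedy_schedule J ?p "rel I" "vs J" using J J by (rule vs_greedy)
  obtain H0 where H0: "0 \<le> H0" "\<And>t k. H0 \<le> t \<Longrightarrow> k \<in> J \<Longrightarrow> processed (vs J) k t = ?p k"
    using G.completed_eventually by blast
  define H where "H = max H0 (s + sum ?p B)"
  have H: "0 \<le> H" "H0 \<le> H" "s + sum ?p B \<le> H" using H0(1) by (auto simp: H_def)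
  have "?p k * (mean_busy_time I i (vs J) k + ?p k / 2) =
      integral {0..H} (\<lambda>t. ?p k - processed (vs J) k t) + (?p k)\<^sup>2 / 2" if "k \<in> B" for k
  proof -
    have k: "k \<in> J" using that B by auto
    show ?thesis
      unfolding mean_busy_time_def G.integral_busy_time[OF k H(1) H0(2)[OF H(2) k], symmetric]
      using G.p_pos[OF k] by (simp add: field_simps power2_eq_square)
  qed
  then have "(\<Sum>k\<in>B. ?p k * (mean_busy_time I i (vs J) k + ?p k / 2)) =
      integral {0..H} (backlog (vs J) ?p B) + (\<Sum>k\<in>B. (?p k)\<^sup>2 / 2)"
    unfolding backlog_def[abs_def] using G.finite_sub[OF B]
    by (subst integral_sum) (auto simp: sum.distrib intro!: integrable_continuous_real continuous_intros G.continuous_on_processed)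
  also have "integral {0..H} (backlog (vs J) ?p B) = s * sum ?p B + (sum ?p B)\<^sup>2 / 2"
    using B s busy H(3) by (intro G.integral_backlog_busy_period) auto
  finally show ?thesis .
qed

end

locale sos_fixed_assignment = sos_policy +
  fixes b :: "nat \<Rightarrow> nat"
  assumes fixed: "p \<in> space (realizations I) \<Longrightarrow> j < njobs I \<Longrightarrow> fst (\<pi> p j) = b j"
begin

lemma b_eq: "\<omega> \<in> space (prb I) \<Longrightarrow> j < n \<Longrightarrow> fst (\<pi> (realized I \<omega>) j) = b j"
  by (rule fixed[OF realized_in_space])

lemma b_less: "j < n \<Longrightarrow> b j < m"
  using not_empty machine_valid b_eq by fastforce

lemma assign_prob_fixed: "j < n \<Longrightarrow> assign_prob i j = (if i = b j then 1 else 0)"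
proof -
  assume j: "j < n"
  have "assign_prob i j = (\<integral>\<omega>. (if i = b j then 1 else 0) \<partial>prb I)"
    unfolding assign_prob_def using b_eq[OF _ j]
    by (intro Bochner_Integration.integral_cong) (auto simp: on_machine_def)
  then show ?thesis by (simp add: prob_space)
qed

text \<open>Disjointness of the jobs on one machine bounds products of distinct times by weighted
  starts. A job's time is independent of its own start and of the other times, so averaging produces
  products of means. The squares of the means are added only afterwards, and no variance
  appears.\<close>

lemma busy_period_lower_bound:
  assumes i: "i < m" and B: "finite B" "B \<subseteq> {k. k < n \<and> b k = i}"
    and int: "\<And>k. k \<in> B \<Longrightarrow> integrable (prb I) (start k)" and s: "\<And>k. k \<in> B \<Longrightarrow> s \<le> rel I k"
  shows "s * sum (pbar I i) B + (sum (pbar I i) B)\<^sup>2 / 2 \<le>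
    (\<Sum>j\<in>B. pbar I i j * (\<integral>\<omega>. start j \<omega> \<partial>prb I) + (pbar I i j)\<^sup>2 / 2)"
proof -
  have Bn: "k < n" "b k = i" if "k \<in> B" for k using B that by auto
  let ?p = "\<lambda>j \<omega>. ptime I i j \<omega>"
  have pint: "integrable (prb I) (?p j)" if "j \<in> B" for j using integrable_ptime[OF i Bn(1)[OF that]] .
  have pS: "integrable (prb I) (\<lambda>\<omega>. ?p j \<omega> * start j \<omega>) \<and> (\<integral>\<omega>. ?p j \<omega> * start j \<omega> \<partial>prb I) = pbar I i j * (\<integral>\<omega>. start j \<omega> \<partial>prb I)"
    if j: "j \<in> B" for j
  proof -
    have "integrable (prb I) (\<lambda>\<omega>. start_fn j (other_jobs j \<omega>))"
      using iffD1[OF Bochner_Integration.integrable_cong[OF refl start_eq[OF _ Bn(1)[OF j]]] int[OF j]] .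
    from own_job_indep[OF Bn(1)[OF j] i measurable_start_fn[OF Bn(1)[OF j]] measurable_ident_sets[OF refl] this pint[OF j]]
    have "integrable (prb I) (\<lambda>\<omega>. ?p j \<omega> * start_fn j (other_jobs j \<omega>))"
      "(\<integral>\<omega>. ?p j \<omega> * start_fn j (other_jobs j \<omega>) \<partial>prb I) = pbar I i j * (\<integral>\<omega>. start_fn j (other_jobs j \<omega>) \<partial>prb I)"
      by (simp_all add: pbar_def mult.commute)
    moreover have "(\<integral>\<omega>. start j \<omega> \<partial>prb I) = (\<integral>\<omega>. start_fn j (other_jobs j \<omega>) \<partial>prb I)"
      using start_eq[OF _ Bn(1)[OF j]] by (intro Bochner_Integration.integral_cong) auto
    moreover have "(\<integral>\<omega>. ?p j \<omega> * start j \<omega> \<partial>prb I) = (\<integral>\<omega>. ?p j \<omega> * start_fn j (other_jobs j \<omega>) \<partial>prb I)"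
      using start_eq[OF _ Bn(1)[OF j]] by (intro Bochner_Integration.integral_cong) auto
    moreover have "integrable (prb I) (\<lambda>\<omega>. ?p j \<omega> * start j \<omega>) \<longleftrightarrow> integrable (prb I) (\<lambda>\<omega>. ?p j \<omega> * start_fn j (other_jobs j \<omega>))"
      using start_eq[OF _ Bn(1)[OF j]] by (intro Bochner_Integration.integrable_cong) auto
    ultimately show ?thesis by simp
  qed
  have pp: "integrable (prb I) (\<lambda>\<omega>. ?p j \<omega> * ?p k \<omega>) \<and> (\<integral>\<omega>. ?p j \<omega> * ?p k \<omega> \<partial>prb I) = pbar I i j * pbar I i k"
    if jk: "j \<in> B" "k \<in> B" "k \<noteq> j" for j k
  proof -
    have eq: "other_jobs j \<omega> k i = ptime I i k \<omega>" for \<omega>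
      using jk Bn(1)[OF jk(2)] i by (simp add: other_jobs_def)
    have "integrable (prb I) (\<lambda>\<omega>. other_jobs j \<omega> k i)" unfolding eq by (rule pint[OF jk(2)])
    from own_job_indep[OF Bn(1)[OF jk(1)] i measurable_others_component[OF Bn(1)[OF jk(2)] jk(3) i] measurable_ident_sets[OF refl] this pint[OF jk(1)]]
    show ?thesis unfolding eq by (simp add: pbar_def mult.commute)
  qed
  have path: "(\<Sum>j\<in>B. \<Sum>k\<in>B - {j}. ?p j \<omega> * ?p k \<omega>) \<le> 2 * (\<Sum>j\<in>B. ?p j \<omega> * start j \<omega> - s * ?p j \<omega>)"
    if \<omega>: "\<omega> \<in> space (prb I)" for \<omega>
  proof -
    have "(\<Sum>j\<in>B. \<Sum>k\<in>B - {j}. ?p j \<omega> * ?p k \<omega>) \<le> 2 * (\<Sum>j\<in>B. ?p j \<omega> * (start j \<omega> - s))"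
    proof (rule sum_pairs_le_weighted_starts[OF B(1)])
      show "s \<le> start k \<omega> \<and> 0 \<le> ?p k \<omega>" if "k \<in> B" for k
        using s[OF that] start_ge_rel[OF \<omega> Bn(1)[OF that]] ptime_ge_0[OF i Bn(1)[OF that] \<omega>] by auto
      fix j k assume jk: "j \<in> B" "k \<in> B" "j \<noteq> k"
      have "completion (realized I \<omega>) (\<pi> (realized I \<omega>)) l = start l \<omega> + ?p l \<omega>" if "l \<in> B" for l
        using b_eq[OF \<omega> Bn(1)[OF that]] Bn[OF that] i by (simp add: completion_def start_def realized_def)
      moreover have "completion (realized I \<omega>) (\<pi> (realized I \<omega>)) j \<le> snd (\<pi> (realized I \<omega>) k) \<or>
          completion (realized I \<omega>) (\<pi> (realized I \<omega>)) k \<le> snd (\<pi> (realized I \<omega>) j)"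
        using feas[OF realized_in_space[OF \<omega>]] Bn[OF jk(1)] Bn[OF jk(2)] b_eq[OF \<omega>] jk(3)
        unfolding feasible_def by metis
      ultimately show "start j \<omega> + ?p j \<omega> \<le> start k \<omega> \<or> start k \<omega> + ?p k \<omega> \<le> start j \<omega>"
        using jk by (simp add: start_def)
    qed
    then show ?thesis by (simp add: right_diff_distrib mult.commute)
  qed
  have "(\<integral>\<omega>. (\<Sum>j\<in>B. \<Sum>k\<in>B - {j}. ?p j \<omega> * ?p k \<omega>) \<partial>prb I) \<le> (\<integral>\<omega>. 2 * (\<Sum>j\<in>B. ?p j \<omega> * start j \<omega> - s * ?p j \<omega>) \<partial>prb I)"
    using pp pS pint
    by (intro integral_mono path Bochner_Integration.integrable_sum integrable_mult_right Bochner_Integration.integrable_diff) auto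
  moreover have "(\<integral>\<omega>. (\<Sum>j\<in>B. \<Sum>k\<in>B - {j}. ?p j \<omega> * ?p k \<omega>) \<partial>prb I) = (\<Sum>j\<in>B. \<Sum>k\<in>B - {j}. pbar I i j * pbar I i k)"
  proof -
    have "(\<integral>\<omega>. (\<Sum>j\<in>B. \<Sum>k\<in>B - {j}. ?p j \<omega> * ?p k \<omega>) \<partial>prb I) = (\<Sum>j\<in>B. \<integral>\<omega>. (\<Sum>k\<in>B - {j}. ?p j \<omega> * ?p k \<omega>) \<partial>prb I)"
      using pp by (intro Bochner_Integration.integral_sum Bochner_Integration.integrable_sum) auto
    also have "\<dots> = (\<Sum>j\<in>B. \<Sum>k\<in>B - {j}. \<integral>\<omega>. ?p j \<omega> * ?p k \<omega> \<partial>prb I)"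
      using pp by (intro sum.cong refl Bochner_Integration.integral_sum) auto
    also have "\<dots> = (\<Sum>j\<in>B. \<Sum>k\<in>B - {j}. pbar I i j * pbar I i k)"
      using pp by (intro sum.cong refl) auto
    finally show ?thesis .
  qed
  moreover have "(\<integral>\<omega>. 2 * (\<Sum>j\<in>B. ?p j \<omega> * start j \<omega> - s * ?p j \<omega>) \<partial>prb I) =
      2 * (\<Sum>j\<in>B. pbar I i j * (\<integral>\<omega>. start j \<omega> \<partial>prb I) - s * pbar I i j)"
  proof -
    have "(\<integral>\<omega>. (\<Sum>j\<in>B. ?p j \<omega> * start j \<omega> - s * ?p j \<omega>) \<partial>prb I) = (\<Sum>j\<in>B. \<integral>\<omega>. ?p j \<omega> * start j \<omega> - s * ?p j \<omega> \<partial>prb I)"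
      using pS pint by (intro Bochner_Integration.integral_sum Bochner_Integration.integrable_diff integrable_mult_right) auto
    also have "\<dots> = (\<Sum>j\<in>B. pbar I i j * (\<integral>\<omega>. start j \<omega> \<partial>prb I) - s * pbar I i j)"
      using pS pint by (intro sum.cong refl) (subst Bochner_Integration.integral_diff, auto simp: pbar_def)
    finally show ?thesis by simp
  qed
  ultimately have "(\<Sum>j\<in>B. \<Sum>k\<in>B - {j}. pbar I i j * pbar I i k) \<le>
      2 * (\<Sum>j\<in>B. pbar I i j * (\<integral>\<omega>. start j \<omega> \<partial>prb I) - s * pbar I i j)" by simp
  then show ?thesis
    unfolding sum_square_split[OF B(1)]
    by (simp add: sum.distrib sum_subtractf sum_distrib_left[symmetric] sum_divide_distrib[symmetric] add_divide_distrib)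
qed

lemma virtual_cost_fixed_assignment_le:
  assumes i: "i < m" and tie: "sos_machine I tie i" and fin: "exp_cost I \<pi> < \<infinity>"
  shows "virtual_cost I tie i {k. k < n \<and> b k = i} \<le>
    (\<Sum>j | j < n \<and> b j = i. mean_start_cost j + wt I j * pbar I i j)"
proof -
  interpret M: sos_machine I tie i by fact
  let ?J = "{k. k < n \<and> b k = i}" and ?p = "pbar I i"
  have J: "?J \<subseteq> {..<njobs I}" by auto
  have "(\<Sum>k\<in>?J. M.ratio k * (?p k * (mean_busy_time I i (M.vs ?J) k + ?p k / 2))) \<le>
      (\<Sum>k\<in>?J. M.ratio k * (?p k * (\<integral>\<omega>. start k \<omega> \<partial>prb I) + (?p k)\<^sup>2))"
  proof (rule M.sum_le_by_busy_periods[OF J])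
    fix B s
    assume period: "B \<subseteq> ?J" "\<And>k. k \<in> B \<Longrightarrow> 0 < wt I k" "0 \<le> s" "\<And>k. k \<in> B \<Longrightarrow> s \<le> rel I k"
      "\<And>u. s < u \<Longrightarrow> u < s + sum ?p B \<Longrightarrow> M.vs ?J u \<in> Some ` B"
    have int: "integrable (prb I) (start k)" if "k \<in> B" for k
      using integrable_weighted_start[OF fin, of k] period(1) period(2)[OF that] that by auto
    have "(\<Sum>k\<in>B. ?p k * (mean_busy_time I i (M.vs ?J) k + ?p k / 2)) =
        s * sum ?p B + (sum ?p B)\<^sup>2 / 2 + (\<Sum>k\<in>B. (?p k)\<^sup>2 / 2)"
      by (rule M.busy_period_mean_busy_times[OF J period(1,3)]) (use period in auto)
    also have "\<dots> \<le> (\<Sum>j\<in>B. ?p j * (\<integral>\<omega>. start j \<omega> \<partial>prb I) + (?p j)\<^sup>2 / 2) + (\<Sum>k\<in>B. (?p k)\<^sup>2 / 2)"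
      using finite_subset[OF period(1)]
      by (intro add_right_mono busy_period_lower_bound[OF i _ period(1) int period(4)]) auto
    also have "\<dots> = (\<Sum>k\<in>B. ?p k * (\<integral>\<omega>. start k \<omega> \<partial>prb I) + (?p k)\<^sup>2)"
      by (simp add: sum.distrib sum_divide_distrib[symmetric])
    finally show "(\<Sum>k\<in>B. ?p k * (mean_busy_time I i (M.vs ?J) k + ?p k / 2)) \<le>
        (\<Sum>k\<in>B. ?p k * (\<integral>\<omega>. start k \<omega> \<partial>prb I) + (?p k)\<^sup>2)" .
  qed
  moreover have "M.ratio k * (?p k * x) = wt I k * x" "M.ratio k * (?p k * y + (?p k)\<^sup>2) = wt I k * y + wt I k * ?p k"
    if "k \<in> ?J" for k x y
    using M.pbar_pos[of k] that by (auto simp: field_simps power2_eq_square)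
  ultimately show ?thesis by (simp add: virtual_cost_def)
qed

end

context sos_greedy
begin

text \<open>The competing schedule here is deterministic: the virtual WSPT schedules of the
  assignment \<open>b\<close>. Job \<open>j\<close> then has first moment equal to its mean length
  times its mean busy time, so the right-hand side is twice the virtual cost of \<open>b\<close>,
  which the expected cost of the policy bounds from above.\<close>

lemma fixed_assignment_lower_bound:
  assumes "sos_fixed_assignment I \<pi> b"
  shows "ennreal total_virtual_cost \<le> 4 * exp_cost I \<pi>"
proof (cases "exp_cost I \<pi> < \<infinity>")
  case False
  then have "exp_cost I \<pi> = \<infinity>" by (simp add: less_top[symmetric])
  then show ?thesis by (simp add: ennreal_mult_top)
next
  case fin: True
  interpret sos_fixed_assignment I \<pi> b by fact
  let ?V = total_virtual_cost
  define \<sigma> where "\<sigma> i = virtual_schedule I tie i (jobs_on b i)" for i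
  define Z where "Z j = {t. \<sigma> (b j) t = Some j}" for j
  have G: "greedy_schedule (jobs_on b i) (pbar I i) (rel I) (\<sigma> i)" if "i < m" for i
    unfolding \<sigma>_def by (intro sos_machine.vs_greedy[OF machine[OF that]]) auto
  have "(\<Sum>j<n. greedy_increase j * pbar I (b j) j / pbar I (b j) j) \<le>
      (\<Sum>j<n. wt I j * (2 * (pbar I (b j) j * mean_busy_time I (b j) (\<sigma> (b j)) j) / pbar I (b j) j + pbar I (b j) j)) + ?V / 2"
  proof (rule total_dual_fitting[where Z=Z])
    fix j assume j: "j < n"
    interpret S: greedy_schedule "jobs_on b (b j)" "pbar I (b j)" "rel I" "\<sigma> (b j)" by (rule G[OF b_less[OF j]])
    have jJ: "j \<in> jobs_on b (b j)" using j by simp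
    show Zb: "Z j \<in> sets borel" unfolding Z_def by (rule S.sets_busy)
    show sub: "Z j \<subseteq> {rel I j..}" using S.scheduled[of _ j] by (auto simp: Z_def)
    then have Z0: "Z j \<subseteq> {0..}" using rel_ge_0[OF j] by auto
    obtain H where H: "0 \<le> H" "processed (\<sigma> (b j)) j H = pbar I (b j) j"
      using S.completed_eventually jJ by blast
    have "Z j = Z j \<inter> {0..H}" using Z0 S.not_busy_after_completion[OF jJ H(2)] by (fastforce simp: Z_def)
    moreover have "measure lborel (Z j \<inter> {0..H}) = pbar I (b j) j"
      using H(2) by (simp add: processed_eq_amount amount_def Z_def)
    ultimately have ms: "measure lborel (Z j) = pbar I (b j) j" "emeasure lborel (Z j) < \<infinity>"
      using emeasure_Int_Icc_finite[of "Z j" 0 H] by (auto simp: less_top)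
    then show "has_bochner_integral lborel (\<lambda>t. indicator (Z j) t) (pbar I (b j) j)"
      using has_bochner_integral_real_indicator[of "Z j" lborel] Zb by simp
    have eq: "(\<lambda>t. indicator {0..} t * (busy (\<sigma> (b j)) j t * t)) = (\<lambda>t. indicator (Z j) t * t)"
      using Z0 by (auto simp: fun_eq_iff busy_def Z_def indicator_def)
    show "has_bochner_integral lborel (\<lambda>t. indicator (Z j) t * t) (pbar I (b j) j * mean_busy_time I (b j) (\<sigma> (b j)) j)"
      using S.integrable_busy_time[OF jJ] S.p_pos[OF jJ]
      by (simp add: has_bochner_integral_iff eq[symmetric] mean_busy_time_def set_lebesgue_integral_def)
  qed (use b_less in \<open>auto simp: Z_def\<close>)
  moreover have "pbar I (b j) j \<noteq> 0" if "j < n" for j using pbar_gt_0[OF b_less[OF that] that] by simp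
  ultimately have "?V \<le> (\<Sum>j<n. wt I j * (2 * mean_busy_time I (b j) (\<sigma> (b j)) j + pbar I (b j) j)) + ?V / 2"
    by (simp add: total_virtual_cost_eq)
  also have "(\<Sum>j<n. wt I j * (2 * mean_busy_time I (b j) (\<sigma> (b j)) j + pbar I (b j) j)) =
      2 * (\<Sum>j<n. wt I j * (mean_busy_time I (b j) (\<sigma> (b j)) j + pbar I (b j) j / 2))"
    by (simp add: sum_distrib_left algebra_simps)
  also have "(\<Sum>j<n. wt I j * (mean_busy_time I (b j) (\<sigma> (b j)) j + pbar I (b j) j / 2)) =
      (\<Sum>i<m. virtual_cost I tie i (jobs_on b i))"
    unfolding virtual_cost_def \<sigma>_def using b_less by (subst sum_by_machine) auto
  also have "\<dots> \<le> (\<Sum>i<m. \<Sum>j | j < n \<and> b j = i. mean_start_cost j + wt I j * pbar I i j)"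
    using virtual_cost_fixed_assignment_le[OF _ machine fin] by (intro sum_mono) auto
  also have "\<dots> = (\<Sum>j<n. mean_start_cost j + wt I j * pbar I (b j) j)"
    using b_less by (subst sum_by_machine) auto
  also have "\<dots> = (\<Sum>j<n. mean_start_cost j + wt I j * mean_length j)"
  proof (intro sum.cong refl)
    fix j assume "j \<in> {..<n}"
    then have "mean_length j = (\<Sum>i<m. if i = b j then pbar I i j else 0)"
      by (intro sum.cong) (auto simp: assign_prob_fixed)
    then show "mean_start_cost j + wt I j * pbar I (b j) j =
        mean_start_cost j + wt I j * mean_length j"
      using b_less[of j] \<open>j \<in> {..<n}\<close> by simp
  qed
  finally have "?V \<le> 4 * (\<Sum>j<n. mean_start_cost j + wt I j * mean_length j)"
    by simp
  then have "ennreal ?V \<le> ennreal (4 * (\<Sum>j<n. mean_start_cost j + wt I j * mean_length j))"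
    by (rule ennreal_leI)
  also have "\<dots> = 4 * exp_cost I \<pi>" unfolding exp_cost_eq[OF fin] by (subst ennreal_mult') simp_all
  finally show ?thesis .
qed

end

section \<open>Queueing at fixed points of the virtual schedule\<close>

text \<open>Taken from list positions rather than from queue times, so that it stays a strict total
  order on the queue even when queue times coincide.\<close>

definition queued_before :: "nat list \<Rightarrow> nat \<Rightarrow> nat set" where
  "queued_before ks j = set (takeWhile (\<lambda>k. k \<noteq> j) ks)"

lemma queued_before_subset: "queued_before ks j \<subseteq> set ks - {j}"
  by (auto simp: queued_before_def dest: set_takeWhileD)

lemma queued_before_total:
  assumes "j \<in> set ks" "k \<in> set ks" "j \<noteq> k"
  shows "k \<in> queued_before ks j \<longleftrightarrow> j \<notin> queued_before ks k"
  using assms by (induction ks) (auto simp: queued_before_def)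

lemma queued_before_sorted:
  assumes "sorted (map e ks)" "j \<in> set ks" "k \<in> queued_before ks j"
  shows "e k \<le> e j"
  using assms by (induction ks) (auto simp: queued_before_def split: if_splits)

text \<open>When \<open>j\<close> enters, all its predecessors have entered already, so the machine
  does not idle again before \<open>j\<close> starts, and the wait is at most their total
  length.\<close>

lemma fifo_start_le:
  assumes "sorted (map e ks)" "j \<in> set ks" "distinct ks" "\<And>k. k \<in> set ks \<Longrightarrow> 0 \<le> d k"
  shows "fifo_start e d t ks j \<le> max t (e j) + sum d (queued_before ks j)"
  using assms
proof (induction ks arbitrary: t)
  case (Cons x ks)
  show ?case
  proof (cases "j = x")
    case False
    then have j: "j \<in> set ks" using Cons.prems by auto
    have IH: "fifo_start e d (max t (e x) + d x) ks j \<le> max (max t (e x) + d x) (e j) + sum d (queued_before ks j)"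
      using Cons.prems j by (intro Cons.IH) auto
    have "e x \<le> e j" "0 \<le> d x" using Cons.prems j by auto
    then have "max (max t (e x) + d x) (e j) \<le> max t (e j) + d x" by auto
    with IH have "fifo_start e d (max t (e x) + d x) ks j \<le> max t (e j) + d x + sum d (queued_before ks j)"
      by linarith
    moreover have "queued_before (x # ks) j = insert x (queued_before ks j)" "finite (queued_before ks j)"
      using False by (auto simp: queued_before_def)
    moreover have "x \<notin> queued_before ks j" using queued_before_subset[of ks j] Cons.prems(3) by auto
    ultimately show ?thesis using False by (simp add: Let_def)
  qed (simp add: queued_before_def)
qed simp

section \<open>Points of the virtual schedule at which a given fraction is processed\<close>

context greedy_schedule
begin

abbreviation "apoint k \<alpha> \<equiv> Inf {t. 0 \<le> t \<and> \<alpha> * p k \<le> processed \<sigma> k t}"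

lemma apoint_mem:
  assumes k: "k \<in> J" and \<alpha>: "\<alpha> \<le> 1"
  shows "0 \<le> apoint k \<alpha> \<and> \<alpha> * p k \<le> processed \<sigma> k (apoint k \<alpha>)"
proof -
  let ?A = "{t. 0 \<le> t \<and> \<alpha> * p k \<le> processed \<sigma> k t}"
  obtain H where "0 \<le> H" "processed \<sigma> k H = p k" using completed_eventually k by blast
  then have ne: "?A \<noteq> {}" using \<alpha> p_pos[OF k] by (auto intro!: exI[of _ H] simp: mult_le_cancel_right1)
  have "closed ({t. 0 \<le> t} \<inter> {t. \<alpha> * p k \<le> processed \<sigma> k t})"
    using continuous_on_processed by (intro closed_Int closed_Collect_le continuous_intros) auto
  then have "closed ?A" by (simp add: Collect_conj_eq)
  then have "Inf ?A \<in> ?A" using ne by (intro closed_contains_Inf) (auto simp: bdd_below_def)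
  then show ?thesis by simp
qed

lemma apoint_le_iff:
  assumes k: "k \<in> J" "\<alpha> \<le> 1" and t: "0 \<le> t"
  shows "apoint k \<alpha> \<le> t \<longleftrightarrow> \<alpha> * p k \<le> processed \<sigma> k t"
proof
  show "\<alpha> * p k \<le> processed \<sigma> k t" if "apoint k \<alpha> \<le> t"
    using apoint_mem[OF k] processed_mono[OF that, of k] by linarith
  show "apoint k \<alpha> \<le> t" if "\<alpha> * p k \<le> processed \<sigma> k t"
    using that t by (intro cInf_lower) (auto simp: bdd_below_def)
qed

lemma processed_apoint:
  assumes k: "k \<in> J" "0 \<le> \<alpha>" "\<alpha> \<le> 1"
  shows "processed \<sigma> k (apoint k \<alpha>) = \<alpha> * p k"
proof -
  have "processed \<sigma> k 0 = 0" by (simp add: processed_eq_amount amount_nonpos)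
  then obtain t where t: "0 \<le> t" "t \<le> apoint k \<alpha>" "processed \<sigma> k t = \<alpha> * p k"
    using IVT'[of "processed \<sigma> k" 0 "\<alpha> * p k" "apoint k \<alpha>"] apoint_mem[OF k(1,3)] k(2) p_pos[OF k(1)]
      continuous_on_processed by force
  then have "t = apoint k \<alpha>" using apoint_le_iff[OF k(1,3) t(1)] by simp
  then show ?thesis using t(3) by simp
qed

text \<open>
  During a busy period \<open>B\<close> starting at \<open>s\<close>, the jobs outside \<open>B\<close> that precede \<open>j\<close> in the queue have already
  received an \<open>\<alpha>\<close>-fraction before \<open>s\<close>, and those inside \<open>B\<close> that follow \<open>j\<close> still lack a
  \<open>(1 - \<alpha>)\<close>-fraction at the \<open>\<alpha>\<close>-point of \<open>j\<close>.
\<close>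

lemma busy_period_fifo_bound:
  assumes \<alpha>: "0 < \<alpha>" "\<alpha> \<le> 1"
    and R: "\<And>j k. j \<in> J \<Longrightarrow> k \<in> J \<Longrightarrow> j \<noteq> k \<Longrightarrow> R k j \<longleftrightarrow> \<not> R j k" "\<And>j. \<not> R j j"
      "\<And>j k. j \<in> J \<Longrightarrow> k \<in> J \<Longrightarrow> R k j \<Longrightarrow> apoint k \<alpha> \<le> apoint j \<alpha>"
    and B: "B \<subseteq> J" and s: "0 \<le> s" "\<And>k. k \<in> B \<Longrightarrow> s \<le> r k"
    and busy: "\<And>u. s < u \<Longrightarrow> u < s + sum p B \<Longrightarrow> \<sigma> u \<in> Some ` B"
    and c: "1 + 1 / \<alpha> \<le> c" "2 + \<alpha> \<le> c"
  shows "(\<Sum>j\<in>B. p j * (apoint j \<alpha> + (\<Sum>k | k \<in> J \<and> R k j. p k) + p j)) \<le>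
    c * (s * sum p B + (sum p B)\<^sup>2 / 2 + (\<Sum>j\<in>B. (p j)\<^sup>2 / 2))"
proof -
  let ?e = "\<lambda>j. apoint j \<alpha>"
  have finB: "finite B" by (rule finite_sub[OF B])
  have period: "backlog \<sigma> p B t = sum p B - (t - s)" if "s \<le> t" "t \<le> s + sum p B" for t
    by (rule backlog_busy_period_during[of B s t]) (use B s busy that in auto)
  have idle: "processed \<sigma> k t = processed \<sigma> k s" if "k \<notin> B" "s \<le> t" "t \<le> s + sum p B" for k t
    by (rule processed_other_job[of B s k t]) (use B s busy that in auto)
  have pB: "0 < p k" if "k \<in> B" for k using p_pos B that by auto
  have nnB: "0 \<le> sum p B" by (intro sum_nonneg less_imp_le pB)
  have e: "s \<le> ?e j" "?e j \<le> s + sum p B" if j: "j \<in> B" for j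
  proof -
    have jJ: "j \<in> J" using B j by auto
    show "s \<le> ?e j"
    proof (rule ccontr)
      assume "\<not> ?thesis"
      then have "processed \<sigma> j (?e j) = 0" using s(2)[OF j] by (intro processed_unreleased jJ) auto
      then show False using processed_apoint[OF jJ _ \<alpha>(2)] \<alpha>(1) pB[OF j] by simp
    qed
    have "p j - processed \<sigma> j (s + sum p B) \<le> backlog \<sigma> p B (s + sum p B)"
      unfolding backlog_def using member_le_sum[of j B "\<lambda>k. p k - processed \<sigma> k (s + sum p B)"] j finB processed_le B by auto
    then have "p j \<le> processed \<sigma> j (s + sum p B)" using period[of "s + sum p B"] nnB by simp
    moreover have "\<alpha> * p j \<le> p j" using \<alpha> pB[OF j] by (simp add: mult_le_cancel_right1)
    ultimately show "?e j \<le> s + sum p B"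
      using s(1) nnB by (subst apoint_le_iff[OF jJ \<alpha>(2)]) auto
  qed
  have after: "?e j \<le> s + sum p B - (1 - \<alpha>) * (p j + (\<Sum>k | k \<in> B \<and> R j k. p k))" if j: "j \<in> B" for j
  proof -
    have "(1 - \<alpha>) * (p j + (\<Sum>k | k \<in> B \<and> R j k. p k)) = (\<Sum>k\<in>insert j {k. k \<in> B \<and> R j k}. (1 - \<alpha>) * p k)"
      using finB R(2) by (simp add: sum_distrib_left distrib_left)
    also have "\<dots> \<le> (\<Sum>k\<in>insert j {k. k \<in> B \<and> R j k}. p k - processed \<sigma> k (?e j))"
    proof (intro sum_mono)
      fix k assume k: "k \<in> insert j {k. k \<in> B \<and> R j k}"
      then have kJ: "k \<in> J" and "?e j \<le> ?e k" using R(3)[of k j] j B by auto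
      then have "processed \<sigma> k (?e j) \<le> \<alpha> * p k"
        using processed_mono[of "?e j" "?e k" k] processed_apoint[OF kJ _ \<alpha>(2)] \<alpha>(1) by simp
      then show "(1 - \<alpha>) * p k \<le> p k - processed \<sigma> k (?e j)" by (simp add: algebra_simps)
    qed
    also have "\<dots> \<le> backlog \<sigma> p B (?e j)"
      unfolding backlog_def using j finB processed_le B by (intro sum_mono2) auto
    also have "\<dots> = sum p B - (?e j - s)" using e[OF j] by (rule period)
    finally show ?thesis by linarith
  qed
  have before: "(\<Sum>k | k \<in> J \<and> R k j. p k) \<le> s / \<alpha> + (\<Sum>k | k \<in> B \<and> R k j. p k)" if j: "j \<in> B" for j
  proof -
    have jJ: "j \<in> J" using B j by auto
    have "{k. k \<in> J \<and> R k j} = {k. k \<in> J - B \<and> R k j} \<union> {k. k \<in> B \<and> R k j}" using B by auto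
    then have "(\<Sum>k | k \<in> J \<and> R k j. p k) = (\<Sum>k | k \<in> J - B \<and> R k j. p k) + (\<Sum>k | k \<in> B \<and> R k j. p k)"
      using finite_jobs finB by (simp add: sum.union_disjoint[symmetric] Int_def)
    moreover have "\<alpha> * (\<Sum>k | k \<in> J - B \<and> R k j. p k) \<le> s"
    proof -
      have "\<alpha> * (\<Sum>k | k \<in> J - B \<and> R k j. p k) \<le> (\<Sum>k | k \<in> J - B \<and> R k j. processed \<sigma> k s)"
        unfolding sum_distrib_left
      proof (intro sum_mono)
        fix k assume k: "k \<in> {k. k \<in> J - B \<and> R k j}"
        then have "\<alpha> * p k \<le> processed \<sigma> k (?e j)"
          using apoint_le_iff[of k \<alpha> "?e j"] R(3)[OF jJ, of k] \<alpha>(2) apoint_mem[OF jJ \<alpha>(2)] by auto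
        then show "\<alpha> * p k \<le> processed \<sigma> k s"
          using idle[of k "?e j"] e[OF j] k by auto
      qed
      also have "\<dots> \<le> s" using finite_jobs s(1) by (intro sum_processed_le) auto
      finally show ?thesis .
    qed
    ultimately show ?thesis using \<alpha>(1) by (simp add: field_simps)
  qed
  let ?N = "\<Sum>j\<in>B. p j * (\<Sum>k | k \<in> B \<and> R k j. p k)"
  have N1: "(\<Sum>j\<in>B. p j * (\<Sum>k | k \<in> B \<and> R j k. p k)) = ?N"
  proof -
    have "(\<Sum>j\<in>B. p j * (\<Sum>k | k \<in> B \<and> R j k. p k)) = (\<Sum>j\<in>B. \<Sum>k\<in>B. if R j k then p j * p k else 0)"
      using finB by (simp add: sum.If_cases Int_def sum_distrib_left)
    also have "\<dots> = (\<Sum>k\<in>B. \<Sum>j\<in>B. if R j k then p j * p k else 0)" by (rule sum.swap)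
    also have "\<dots> = ?N" using finB by (simp add: sum.If_cases Int_def sum_distrib_left mult.commute)
    finally show ?thesis .
  qed
  \<comment> \<open>Each pair of distinct jobs of \<open>B\<close> is ordered in exactly one way, so
    summing over predecessors and over successors together covers all ordered pairs.\<close>
  have N2: "?N + ?N = (sum p B)\<^sup>2 - (\<Sum>j\<in>B. (p j)\<^sup>2)"
  proof -
    have "p j * sum p (B - {j}) = p j * (\<Sum>k | k \<in> B \<and> R k j. p k) + p j * (\<Sum>k | k \<in> B \<and> R j k. p k)" if j: "j \<in> B" for j
    proof -
      have "B - {j} = {k. k \<in> B \<and> R k j} \<union> {k. k \<in> B \<and> R j k}" "{k. k \<in> B \<and> R k j} \<inter> {k. k \<in> B \<and> R j k} = {}"
        using R(1)[of j] R(2) j B by (fastforce, fastforce)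
      then have "sum p (B - {j}) = (\<Sum>k | k \<in> B \<and> R k j. p k) + (\<Sum>k | k \<in> B \<and> R j k. p k)"
        using finB by (simp add: sum.union_disjoint)
      then show ?thesis by (simp add: distrib_left)
    qed
    then have "(\<Sum>j\<in>B. \<Sum>k\<in>B - {j}. p j * p k) = ?N + ?N"
      by (simp add: sum_distrib_left[symmetric] sum.distrib N1)
    then show ?thesis using sum_square_split[OF finB, of p] by simp
  qed
  let ?S = "sum p B" and ?D = "\<Sum>j\<in>B. (p j)\<^sup>2"
  have "(\<Sum>j\<in>B. p j * (?e j + (\<Sum>k | k \<in> J \<and> R k j. p k) + p j)) \<le>
      (\<Sum>j\<in>B. p j * ((s + ?S - (1 - \<alpha>) * (p j + (\<Sum>k | k \<in> B \<and> R j k. p k))) + (s / \<alpha> + (\<Sum>k | k \<in> B \<and> R k j. p k)) + p j))"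
    by (intro sum_mono mult_left_mono add_mono after before order_refl less_imp_le[OF pB])
  also have "\<dots> = (\<Sum>j\<in>B. (s + ?S + s / \<alpha>) * p j + \<alpha> * (p j)\<^sup>2 - (1 - \<alpha>) * (p j * (\<Sum>k | k \<in> B \<and> R j k. p k)) +
      p j * (\<Sum>k | k \<in> B \<and> R k j. p k))"
    by (intro sum.cong refl) (simp add: algebra_simps power2_eq_square)
  also have "\<dots> = (s + ?S + s / \<alpha>) * ?S + \<alpha> * ?D - (1 - \<alpha>) * ?N + ?N"
    by (simp add: sum.distrib sum_subtractf sum_distrib_left[symmetric] N1)
  \<comment> \<open>Eliminating \<open>?N\<close> separates the two constraints on \<open>c\<close>:
    work before the busy period costs \<open>1 + 1 / \<alpha>\<close>, work within it
    \<open>2 + \<alpha>\<close>.\<close>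
  also have "\<dots> = (1 + 1 / \<alpha>) * (s * ?S) + (2 + \<alpha>) * (?S\<^sup>2 / 2) + \<alpha> * (?D / 2)"
  proof -
    have "?N = (?S\<^sup>2 - ?D) / 2" using N2 by simp
    then show ?thesis by (simp only:) (simp add: field_simps power2_eq_square)
  qed
  also have "\<dots> \<le> c * (s * ?S) + c * (?S\<^sup>2 / 2) + c * (?D / 2)"
  proof -
    have "0 \<le> ?D" by (intro sum_nonneg) auto
    then show ?thesis using c s(1) nnB by (intro add_mono mult_right_mono mult_nonneg_nonneg) auto
  qed
  finally show ?thesis by (simp add: distrib_left sum_divide_distrib)
qed

end

context sos_machine
begin

lemma fifo_virtual_cost_bound:
  assumes J: "J \<subseteq> {..<njobs I}" and \<alpha>: "0 < \<alpha>" "\<alpha> \<le> 1"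
    and R: "\<And>j k. j \<in> J \<Longrightarrow> k \<in> J \<Longrightarrow> j \<noteq> k \<Longrightarrow> R k j \<longleftrightarrow> \<not> R j k" "\<And>j. \<not> R j j"
      "\<And>j k. j \<in> J \<Longrightarrow> k \<in> J \<Longrightarrow> R k j \<Longrightarrow> alpha_point I i (vs J) k \<alpha> \<le> alpha_point I i (vs J) j \<alpha>"
    and c: "1 + 1 / \<alpha> \<le> c" "2 + \<alpha> \<le> c"
  shows "(\<Sum>j\<in>J. wt I j * (alpha_point I i (vs J) j \<alpha> + (\<Sum>k | k \<in> J \<and> R k j. pbar I i k) + pbar I i j)) \<le>
    c * virtual_cost I tie i J"
proof -
  let ?p = "pbar I i"
  interpret G: greedy_schedule J ?p "rel I" "vs J" using J J by (rule vs_greedy)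
  let ?X = "\<lambda>j. alpha_point I i (vs J) j \<alpha> + (\<Sum>k | k \<in> J \<and> R k j. ?p k) + ?p j"
  let ?Y = "\<lambda>j. mean_busy_time I i (vs J) j + ?p j / 2"
  have "(\<Sum>j\<in>J. ratio j * (?p j * ?X j)) \<le> (\<Sum>j\<in>J. ratio j * (c * (?p j * ?Y j)))"
  proof (rule sum_le_by_busy_periods[OF J])
    fix B s
    assume period: "B \<subseteq> J" "0 \<le> s" "\<And>k. k \<in> B \<Longrightarrow> s \<le> rel I k"
      "\<And>u. s < u \<Longrightarrow> u < s + sum ?p B \<Longrightarrow> vs J u \<in> Some ` B"
    have "(\<Sum>j\<in>B. ?p j * ?X j) \<le> c * (s * sum ?p B + (sum ?p B)\<^sup>2 / 2 + (\<Sum>j\<in>B. (?p j)\<^sup>2 / 2))"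
      unfolding alpha_point_def
      by (rule G.busy_period_fifo_bound[OF \<alpha> R(1,2) R(3)[unfolded alpha_point_def] period c])
    also have "s * sum ?p B + (sum ?p B)\<^sup>2 / 2 + (\<Sum>j\<in>B. (?p j)\<^sup>2 / 2) = (\<Sum>j\<in>B. ?p j * ?Y j)"
      by (rule busy_period_mean_busy_times[OF J period(1,2), symmetric]) (use period in auto)
    finally show "(\<Sum>j\<in>B. ?p j * ?X j) \<le> (\<Sum>j\<in>B. c * (?p j * ?Y j))" by (simp add: sum_distrib_left)
  qed
  moreover have "ratio j * (?p j * x) = wt I j * x" "ratio j * (c * (?p j * x)) = c * (wt I j * x)" if "j \<in> J" for j x
    using G.p_pos[OF that] by auto
  ultimately show ?thesis by (simp add: virtual_cost_def sum_distrib_left mult.left_commute[of c])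
qed

end

section \<open>Cost of the two policies\<close>

context sos_greedy
begin

abbreviation "final_schedule i \<equiv> virtual_schedule I tie i (jobs_on a i)"

definition queue :: "(nat \<Rightarrow> real) \<Rightarrow> nat \<Rightarrow> nat list" where
  "queue \<alpha> i = sort_key (queue_time I tie a \<alpha>) (filter (\<lambda>k. a k = i) [0..<n])"

lemma set_queue: "set (queue \<alpha> i) = jobs_on a i"
  and distinct_queue: "distinct (queue \<alpha> i)"
  and sorted_queue: "sorted (map (queue_time I tie a \<alpha>) (queue \<alpha> i))"
  by (auto simp: queue_def)

lemma queued_before_queue_subset: "queued_before (queue \<alpha> i) j \<subseteq> jobs_on a i - {j}"
  using queued_before_subset[of "queue \<alpha> i" j] by (simp add: set_queue)

lemma final_greedy_schedule: "i < m \<Longrightarrow> greedy_schedule (jobs_on a i) (pbar I i) (rel I) (final_schedule i)"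
  by (intro sos_machine.vs_greedy[OF machine]) auto

text \<open>For fixed \<open>\<alpha>\<close>, assignment and queue order depend on the virtual
  schedules only. The set of predecessors is therefore deterministic, and realized lengths are
  replaced by their means through linearity.\<close>

lemma exp_cost_ga_le:
  assumes e: "\<And>j. j < n \<Longrightarrow> 0 \<le> queue_time I tie a \<alpha> j"
  shows "exp_cost I (ga_policy I tie a \<alpha>) \<le> ennreal (\<Sum>j<n. wt I j *
    (queue_time I tie a \<alpha> j + sum (pbar I (a j)) (queued_before (queue \<alpha> (a j)) j) + pbar I (a j) j))"
proof -
  let ?e = "queue_time I tie a \<alpha>" and ?Q = "\<lambda>j. queued_before (queue \<alpha> (a j)) j"
  let ?f = "\<lambda>\<omega>. \<Sum>j<n. wt I j * (?e j + (\<Sum>k\<in>?Q j. ptime I (a j) k \<omega>) + ptime I (a j) j \<omega>)"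
  have Q: "k < n" if "k \<in> ?Q j" for k j using that queued_before_queue_subset by fastforce
  have "completion (realized I \<omega>) (ga_policy I tie a \<alpha> (realized I \<omega>)) j \<le>
      ?e j + (\<Sum>k\<in>?Q j. ptime I (a j) k \<omega>) + ptime I (a j) j \<omega>" if \<omega>: "\<omega> \<in> space (prb I)" and j: "j < n" for \<omega> j
  proof -
    let ?d = "\<lambda>k. realized I \<omega> (a j, k)"
    have d: "?d k = ptime I (a j) k \<omega>" if "k < n" for k using a_less[OF j] that by (simp add: realized_def)
    have "fifo_start ?e ?d 0 (queue \<alpha> (a j)) j \<le> max 0 (?e j) + sum ?d (?Q j)"
      using j d ptime_ge_0[OF a_less[OF j] _ \<omega>]
      by (intro fifo_start_le sorted_queue distinct_queue) (auto simp: set_queue)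
    moreover have "sum ?d (?Q j) = (\<Sum>k\<in>?Q j. ptime I (a j) k \<omega>)" using Q d by (intro sum.cong) auto
    ultimately show ?thesis using e[OF j] d[OF j] by (simp add: completion_def ga_policy_def queue_def)
  qed
  then have "exp_cost I (ga_policy I tie a \<alpha>) \<le> (\<integral>\<^sup>+\<omega>. ennreal (?f \<omega>) \<partial>prb I)"
    unfolding exp_cost_def using wt_ge_0 by (intro nn_integral_mono ennreal_leI sum_mono mult_left_mono) auto
  also have "\<dots> = ennreal (\<integral>\<omega>. ?f \<omega> \<partial>prb I)"
  proof (rule nn_integral_eq_integral)
    show "integrable (prb I) ?f"
      using integrable_ptime a_less Q
      by (intro Bochner_Integration.integrable_sum integrable_mult_right Bochner_Integration.integrable_add) auto
    show "AE \<omega> in prb I. 0 \<le> ?f \<omega>"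
      using wt_ge_0 e ptime_ge_0 a_less Q
      by (intro AE_I2 sum_nonneg mult_nonneg_nonneg add_nonneg_nonneg) auto
  qed
  also have "(\<integral>\<omega>. ?f \<omega> \<partial>prb I) = (\<Sum>j<n. wt I j * (?e j + sum (pbar I (a j)) (?Q j) + pbar I (a j) j))"
  proof -
    have ip: "integrable (prb I) (ptime I (a j) k)" if "j < n" "k < n" for j k
      using integrable_ptime a_less that by auto
    have is': "integrable (prb I) (\<lambda>\<omega>. \<Sum>k\<in>?Q j. ptime I (a j) k \<omega>)" if "j < n" for j
      using ip[OF that] Q by (intro Bochner_Integration.integrable_sum) auto
    have "(\<integral>\<omega>. ?f \<omega> \<partial>prb I) = (\<Sum>j<n. \<integral>\<omega>. wt I j * (?e j + (\<Sum>k\<in>?Q j. ptime I (a j) k \<omega>) + ptime I (a j) j \<omega>) \<partial>prb I)"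
      using ip is' by (intro Bochner_Integration.integral_sum integrable_mult_right Bochner_Integration.integrable_add) auto
    also have "\<dots> = (\<Sum>j<n. wt I j * (?e j + sum (pbar I (a j)) (?Q j) + pbar I (a j) j))"
    proof (intro sum.cong refl)
      fix j assume j: "j \<in> {..<n}"
      then have "(\<integral>\<omega>. ?e j + (\<Sum>k\<in>?Q j. ptime I (a j) k \<omega>) + ptime I (a j) j \<omega> \<partial>prb I) =
          (\<integral>\<omega>. ?e j \<partial>prb I) + (\<integral>\<omega>. (\<Sum>k\<in>?Q j. ptime I (a j) k \<omega>) \<partial>prb I) + (\<integral>\<omega>. ptime I (a j) j \<omega> \<partial>prb I)"
        using ip is' by (simp add: Bochner_Integration.integral_add)
      also have "(\<integral>\<omega>. (\<Sum>k\<in>?Q j. ptime I (a j) k \<omega>) \<partial>prb I) = sum (pbar I (a j)) (?Q j)"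
        unfolding pbar_def using ip[of j] Q j by (intro Bochner_Integration.integral_sum) auto
      finally show "(\<integral>\<omega>. wt I j * (?e j + (\<Sum>k\<in>?Q j. ptime I (a j) k \<omega>) + ptime I (a j) j \<omega>) \<partial>prb I) =
          wt I j * (?e j + sum (pbar I (a j)) (?Q j) + pbar I (a j) j)"
        by (simp add: prob_space pbar_def)
    qed
    finally show ?thesis .
  qed
  finally show ?thesis .
qed

lemma cost_GA_DSOS_le: "cost_GA_DSOS I tie a \<le> ennreal ((3 + sqrt 5) / 2 * total_virtual_cost)"
proof -
  define \<phi> :: real where "\<phi> = golden_ratio - 1"
  define c :: real where "c = (3 + sqrt 5) / 2"
  have s5: "2 \<le> sqrt 5" "sqrt 5 \<le> 3" by (auto intro: real_le_rsqrt real_le_lsqrt)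
  have \<phi>: "0 < \<phi>" "\<phi> \<le> 1" using s5 by (auto simp: \<phi>_def golden_ratio_def)
  have c2: "2 + \<phi> \<le> c" by (simp add: c_def \<phi>_def golden_ratio_def field_simps)
  \<comment> \<open>The defining equation of the golden ratio: at this value
    \<open>1 + 1 / \<phi>\<close> and \<open>2 + \<phi>\<close> coincide, and both equal
    \<open>c\<close>.\<close>
  have "\<phi> * (1 + \<phi>) = 1" by (simp add: \<phi>_def golden_ratio_def field_simps)
  then have "1 / \<phi> = 1 + \<phi>" using \<phi> by (simp add: field_simps)
  then have c1: "1 + 1 / \<phi> \<le> c" using c2 by simp
  let ?\<alpha> = "\<lambda>j::nat. \<phi>"
  let ?e = "queue_time I tie a ?\<alpha>" and ?Q = "\<lambda>i j. queued_before (queue ?\<alpha> i) j"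
  have e: "?e j = alpha_point I (a j) (final_schedule (a j)) j \<phi>" for j by (simp add: queue_time_def)
  have "0 \<le> ?e j" if j: "j < n" for j
    using greedy_schedule.apoint_mem[OF final_greedy_schedule[OF a_less[OF j]], of j \<phi>] \<phi> j
    unfolding e alpha_point_def by auto
  then have "cost_GA_DSOS I tie a \<le> ennreal (\<Sum>j<n. wt I j * (?e j + sum (pbar I (a j)) (?Q (a j) j) + pbar I (a j) j))"
    unfolding cost_GA_DSOS_def \<phi>_def[symmetric] by (rule exp_cost_ga_le)
  also have "(\<Sum>j<n. wt I j * (?e j + sum (pbar I (a j)) (?Q (a j) j) + pbar I (a j) j)) =
      (\<Sum>i<m. \<Sum>j\<in>jobs_on a i. wt I j * (alpha_point I i (final_schedule i) j \<phi> + sum (pbar I i) (?Q i j) + pbar I i j))"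
    unfolding e
    using sum_by_machine[where b=a and f="\<lambda>i j. wt I j * (alpha_point I i (final_schedule i) j \<phi> + sum (pbar I i) (?Q i j) + pbar I i j)", OF a_less]
    by simp
  also have "\<dots> \<le> (\<Sum>i<m. c * virtual_cost I tie i (jobs_on a i))"
  proof (intro sum_mono)
    fix i assume "i \<in> {..<m}"
    then interpret M: sos_machine I tie i using machine by auto
    have "(\<Sum>j\<in>jobs_on a i. wt I j * (alpha_point I i (final_schedule i) j \<phi> + (\<Sum>k | k \<in> jobs_on a i \<and> k \<in> ?Q i j. pbar I i k) + pbar I i j)) \<le>
        c * virtual_cost I tie i (jobs_on a i)"
    proof (rule M.fifo_virtual_cost_bound[OF _ \<phi> _ _ _ c1 c2])
      show "k \<in> ?Q i j \<longleftrightarrow> j \<notin> ?Q i k" if "j \<in> jobs_on a i" "k \<in> jobs_on a i" "j \<noteq> k" for j k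
        using that by (intro queued_before_total) (auto simp: set_queue)
      show "j \<notin> ?Q i j" for j using queued_before_queue_subset by blast
      show "alpha_point I i (final_schedule i) k \<phi> \<le> alpha_point I i (final_schedule i) j \<phi>"
        if "j \<in> jobs_on a i" "k \<in> jobs_on a i" "k \<in> ?Q i j" for j k
        using queued_before_sorted[OF sorted_queue _ that(3)] that by (auto simp: set_queue e)
    qed auto
    moreover have "{k. k \<in> jobs_on a i \<and> k \<in> ?Q i j} = ?Q i j" for j using queued_before_queue_subset by blast
    ultimately show "(\<Sum>j\<in>jobs_on a i. wt I j * (alpha_point I i (final_schedule i) j \<phi> + sum (pbar I i) (?Q i j) + pbar I i j)) \<le>
        c * virtual_cost I tie i (jobs_on a i)" by simp
  qed
  also have "\<dots> = c * total_virtual_cost" by (simp add: total_virtual_cost_def sum_distrib_left)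
  finally show ?thesis by (simp add: c_def ennreal_leI)
qed

end

section \<open>Uniformly random points of the virtual schedule\<close>

abbreviation "unit_uniform \<equiv> uniform_measure lborel {0<..1::real}"

lemma prob_space_unit_uniform: "prob_space unit_uniform"
  by (intro prob_space_uniform_measure) auto

lemma nn_integral_unit_uniform:
  "f \<in> borel_measurable borel \<Longrightarrow> (\<integral>\<^sup>+x. f x \<partial>unit_uniform) = (\<integral>\<^sup>+x. f x * indicator {0<..1} x \<partial>lborel)"
  by (subst nn_integral_uniform_measure) (auto simp: divide_ennreal_def)

context greedy_schedule
begin

text \<open>Truncated at \<open>1\<close>, since the \<open>\<alpha>\<close>-point is an infimum over the empty set for \<open>\<alpha> > 1\<close>.\<close>

definition tpoint :: "nat \<Rightarrow> real \<Rightarrow> real" where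
  "tpoint k \<beta> = apoint k (min \<beta> 1)"

lemma tpoint_nonneg: "k \<in> J \<Longrightarrow> 0 \<le> tpoint k \<beta>"
  using apoint_mem[of k "min \<beta> 1"] by (simp add: tpoint_def)

lemma tpoint_le_iff: "k \<in> J \<Longrightarrow> 0 \<le> t \<Longrightarrow> tpoint k \<beta> \<le> t \<longleftrightarrow> min \<beta> 1 * p k \<le> processed \<sigma> k t"
  unfolding tpoint_def by (intro apoint_le_iff) auto

lemma measurable_tpoint: "k \<in> J \<Longrightarrow> tpoint k \<in> borel_measurable borel"
proof (intro borel_measurable_mono monoI)
  fix \<beta> \<beta>' :: real assume k: "k \<in> J" and "\<beta> \<le> \<beta>'"
  then have "min \<beta> 1 * p k \<le> min \<beta>' 1 * p k" using p_pos[OF k] by (intro mult_right_mono) auto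
  also have "\<dots> \<le> processed \<sigma> k (tpoint k \<beta>')" using tpoint_le_iff[OF k tpoint_nonneg[OF k], of \<beta>' \<beta>'] by simp
  finally show "tpoint k \<beta> \<le> tpoint k \<beta>'" using tpoint_le_iff[OF k tpoint_nonneg[OF k]] by blast
qed

text \<open>The point is reached by \<open>t\<close> exactly if the uniform fraction is at most the
  fraction processed by \<open>t\<close>.\<close>

lemma nn_integral_tpoint_le:
  assumes k: "k \<in> J" and t: "0 \<le> t"
  shows "(\<integral>\<^sup>+\<beta>. (if tpoint k \<beta> \<le> t then 1 else 0) \<partial>unit_uniform) = ennreal (processed \<sigma> k t / p k)"
proof -
  have q: "0 \<le> processed \<sigma> k t / p k" "processed \<sigma> k t / p k \<le> 1"
    using processed_nonneg processed_le[OF k] p_pos[OF k] by auto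
  have "(\<integral>\<^sup>+\<beta>. (if tpoint k \<beta> \<le> t then 1 else 0) \<partial>unit_uniform) =
      (\<integral>\<^sup>+\<beta>. (if tpoint k \<beta> \<le> t then 1 else 0) * indicator {0<..1} \<beta> \<partial>lborel)"
    using measurable_tpoint[OF k] by (intro nn_integral_unit_uniform) measurable
  also have "\<dots> = (\<integral>\<^sup>+\<beta>. indicator {0<..processed \<sigma> k t / p k} \<beta> \<partial>lborel)"
  proof (intro nn_integral_cong)
    fix \<beta> :: real
    have "\<beta> * p k \<le> processed \<sigma> k t \<longleftrightarrow> \<beta> \<le> processed \<sigma> k t / p k" using p_pos[OF k] by (simp add: field_simps)
    then show "(if tpoint k \<beta> \<le> t then 1 else 0) * indicator {0<..1} \<beta> = (indicator {0<..processed \<sigma> k t / p k} \<beta> :: ennreal)"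
      using tpoint_le_iff[OF k t, of \<beta>] q(2) by (auto simp: indicator_def min_def split: if_splits)
  qed
  finally show ?thesis using q by simp
qed

text \<open>The expectation is the integral of the tail probabilities, which are the unprocessed
  fractions. The same integral is the mean busy time of \<open>k\<close>.\<close>

lemma nn_integral_tpoint:
  assumes k: "k \<in> J" and H: "0 \<le> H" "processed \<sigma> k H = p k"
  shows "(\<integral>\<^sup>+\<beta>. ennreal (tpoint k \<beta>) \<partial>unit_uniform) = ennreal (integral {0..H} (\<lambda>t. p k - processed \<sigma> k t) / p k)"
proof -
  note [measurable] = measurable_tpoint[OF k]
  let ?f = "\<lambda>s \<beta>. (if 0 \<le> s \<and> s < tpoint k \<beta> then 1 else 0) * indicator {0<..1} \<beta> :: ennreal"
  have "(\<integral>\<^sup>+\<beta>. ennreal (tpoint k \<beta>) \<partial>unit_uniform) = (\<integral>\<^sup>+\<beta>. ennreal (tpoint k \<beta>) * indicator {0<..1} \<beta> \<partial>lborel)"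
    by (intro nn_integral_unit_uniform) measurable
  also have "\<dots> = (\<integral>\<^sup>+\<beta>. (\<integral>\<^sup>+s. ?f s \<beta> \<partial>lborel) \<partial>lborel)"
  proof (intro nn_integral_cong)
    fix \<beta> :: real
    have "(\<integral>\<^sup>+s. ?f s \<beta> \<partial>lborel) = (\<integral>\<^sup>+s. indicator {0<..1} \<beta> * indicator {0..<tpoint k \<beta>} s \<partial>lborel)"
      by (intro nn_integral_cong) (auto simp: indicator_def)
    then show "ennreal (tpoint k \<beta>) * indicator {0<..1} \<beta> = (\<integral>\<^sup>+s. ?f s \<beta> \<partial>lborel)"
      using tpoint_nonneg[OF k, of \<beta>] by (simp add: nn_integral_cmult mult.commute)
  qed
  also have "\<dots> = (\<integral>\<^sup>+s. (\<integral>\<^sup>+\<beta>. ?f s \<beta> \<partial>lborel) \<partial>lborel)"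
    by (intro lborel_pair.Fubini') measurable
  also have "\<dots> = (\<integral>\<^sup>+s. ennreal ((p k - processed \<sigma> k s) / p k) * indicator {0..H} s \<partial>lborel)"
  proof (intro nn_integral_cong)
    fix s :: real
    show "(\<integral>\<^sup>+\<beta>. ?f s \<beta> \<partial>lborel) = ennreal ((p k - processed \<sigma> k s) / p k) * indicator {0..H} s"
    proof (cases "0 \<le> s")
      case True
      have q: "0 \<le> processed \<sigma> k s / p k" "processed \<sigma> k s / p k \<le> 1"
        using processed_nonneg processed_le[OF k] p_pos[OF k] by auto
      have "(\<integral>\<^sup>+\<beta>. ?f s \<beta> \<partial>lborel) = (\<integral>\<^sup>+\<beta>. indicator {processed \<sigma> k s / p k<..1} \<beta> \<partial>lborel)"
      proof (intro nn_integral_cong)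
        fix \<beta> :: real
        have "\<beta> * p k \<le> processed \<sigma> k s \<longleftrightarrow> \<beta> \<le> processed \<sigma> k s / p k" using p_pos[OF k] by (simp add: field_simps)
        then show "?f s \<beta> = indicator {processed \<sigma> k s / p k<..1} \<beta>"
          using tpoint_le_iff[OF k True, of \<beta>] q True
          by (auto simp: indicator_def min_def not_less[symmetric] split: if_splits)
      qed
      also have "\<dots> = ennreal ((p k - processed \<sigma> k s) / p k)"
        using q p_pos[OF k] by (simp add: diff_divide_distrib)
      also have "\<dots> = ennreal ((p k - processed \<sigma> k s) / p k) * indicator {0..H} s"
      proof (cases "s \<le> H")
        case False
        then have "processed \<sigma> k s = p k" using processed_mono[of H s k] processed_le[OF k, of s] H(2) by simp
        then show ?thesis by simp
      qed (use True in simp)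
      finally show ?thesis .
    qed simp
  qed
  also have "\<dots> = ennreal (integral {0..H} (\<lambda>s. (p k - processed \<sigma> k s) / p k))"
    using processed_le[OF k] p_pos[OF k]
    by (intro nn_integral_Icc_eq_integral continuous_intros continuous_on_processed) auto
  finally show ?thesis by simp
qed

end

context sos_greedy
begin

definition tp :: "nat \<Rightarrow> real \<Rightarrow> real" where
  "tp j \<beta> = alpha_point I (a j) (final_schedule (a j)) j (min \<beta> 1)"

text \<open>The non-strict comparison counts tied jobs as predecessors of each other, which is
  harmless in an upper bound.\<close>

abbreviation "overtakes k j \<alpha> \<equiv> (if tp k (\<alpha> k) \<le> tp j (\<alpha> j) then 1 else 0)"

abbreviation "mbt j \<equiv> mean_busy_time I (a j) (final_schedule (a j)) j"

lemma tp_eq: "a k = i \<Longrightarrow> i < m \<Longrightarrow> tp k = greedy_schedule.tpoint (pbar I i) (final_schedule i) k"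
  by (simp add: tp_def[abs_def] greedy_schedule.tpoint_def[OF final_greedy_schedule] alpha_point_def fun_eq_iff)

lemma measurable_tp: "j < n \<Longrightarrow> tp j \<in> borel_measurable borel"
  using greedy_schedule.measurable_tpoint[OF final_greedy_schedule] a_less by (simp add: tp_eq[OF refl])

lemma tp_nonneg: "j < n \<Longrightarrow> 0 \<le> tp j \<beta>"
  using greedy_schedule.tpoint_nonneg[OF final_greedy_schedule] a_less by (simp add: tp_eq[OF refl])

lemma mbt_nonneg: "j < n \<Longrightarrow> 0 \<le> mbt j"
proof -
  assume j: "j < n"
  have "0 \<le> (LBINT t:{0..}. busy (final_schedule (a j)) j t * t)"
    unfolding set_lebesgue_integral_def
    by (intro Bochner_Integration.integral_nonneg) (auto simp: busy_def indicator_def)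
  then show ?thesis using pbar_gt_0[OF a_less[OF j] j] by (simp add: mean_busy_time_def)
qed

lemma nn_integral_tp:
  assumes j: "j < n"
  shows "(\<integral>\<^sup>+\<beta>. ennreal (tp j \<beta>) \<partial>unit_uniform) = ennreal (mbt j)"
proof -
  interpret G: greedy_schedule "jobs_on a (a j)" "pbar I (a j)" "rel I" "final_schedule (a j)"
    by (rule final_greedy_schedule[OF a_less[OF j]])
  have jJ: "j \<in> jobs_on a (a j)" using j by simp
  obtain H where "0 \<le> H" "processed (final_schedule (a j)) j H = pbar I (a j) j"
    using G.completed_eventually jJ by blast
  then show ?thesis
    using G.nn_integral_tpoint[OF jJ] G.integral_busy_time[OF jJ]
    by (simp add: tp_eq[OF refl a_less[OF j]] mean_busy_time_def)
qed

interpretation U: prob_space unit_uniform by (rule prob_space_unit_uniform)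

interpretation PU: product_sigma_finite "\<lambda>_::nat. unit_uniform"
  by unfold_locales

lemma nn_integral_alpha_component:
  assumes "S \<subseteq> {..<n}" "j \<in> S" and f: "f \<in> borel_measurable borel"
  shows "(\<integral>\<^sup>+\<alpha>. f (\<alpha> j) \<partial>(Pi\<^sub>M S (\<lambda>_. unit_uniform))) = (\<integral>\<^sup>+\<beta>. f \<beta> \<partial>unit_uniform)"
proof -
  have "(\<integral>\<^sup>+\<beta>. f \<beta> \<partial>unit_uniform) = (\<integral>\<^sup>+\<beta>. f \<beta> \<partial>(distr (Pi\<^sub>M S (\<lambda>_. unit_uniform)) unit_uniform (\<lambda>\<omega>. \<omega> j)))"
    using assms by (subst distr_PiM_component) (auto intro: prob_space_unit_uniform)
  also have "\<dots> = (\<integral>\<^sup>+\<alpha>. f (\<alpha> j) \<partial>(Pi\<^sub>M S (\<lambda>_. unit_uniform)))"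
    using assms by (intro nn_integral_distr measurable_component_singleton) auto
  finally show ?thesis by simp
qed

lemma measurable_tp_component: "j < n \<Longrightarrow> (\<lambda>\<alpha>. tp j (\<alpha> j)) \<in> borel_measurable (alpha_distribution I)"
  unfolding alpha_distribution_def
  by (rule measurable_compose[OF measurable_component_singleton]) (use measurable_tp in auto)

text \<open>The fraction of \<open>k\<close> is integrated first: as \<open>k\<close> differs from
  \<open>j\<close>, the point of \<open>j\<close> is then fixed, and the probability that
  \<open>k\<close> comes no later is the fraction of \<open>k\<close> processed by that
  point.\<close>

lemma nn_integral_overtakes:
  assumes j: "j < n" and k: "k < n" "k \<noteq> j" "a k = a j"
  shows "(\<integral>\<^sup>+\<alpha>. overtakes k j \<alpha> \<partial>alpha_distribution I) =
    (\<integral>\<^sup>+\<beta>. ennreal (processed (final_schedule (a j)) k (tp j \<beta>) / pbar I (a j) k) \<partial>unit_uniform)"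
proof -
  interpret G: greedy_schedule "jobs_on a (a j)" "pbar I (a j)" "rel I" "final_schedule (a j)"
    by (rule final_greedy_schedule[OF a_less[OF j]])
  have kJ: "k \<in> jobs_on a (a j)" using k by simp
  let ?f = "\<lambda>\<alpha>. overtakes k j \<alpha> :: ennreal"
  have n: "insert k ({..<n} - {k}) = {..<n}" using k by auto
  have "?f \<in> borel_measurable (alpha_distribution I)"
    using measurable_tp_component[OF j] measurable_tp_component[OF k(1)] by measurable
  then have "(\<integral>\<^sup>+\<alpha>. ?f \<alpha> \<partial>alpha_distribution I) =
      (\<integral>\<^sup>+\<alpha>. (\<integral>\<^sup>+\<beta>. ?f (\<alpha>(k := \<beta>)) \<partial>unit_uniform) \<partial>(Pi\<^sub>M ({..<n} - {k}) (\<lambda>_. unit_uniform)))"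
    unfolding alpha_distribution_def
    using PU.product_nn_integral_insert[of "{..<n} - {k}" k ?f, unfolded n] by simp
  also have "\<dots> = (\<integral>\<^sup>+\<alpha>. ennreal (processed (final_schedule (a j)) k (tp j (\<alpha> j)) / pbar I (a j) k) \<partial>(Pi\<^sub>M ({..<n} - {k}) (\<lambda>_. unit_uniform)))"
    using G.nn_integral_tpoint_le[OF kJ tp_nonneg[OF j]] k tp_eq[OF k(3) a_less[OF j]]
    by (intro nn_integral_cong) simp
  also have "\<dots> = (\<integral>\<^sup>+\<beta>. ennreal (processed (final_schedule (a j)) k (tp j \<beta>) / pbar I (a j) k) \<partial>unit_uniform)"
  proof (rule nn_integral_alpha_component)
    have "processed (final_schedule (a j)) k \<in> borel_measurable borel"
      by (intro borel_measurable_continuous_onI G.continuous_on_processed)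
    then show "(\<lambda>\<beta>. ennreal (processed (final_schedule (a j)) k (tp j \<beta>) / pbar I (a j) k)) \<in> borel_measurable borel"
      using measurable_tp[OF j] by measurable
  qed (use j k in auto)
  finally show ?thesis .
qed

lemma cost_GA_RSOS_le: "cost_GA_RSOS I tie a \<le> ennreal (2 * total_virtual_cost)"
proof -
  let ?A = "alpha_distribution I"
  define K where "K j = jobs_on a (a j) - {j}" for j
  define F where "F j \<alpha> = ennreal (wt I j) * (ennreal (tp j (\<alpha> j)) +
      (\<Sum>k\<in>K j. ennreal (pbar I (a j) k) * overtakes k j \<alpha>) + ennreal (pbar I (a j) j))" for j \<alpha>
  have Kn: "k < n" "k \<noteq> j" "a k = a j" if "k \<in> K j" for k j using that by (auto simp: K_def)
  have pos: "0 < pbar I (a j) k" if "j < n" "k < n" for j k using pbar_gt_0 a_less that by auto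
  have overtakes_measurable: "(\<lambda>\<alpha>. c * overtakes k j \<alpha>) \<in> borel_measurable ?A"
    if "j < n" "k < n" for j k and c :: ennreal
    using measurable_tp_component[OF that(1)] measurable_tp_component[OF that(2)] by measurable
  \<comment> \<open>On this set of full measure the truncated points agree with the actual queue
    times.\<close>
  have "AE \<alpha> in ?A. \<forall>j\<in>{..<n}. \<alpha> j \<in> {0<..1}"
    unfolding alpha_distribution_def
    by (intro AE_finite_allI AE_PiM_component prob_space_unit_uniform AE_uniform_measureI) auto
  then have "AE \<alpha> in ?A. exp_cost I (ga_policy I tie a \<alpha>) \<le> (\<Sum>j<n. F j \<alpha>)"
  proof eventually_elim
    case (elim \<alpha>)
    have q: "queue_time I tie a \<alpha> j = tp j (\<alpha> j)" if "j < n" for j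
      using elim that by (auto simp: queue_time_def tp_def min_def)
    have "exp_cost I (ga_policy I tie a \<alpha>) \<le> ennreal (\<Sum>j<n. wt I j *
        (queue_time I tie a \<alpha> j + sum (pbar I (a j)) (queued_before (queue \<alpha> (a j)) j) + pbar I (a j) j))"
      using q tp_nonneg by (intro exp_cost_ga_le) auto
    also have "\<dots> \<le> ennreal (\<Sum>j<n. wt I j * (tp j (\<alpha> j) +
        (\<Sum>k\<in>K j. pbar I (a j) k * overtakes k j \<alpha>) + pbar I (a j) j))"
    proof (intro ennreal_leI sum_mono mult_left_mono add_mono order_refl)
      fix j assume "j \<in> {..<n}"
      then have j: "j < n" by simp
      show "queue_time I tie a \<alpha> j \<le> tp j (\<alpha> j)" using q[OF j] by simp
      show "0 \<le> wt I j" by (rule wt_ge_0[OF j])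
      let ?Q = "queued_before (queue \<alpha> (a j)) j"
      have Q: "?Q \<subseteq> K j" using queued_before_queue_subset by (simp add: K_def)
      have "tp k (\<alpha> k) \<le> tp j (\<alpha> j)" if "k \<in> ?Q" for k
        using queued_before_sorted[OF sorted_queue _ that] Kn(1)[of k j] Q that q j by (auto simp: set_queue)
      then have "sum (pbar I (a j)) ?Q = (\<Sum>k\<in>?Q. pbar I (a j) k * overtakes k j \<alpha>)"
        by (intro sum.cong) auto
      also have "\<dots> \<le> (\<Sum>k\<in>K j. pbar I (a j) k * overtakes k j \<alpha>)"
      proof (rule sum_mono2[OF _ Q])
        show "finite (K j)" by (simp add: K_def)
        show "0 \<le> pbar I (a j) k * overtakes k j \<alpha>" if "k \<in> K j - ?Q" for k
          using less_imp_le[OF pos[OF j Kn(1)[of k j]]] that by simp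
      qed
      finally show "sum (pbar I (a j)) ?Q \<le> (\<Sum>k\<in>K j. pbar I (a j) k * overtakes k j \<alpha>)" .
    qed
    also have "\<dots> = (\<Sum>j<n. ennreal (wt I j * (tp j (\<alpha> j) +
        (\<Sum>k\<in>K j. pbar I (a j) k * overtakes k j \<alpha>) + pbar I (a j) j)))"
    proof (intro sum_ennreal[symmetric] mult_nonneg_nonneg add_nonneg_nonneg sum_nonneg)
      fix j assume "j \<in> {..<n}"
      then have j: "j < n" by simp
      show "0 \<le> wt I j" "0 \<le> tp j (\<alpha> j)" "0 \<le> pbar I (a j) j"
        using wt_ge_0[OF j] tp_nonneg[OF j] less_imp_le[OF pos[OF j j]] by auto
      show "0 \<le> pbar I (a j) k" if "k \<in> K j" for k using less_imp_le[OF pos[OF j Kn(1)[OF that]]] .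
    qed simp
    also have "\<dots> = (\<Sum>j<n. F j \<alpha>)"
    proof (intro sum.cong refl)
      fix j assume "j \<in> {..<n}"
      then have j: "j < n" by simp
      have nn: "0 \<le> pbar I (a j) k * overtakes k j \<alpha>" if "k \<in> K j" for k
        using less_imp_le[OF pos[OF j Kn(1)[OF that]]] by simp
      have "(\<Sum>k\<in>K j. ennreal (pbar I (a j) k) * overtakes k j \<alpha>) =
          (\<Sum>k\<in>K j. ennreal (pbar I (a j) k * overtakes k j \<alpha>))"
        by (intro sum.cong) auto
      also have "\<dots> = ennreal (\<Sum>k\<in>K j. pbar I (a j) k * overtakes k j \<alpha>)"
        using nn by (rule sum_ennreal)
      finally show "ennreal (wt I j * (tp j (\<alpha> j) +
        (\<Sum>k\<in>K j. pbar I (a j) k * overtakes k j \<alpha>) + pbar I (a j) j)) = F j \<alpha>"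
        using wt_ge_0[OF j] tp_nonneg[OF j] pos[OF j j] sum_nonneg[OF nn, of "K j"]
        by (simp add: F_def ennreal_mult' ennreal_plus[symmetric] del: ennreal_plus)
    qed
    finally show ?case .
  qed
  then have "cost_GA_RSOS I tie a \<le> (\<integral>\<^sup>+\<alpha>. (\<Sum>j<n. F j \<alpha>) \<partial>?A)"
    unfolding cost_GA_RSOS_def randomized_exp_cost_def by (rule nn_integral_mono_AE)
  also have "\<dots> = (\<Sum>j<n. \<integral>\<^sup>+\<alpha>. F j \<alpha> \<partial>?A)"
  proof (intro nn_integral_sum)
    fix j assume "j \<in> {..<n}"
    then have j: "j < n" by simp
    show "F j \<in> borel_measurable ?A"
      unfolding F_def[abs_def]
      by (intro borel_measurable_times_ennreal[OF borel_measurable_const] borel_measurable_add borel_measurable_const borel_measurable_sum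
          overtakes_measurable[OF j Kn(1)] measurable_compose[OF measurable_tp_component[OF j] measurable_ennreal])
  qed
  also have "\<dots> \<le> (\<Sum>j<n. ennreal (wt I j * (2 * mbt j + pbar I (a j) j)))"
  proof (intro sum_mono)
    fix j assume "j \<in> {..<n}"
    then have j: "j < n" by simp
    interpret G: greedy_schedule "jobs_on a (a j)" "pbar I (a j)" "rel I" "final_schedule (a j)"
      by (rule final_greedy_schedule[OF a_less[OF j]])
    note [measurable] = measurable_tp_component[OF j] measurable_tp[OF j]
    have mK[measurable]: "(\<lambda>\<alpha>. tp k (\<alpha> k)) \<in> borel_measurable ?A" if "k \<in> K j" for k
      using measurable_tp_component Kn(1)[OF that] .
    let ?o = "\<lambda>k \<alpha>. ennreal (pbar I (a j) k) * overtakes k j \<alpha>"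
    have mo: "?o k \<in> borel_measurable ?A" if "k \<in> K j" for k
      by (rule overtakes_measurable[OF j Kn(1)[OF that]])
    have sp: "emeasure ?A (space ?A) = 1"
      unfolding alpha_distribution_def by (intro prob_space.emeasure_space_1 prob_space_PiM prob_space_unit_uniform)
    have pm[measurable]: "processed (final_schedule (a j)) k \<in> borel_measurable borel" for k
      by (intro borel_measurable_continuous_onI G.continuous_on_processed)
    have o: "(\<integral>\<^sup>+\<alpha>. ?o k \<alpha> \<partial>?A) = (\<integral>\<^sup>+\<beta>. ennreal (processed (final_schedule (a j)) k (tp j \<beta>)) \<partial>unit_uniform)" if k: "k \<in> K j" for k
    proof -
      have "(\<integral>\<^sup>+\<alpha>. ?o k \<alpha> \<partial>?A) = ennreal (pbar I (a j) k) * (\<integral>\<^sup>+\<alpha>. overtakes k j \<alpha> \<partial>?A)"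
        using overtakes_measurable[OF j Kn(1)[OF k], of 1] by (intro nn_integral_cmult) simp
      also have "\<dots> = (\<integral>\<^sup>+\<beta>. ennreal (pbar I (a j) k) * ennreal (processed (final_schedule (a j)) k (tp j \<beta>) / pbar I (a j) k) \<partial>unit_uniform)"
        unfolding nn_integral_overtakes[OF j Kn[OF k]] by (intro nn_integral_cmult[symmetric]) measurable
      also have "\<dots> = (\<integral>\<^sup>+\<beta>. ennreal (processed (final_schedule (a j)) k (tp j \<beta>)) \<partial>unit_uniform)"
        using pos[OF j Kn(1)[OF k]] by (intro nn_integral_cong) (simp add: ennreal_mult'[symmetric])
      finally show ?thesis .
    qed
    have "(\<Sum>k\<in>K j. \<integral>\<^sup>+\<alpha>. ?o k \<alpha> \<partial>?A) =
        (\<Sum>k\<in>K j. \<integral>\<^sup>+\<beta>. ennreal (processed (final_schedule (a j)) k (tp j \<beta>)) \<partial>unit_uniform)"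
      using o by (rule sum.cong[OF refl])
    also have "\<dots> = (\<integral>\<^sup>+\<beta>. (\<Sum>k\<in>K j. ennreal (processed (final_schedule (a j)) k (tp j \<beta>))) \<partial>unit_uniform)"
      by (intro nn_integral_sum[symmetric]) measurable
    \<comment> \<open>One machine cannot have processed more than the elapsed time, so the expected
      length of the queue ahead of \<open>j\<close> is at most the expected queue time, which is
      \<open>mbt j\<close>. With the queue time itself this gives the term
      \<open>2 * mbt j\<close>.\<close>
    also have "\<dots> \<le> (\<integral>\<^sup>+\<beta>. ennreal (tp j \<beta>) \<partial>unit_uniform)"
    proof (intro nn_integral_mono)
      fix \<beta> :: real
      have "(\<Sum>k\<in>K j. ennreal (processed (final_schedule (a j)) k (tp j \<beta>))) = ennreal (\<Sum>k\<in>K j. processed (final_schedule (a j)) k (tp j \<beta>))"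
        using G.processed_nonneg by (intro sum_ennreal)
      also have "\<dots> \<le> ennreal (tp j \<beta>)"
        using tp_nonneg[OF j] by (intro ennreal_leI G.sum_processed_le) (auto simp: K_def)
      finally show "(\<Sum>k\<in>K j. ennreal (processed (final_schedule (a j)) k (tp j \<beta>))) \<le> ennreal (tp j \<beta>)" .
    qed
    finally have so: "(\<Sum>k\<in>K j. \<integral>\<^sup>+\<alpha>. ?o k \<alpha> \<partial>?A) \<le> ennreal (mbt j)" using nn_integral_tp[OF j] by simp
    have t1: "(\<integral>\<^sup>+\<alpha>. ennreal (tp j (\<alpha> j)) \<partial>?A) = ennreal (mbt j)"
      unfolding alpha_distribution_def using j
      by (subst nn_integral_alpha_component[where f="\<lambda>\<beta>. ennreal (tp j \<beta>)"]) (auto simp: nn_integral_tp)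
    have "(\<integral>\<^sup>+\<alpha>. F j \<alpha> \<partial>?A) = ennreal (wt I j) * (\<integral>\<^sup>+\<alpha>. ennreal (tp j (\<alpha> j)) + (\<Sum>k\<in>K j. ?o k \<alpha>) + ennreal (pbar I (a j) j) \<partial>?A)"
      unfolding F_def using mo by (intro nn_integral_cmult) measurable
    also have "(\<integral>\<^sup>+\<alpha>. ennreal (tp j (\<alpha> j)) + (\<Sum>k\<in>K j. ?o k \<alpha>) + ennreal (pbar I (a j) j) \<partial>?A) =
        (\<integral>\<^sup>+\<alpha>. ennreal (tp j (\<alpha> j)) \<partial>?A) + (\<integral>\<^sup>+\<alpha>. (\<Sum>k\<in>K j. ?o k \<alpha>) \<partial>?A) + (\<integral>\<^sup>+\<alpha>. ennreal (pbar I (a j) j) \<partial>?A)"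
    proof -
      have 1: "(\<lambda>\<alpha>. \<Sum>k\<in>K j. ?o k \<alpha>) \<in> borel_measurable ?A" using mo by (rule borel_measurable_sum)
      have 2: "(\<lambda>\<alpha>. ennreal (tp j (\<alpha> j))) \<in> borel_measurable ?A" by measurable
      show ?thesis
        by (subst nn_integral_add[OF borel_measurable_add[OF 2 1] borel_measurable_const], subst nn_integral_add[OF 2 1]) (rule refl)
    qed
    also have "(\<integral>\<^sup>+\<alpha>. (\<Sum>k\<in>K j. ?o k \<alpha>) \<partial>?A) = (\<Sum>k\<in>K j. \<integral>\<^sup>+\<alpha>. ?o k \<alpha> \<partial>?A)"
      using mo by (rule nn_integral_sum)
    also have "ennreal (wt I j) * ((\<integral>\<^sup>+\<alpha>. ennreal (tp j (\<alpha> j)) \<partial>?A) + (\<Sum>k\<in>K j. \<integral>\<^sup>+\<alpha>. ?o k \<alpha> \<partial>?A) + (\<integral>\<^sup>+\<alpha>. ennreal (pbar I (a j) j) \<partial>?A)) \<le>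
        ennreal (wt I j) * (ennreal (mbt j) + ennreal (mbt j) + ennreal (pbar I (a j) j))"
      using so t1 by (intro mult_left_mono add_mono) (auto simp: sp)
    also have "\<dots> = ennreal (wt I j * (2 * mbt j + pbar I (a j) j))"
    proof -
      have "ennreal (2 * mbt j + pbar I (a j) j) = ennreal (mbt j + mbt j + pbar I (a j) j)" by simp
      also have "\<dots> = ennreal (mbt j) + ennreal (mbt j) + ennreal (pbar I (a j) j)"
        using pos[OF j j] mbt_nonneg[OF j] by (simp only: ennreal_plus add_nonneg_nonneg less_imp_le)
      finally show ?thesis using wt_ge_0[OF j] by (simp only: ennreal_mult')
    qed
    finally show "(\<integral>\<^sup>+\<alpha>. F j \<alpha> \<partial>?A) \<le> ennreal (wt I j * (2 * mbt j + pbar I (a j) j))" .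
  qed
  also have "\<dots> = ennreal (2 * total_virtual_cost)"
  proof -
    have mb: "0 \<le> wt I j * (2 * mbt j + pbar I (a j) j)" if j: "j < n" for j
      using pos[OF j j] wt_ge_0[OF j] mbt_nonneg[OF j] by (intro mult_nonneg_nonneg) auto
    have "(\<Sum>j<n. ennreal (wt I j * (2 * mbt j + pbar I (a j) j))) = ennreal (\<Sum>j<n. wt I j * (2 * mbt j + pbar I (a j) j))"
      using mb by (intro sum_ennreal) auto
    also have "(\<Sum>j<n. wt I j * (2 * mbt j + pbar I (a j) j)) =
        (\<Sum>i<m. \<Sum>j\<in>jobs_on a i. wt I j * (2 * mean_busy_time I i (final_schedule i) j + pbar I i j))"
      using sum_by_machine[where b=a and f="\<lambda>i j. wt I j * (2 * mean_busy_time I i (final_schedule i) j + pbar I i j)", OF a_less] by simp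
    also have "\<dots> = 2 * total_virtual_cost"
      unfolding total_virtual_cost_def virtual_cost_def sum_distrib_left
      by (intro sum.cong refl) (simp add: algebra_simps)
    finally show ?thesis .
  qed
  finally show ?thesis .
qed

end

section \<open>Averaging over random seeds and the final bounds\<close>

text \<open>Moving \<open>C\<close> into the integral would call for measurability of
  \<open>f\<close>, here the cost as a function of the seed. Dividing the constant \<open>V\<close>
  by \<open>C\<close> beforehand leaves a comparison that follows from monotonicity.\<close>

lemma ennreal_mult_nn_integral_lower_bound:
  assumes "prob_space N" "0 < C" "\<And>u. u \<in> space N \<Longrightarrow> ennreal V \<le> ennreal C * f u"
  shows "ennreal V \<le> ennreal C * (\<integral>\<^sup>+u. f u \<partial>N)"
proof -
  have V: "ennreal V = ennreal C * ennreal (V / C)"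
    using assms(2) by (simp add: ennreal_mult'[symmetric])
  have "ennreal (V / C) \<le> f u" if "u \<in> space N" for u
    using assms(3)[OF that] assms(2) unfolding V by (simp add: ennreal_mult_le_mult_iff)
  then have "(\<integral>\<^sup>+u. ennreal (V / C) \<partial>N) \<le> (\<integral>\<^sup>+u. f u \<partial>N)" by (rule nn_integral_mono)
  then have "ennreal (V / C) \<le> (\<integral>\<^sup>+u. f u \<partial>N)"
    using prob_space.emeasure_space_1[OF assms(1)] by simp
  then show ?thesis unfolding V by (rule mult_left_mono) simp
qed

lemma scheduling_policy_seed:
  assumes "sos_instance I" "scheduling_policy I N pol" "u \<in> space N"
  shows "sos_policy I (pol u)"
proof
  show "(\<lambda>p. pol u p j) \<in> realizations I \<rightarrow>\<^sub>M count_space UNIV \<Otimes>\<^sub>M borel" if "j < njobs I" for j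
    using measurable_compose_Pair1[OF assms(3), of "\<lambda>(u, p). pol u p j"] assms(2) that
    by (auto simp: scheduling_policy_def)
qed (use assms in \<open>auto simp: scheduling_policy_def\<close>)

text \<open>For a fixed seed all realizations give the same assignment, so it can be read off at the
  all-zero realization.\<close>

lemma fixed_assignment_policy_seed:
  assumes "sos_instance I" "fixed_assignment_policy I N FA" "u \<in> space N"
  shows "sos_fixed_assignment I (FA u) (\<lambda>j. fst (FA u (\<lambda>ik\<in>{..<nmach I} \<times> {..<njobs I}. 0) j))"
proof -
  interpret sos_policy I "FA u"
    using assms by (intro scheduling_policy_seed) (auto simp: fixed_assignment_policy_def)
  have "(\<lambda>ik\<in>{..<nmach I} \<times> {..<njobs I}. 0) \<in> space (realizations I)"
    by (auto simp: realizations_space)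
  then have "fst (FA u p j) = fst (FA u (\<lambda>ik\<in>{..<nmach I} \<times> {..<njobs I}. 0) j)"
    if "p \<in> space (realizations I)" "j < njobs I" for p j
    using assms(2,3) that unfolding fixed_assignment_policy_def by blast
  then show ?thesis by unfold_locales
qed

theorem theorem1:
  fixes I :: "'a sos" and \<Delta> :: real
    and tie :: "nat \<Rightarrow> nat \<Rightarrow> nat" and arr :: "nat \<Rightarrow> nat" and a :: "nat \<Rightarrow> nat"
  assumes "sos_instance I"
    and "sqCV_bounded I \<Delta>"
    and "tie_breaking I tie"
    and "arrival_order I arr"
    and "greedy_assignment I tie arr a"
  shows
    "(\<forall>(N :: 'u measure) pol. scheduling_policy I N pol \<longrightarrow>
        cost_GA_RSOS I tie a \<le> ennreal (8 + 4 * \<Delta>) * randomized_exp_cost I N pol) \<and>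
     (\<forall>(N :: 'u measure) FA. fixed_assignment_policy I N FA \<longrightarrow>
        cost_GA_RSOS I tie a \<le> 8 * randomized_exp_cost I N FA) \<and>
     (\<forall>(N :: 'u measure) pol. scheduling_policy I N pol \<longrightarrow>
        cost_GA_DSOS I tie a \<le> ennreal ((3 + sqrt 5) * (2 + \<Delta>)) * randomized_exp_cost I N pol) \<and>
     (\<forall>(N :: 'u measure) FA. fixed_assignment_policy I N FA \<longrightarrow>
        cost_GA_DSOS I tie a \<le> ennreal (2 * (3 + sqrt 5)) * randomized_exp_cost I N FA)"
proof -
  interpret sos_greedy I tie arr a by unfold_locales fact+
  let ?V = total_virtual_cost
  \<comment> \<open>The scaling \<open>c\<close> will be 2 for GA-RSOS and
    \<open>(3 + sqrt 5) / 2\<close> for GA-DSOS, the factors of the two upper bounds.\<close>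
  have policy: "ennreal (c * ?V) \<le> ennreal (c * (4 + 2 * \<Delta>)) * randomized_exp_cost I N pol"
    if c: "0 \<le> c" and pol: "scheduling_policy I N pol" for c and N :: "'u measure" and pol
  \<comment> \<open>If there is a job, its squared coefficient of variation forces
    \<open>\<Delta>\<close> to be nonnegative; without jobs, \<open>\<Delta>\<close> is
    unconstrained, but the virtual cost is 0.\<close>
  proof (cases "njobs I = 0")
    case True
    then show ?thesis by (simp add: total_virtual_cost_eq)
  next
    case False
    have "0 \<le> sqCV I (a 0) 0" by (simp add: sqCV_def)
    also have "\<dots> \<le> \<Delta>" using assms(2) a_less[of 0] False by (auto simp: sqCV_bounded_def)
    finally have \<Delta>: "0 \<le> \<Delta>" .
    have "ennreal ?V \<le> ennreal (4 + 2 * \<Delta>) * randomized_exp_cost I N pol"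
      unfolding randomized_exp_cost_def using pol \<Delta>
      by (intro ennreal_mult_nn_integral_lower_bound policy_lower_bound scheduling_policy_seed assms)
        (auto simp: scheduling_policy_def)
    then have "ennreal c * ennreal ?V \<le> ennreal c * (ennreal (4 + 2 * \<Delta>) * randomized_exp_cost I N pol)"
      by (rule mult_left_mono) simp
    then show ?thesis using c by (simp only: ennreal_mult' mult.assoc)
  qed
  have fixed: "ennreal (c * ?V) \<le> ennreal (c * 4) * randomized_exp_cost I N FA"
    if c: "0 \<le> c" and FA: "fixed_assignment_policy I N FA" for c and N :: "'u measure" and FA
  proof -
    have "ennreal ?V \<le> ennreal 4 * randomized_exp_cost I N FA"
      unfolding randomized_exp_cost_def
    proof (rule ennreal_mult_nn_integral_lower_bound)
      show "prob_space N" using FA by (simp add: fixed_assignment_policy_def scheduling_policy_def)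
      show "ennreal ?V \<le> ennreal 4 * exp_cost I (FA u)" if "u \<in> space N" for u
        using fixed_assignment_lower_bound[OF fixed_assignment_policy_seed[OF assms(1) FA that]] by simp
    qed simp
    then have "ennreal c * ennreal ?V \<le> ennreal c * (ennreal 4 * randomized_exp_cost I N FA)"
      by (rule mult_left_mono) simp
    then show ?thesis using c by (simp only: ennreal_mult' mult.assoc)
  qed
  have "0 \<le> (3 + sqrt 5) / 2" by simp
  note D = cost_GA_DSOS_le and R = cost_GA_RSOS_le
  have "cost_GA_RSOS I tie a \<le> ennreal (8 + 4 * \<Delta>) * randomized_exp_cost I N pol"
    if "scheduling_policy I N pol" for N :: "'u measure" and pol
    using order_trans[OF R policy[of 2, OF _ that]] by (simp add: algebra_simps)
  moreover have "cost_GA_RSOS I tie a \<le> 8 * randomized_exp_cost I N FA"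
    if "fixed_assignment_policy I N FA" for N :: "'u measure" and FA
    using order_trans[OF R fixed[of 2, OF _ that]] by simp
  moreover have "cost_GA_DSOS I tie a \<le> ennreal ((3 + sqrt 5) * (2 + \<Delta>)) * randomized_exp_cost I N pol"
    if "scheduling_policy I N pol" for N :: "'u measure" and pol
  proof -
    have "(3 + sqrt 5) / 2 * (4 + 2 * \<Delta>) = (3 + sqrt 5) * (2 + \<Delta>)" by (simp add: field_simps)
    then show ?thesis using order_trans[OF D policy[OF \<open>0 \<le> (3 + sqrt 5) / 2\<close> that]] by (simp only:)
  qed
  moreover have "cost_GA_DSOS I tie a \<le> ennreal (2 * (3 + sqrt 5)) * randomized_exp_cost I N FA"
    if "fixed_assignment_policy I N FA" for N :: "'u measure" and FA
  proof -
    have "(3 + sqrt 5) / 2 * 4 = 2 * (3 + sqrt 5)" by simp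
    then show ?thesis using order_trans[OF D fixed[OF \<open>0 \<le> (3 + sqrt 5) / 2\<close> that]] by (simp only:)
  qed
  ultimately show ?thesis by blast
qed

end
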